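(* Let a compact group $G$ act continuously on the right of a locally compact Polish metric space $(X,d)$ by isometries. Let $q:X\to X/G$ be the natural quotient map, and let $a,b>0$ and $p\ge 1$. Then: (1) the map $q_\sharp:\mathcal{M}_p(X)\to\mathcal{M}_p(X/G)$ is onto, and furthermore for every $\nu^*\in\mathcal{M}_p(X/G)$ there exists $\mu\in\mathcal{M}_p^G(X)$ such that $q_\sharp\mu=\nu^*$; (2) $W_p^{a,b}(q_\sharp\mu,q_\sharp\nu)\le W_p^{a,b}(\mu,\nu)$ for every $\mu,\nu\in\mathcal{M}(X)$; (3) the map $q_\sharp:(\mathcal{M}^G(X),W_p^{a,b})\to(\mathcal{M}(X/G),W_p^{a,b})$ is an isometry; (4) the map $q_\sharp:(\mathcal{M}_p^G(X),W_p^{a,b})\to(\mathcal{M}_p(X/G),W_p^{a,b})$ is an isometry.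
   Context: A Polish metric space is a complete separable metric space. An isometry between metric spaces is a surjective distance-preserving map. The orbit space $X/G$, with elements $x^*=q(x)$, carries the metric $d_{X/G}(x^*,y^* ):=\inf_{g\in G}d(xg,y)$, for which it is a locally compact Polish metric space. For a Borel map $f:X\to Y$ and a Borel measure $\mu$ on $X$, $f_\sharp\mu(B):=\mu(f^{-1}(B))$. For a Polish metric space $(Y,d_Y)$: $\mathcal{M}(Y)$ is the set of nonnegative Borel measures on $Y$ with finite mass; $\mathcal{M}_p(Y)$ ($p\ge1$) is the set of $\mu\in\mathcal{M}(Y)$ with $\int_Y d_Y(y,y_0)^p\,d\mu(y)<\infty$ for some (equivalently any) $y_0\in Y$. A measure $\mu\in\mathcal{M}(X)$ is $G$-invariant if $\mu(Ag)=\mu(A)$ for all $g\in G$ and all Borel $A\subset X$; $\mathcal{M}^G(X)$ is the set of $G$-invariant $\mu\in\mathcal{M}(X)$ and $\mathcal{M}_p^G(X):=\mathcal{M}_p(X)\cap\mathcal{M}^G(X)$. For $\mu\in\mathcal{M}(Y)$, $|\mu|:=\mu(Y)$, and $|\mu-\nu|$ denotes the total variation mass of the signed measure $\mu-\nu$. For $\mu,\nu\in\mathcal{M}(Y)$ with $|\mu|=|\nu|$, $\Pi(\mu,\nu)$ is the set of Borel probability measures $\pi$ on $Y\times Y$ with $|\mu|\pi(A\times Y)=\mu(A)$ and $|\nu|\pi(Y\times B)=\nu(B)$ for all Borel $A,B$; for $\mu,\nu\in\mathcal{M}_p(Y)$ with $|\mu|=|\nu|$, $W_p(\mu,\nu):=\left(|\mu|\inf_{\pi\in\Pi(\mu,\nu)}\int_{Y\times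 Y}d_Y(x,y)^p\,d\pi(x,y)\right)^{1/p}$. The generalized Wasserstein distance on $\mathcal{M}(Y)$ is $$W_p^{a,b}(\mu,\nu):=\inf\{a|\mu-\widetilde\mu|+a|\nu-\widetilde\nu|+b\,W_p(\widetilde\mu,\widetilde\nu)\;:\;\widetilde\mu,\widetilde\nu\in\mathcal{M}_p(Y),\ |\widetilde\mu|=|\widetilde\nu|\}.$$ *)

theory Defs
  imports "HOL-Probability.Probability"
begin

section \<open>Measures on a metric space\<close>

text \<open>
  A metric space is given by a carrier \<open>Y\<close> together with a distance \<open>d\<close>, in the style of the locale
  \<^locale>\<open>Metric_space\<close>.  This makes the same definitions available for \<open>(UNIV, dist)\<close> on a type
  of class \<^class>\<open>polish_space\<close> and for its orbit spaces, whose points are sets.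
\<close>

definition borel_of_top :: "'a topology \<Rightarrow> 'a measure" where
  "borel_of_top T = sigma (topspace T) {U. openin T U}"

definition borel_metric :: "'a set \<Rightarrow> ('a \<Rightarrow> 'a \<Rightarrow> real) \<Rightarrow> 'a measure" where
  "borel_metric Y d = borel_of_top (Metric_space.mtopology Y d)"

definition borel_metric2 :: "'a set \<Rightarrow> ('a \<Rightarrow> 'a \<Rightarrow> real) \<Rightarrow> ('a \<times> 'a) measure" where
  "borel_metric2 Y d =
     borel_of_top (prod_topology (Metric_space.mtopology Y d) (Metric_space.mtopology Y d))"

definition fin_measures :: "'a set \<Rightarrow> ('a \<Rightarrow> 'a \<Rightarrow> real) \<Rightarrow> 'a measure set" where
  "fin_measures Y d = {\<mu>. sets \<mu> = sets (borel_metric Y d) \<and> finite_measure \<mu>}"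

definition fin_measures_p :: "real \<Rightarrow> 'a set \<Rightarrow> ('a \<Rightarrow> 'a \<Rightarrow> real) \<Rightarrow> 'a measure set" where
  "fin_measures_p p Y d =
     {\<mu> \<in> fin_measures Y d. \<exists>y0\<in>Y. (\<integral>\<^sup>+ y. ennreal (d y y0 powr p) \<partial>\<mu>) < \<infinity>}"

definition mass :: "'a measure \<Rightarrow> real" where
  "mass \<mu> = measure \<mu> (space \<mu>)"

text \<open>
  Total variation mass of the signed measure \<open>\<mu> - \<nu>\<close>: the supremum over all finite measurable
  partitions of the space.
\<close>
definition tv_diff :: "'a measure \<Rightarrow> 'a measure \<Rightarrow> real" where
  "tv_diff \<mu> \<nu> =
     Sup {(\<Sum>A\<in>P. \<bar>measure \<mu> A - measure \<nu> A\<bar>) | P.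
            finite P \<and> P \<subseteq> sets \<mu> \<and> disjoint P \<and> \<Union>P = space \<mu>}"


section \<open>Wasserstein distances\<close>

definition couplings ::
    "'a set \<Rightarrow> ('a \<Rightarrow> 'a \<Rightarrow> real) \<Rightarrow> 'a measure \<Rightarrow> 'a measure \<Rightarrow> ('a \<times> 'a) measure set" where
  "couplings Y d \<mu> \<nu> =
     {\<pi>. sets \<pi> = sets (borel_metric2 Y d) \<and> prob_space \<pi> \<and>
         (\<forall>A\<in>sets (borel_metric Y d). mass \<mu> * measure \<pi> (A \<times> Y) = measure \<mu> A) \<and>
         (\<forall>B\<in>sets (borel_metric Y d). mass \<nu> * measure \<pi> (Y \<times> B) = measure \<nu> B)}"

text \<open>Used only for \<open>\<mu>\<close>, \<open>\<nu>\<close> of equal mass with finite \<open>p\<close>-th moment, where the value is finite.\<close>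
definition wasserstein ::
    "real \<Rightarrow> 'a set \<Rightarrow> ('a \<Rightarrow> 'a \<Rightarrow> real) \<Rightarrow> 'a measure \<Rightarrow> 'a measure \<Rightarrow> real" where
  "wasserstein p Y d \<mu> \<nu> =
     (enn2real (ennreal (mass \<mu>) *
        (INF \<pi>\<in>couplings Y d \<mu> \<nu>. \<integral>\<^sup>+ z. ennreal (d (fst z) (snd z) powr p) \<partial>\<pi>))) powr (1 / p)"

definition gen_wasserstein ::
    "real \<Rightarrow> real \<Rightarrow> real \<Rightarrow> 'a set \<Rightarrow> ('a \<Rightarrow> 'a \<Rightarrow> real) \<Rightarrow> 'a measure \<Rightarrow> 'a measure \<Rightarrow> real" where
  "gen_wasserstein a b p Y d \<mu> \<nu> =
     Inf {a * tv_diff \<mu> \<mu>' + a * tv_diff \<nu> \<nu>' + b * wasserstein p Y d \<mu>' \<nu>' | \<mu>' \<nu>'.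
            \<mu>' \<in> fin_measures_p p Y d \<and> \<nu>' \<in> fin_measures_p p Y d \<and> mass \<mu>' = mass \<nu>'}"

definition isometry_between ::
    "'a set \<Rightarrow> ('a \<Rightarrow> 'a \<Rightarrow> real) \<Rightarrow> 'b set \<Rightarrow> ('b \<Rightarrow> 'b \<Rightarrow> real) \<Rightarrow> ('a \<Rightarrow> 'b) \<Rightarrow> bool" where
  "isometry_between A dA B dB f \<longleftrightarrow>
     f ` A = B \<and> (\<forall>x\<in>A. \<forall>y\<in>A. dB (f x) (f y) = dA x y)"


section \<open>Right actions and orbit spaces\<close>

text \<open>
  The library's class of (not necessarily commutative) topological groups is
  \<^class>\<open>topological_group_add\<close>, so the group operation is written additively and \<open>act x g\<close> is
  the point \<open>x g\<close>.
\<close>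

definition right_action :: "('a \<Rightarrow> 'g::group_add \<Rightarrow> 'a) \<Rightarrow> bool" where
  "right_action act \<longleftrightarrow>
     (\<forall>x. act x 0 = x) \<and> (\<forall>x g h. act x (g + h) = act (act x g) h)"

definition orbit_map :: "('a \<Rightarrow> 'g \<Rightarrow> 'a) \<Rightarrow> 'a \<Rightarrow> 'a set" where
  "orbit_map act x = range (act x)"

definition orbit_space :: "('a \<Rightarrow> 'g \<Rightarrow> 'a) \<Rightarrow> 'a set set" where
  "orbit_space act = range (orbit_map act)"

text \<open>
  The distance is computed with chosen representatives; lemma \<open>orbit_dist_orbit_map\<close> below shows
  that the choice is irrelevant for actions by isometries.
\<close>
definition orbit_dist :: "('a::metric_space \<Rightarrow> 'g \<Rightarrow> 'a) \<Rightarrow> 'a set \<Rightarrow> 'a set \<Rightarrow> real" where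
  "orbit_dist act P Q = (INF g. dist (act (SOME x. x \<in> P) g) (SOME y. y \<in> Q))"

definition push_orbit ::
    "('a::metric_space \<Rightarrow> 'g \<Rightarrow> 'a) \<Rightarrow> 'a measure \<Rightarrow> 'a set measure" where
  "push_orbit act \<mu> = distr \<mu> (borel_metric (orbit_space act) (orbit_dist act)) (orbit_map act)"

definition inv_measures :: "('a::metric_space \<Rightarrow> 'g \<Rightarrow> 'a) \<Rightarrow> 'a measure set" where
  "inv_measures act =
     {\<mu> \<in> fin_measures UNIV dist.
        \<forall>g. \<forall>A\<in>sets \<mu>. emeasure \<mu> ((\<lambda>x. act x g) ` A) = emeasure \<mu> A}"

definition inv_measures_p :: "real \<Rightarrow> ('a::metric_space \<Rightarrow> 'g \<Rightarrow> 'a) \<Rightarrow> 'a measure set" where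
  "inv_measures_p p act = fin_measures_p p UNIV dist \<inter> inv_measures act"


section \<open>Consistency of the definitions\<close>

lemma borel_metric_dist: "borel_metric UNIV dist = (borel :: 'a::metric_space measure)"
  by (simp add: borel_metric_def borel_of_top_def borel_def)

lemma borel_metric2_dist:
  "borel_metric2 UNIV dist = (borel :: ('a::metric_space \<times> 'a) measure)"
  by (simp add: borel_metric2_def borel_of_top_def borel_def)

lemma right_action_inverse:
  assumes "right_action act" shows "act (act x g) (- g) = x"
  using assms unfolding right_action_def by (metis right_minus)

lemma orbit_map_eq_iff:
  assumes "right_action act"
  shows "orbit_map act x = orbit_map act y \<longleftrightarrow> y \<in> orbit_map act x"
proof
  show "y \<in> orbit_map act x" if "orbit_map act x = orbit_map act y"
    using that assms unfolding orbit_map_def right_action_def by (metis rangeI)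
next
  assume "y \<in> orbit_map act x"
  then obtain g where y: "y = act x g" by (auto simp: orbit_map_def)
  have "act x h = act y (- g + h)" for h
    using assms right_action_inverse[OF assms] y unfolding right_action_def by metis
  moreover have "act y h = act x (g + h)" for h
    using assms y unfolding right_action_def by metis
  ultimately show "orbit_map act x = orbit_map act y"
    unfolding orbit_map_def by blast
qed

lemma orbit_dist_orbit_map:
  fixes act :: "'a::metric_space \<Rightarrow> 'g::group_add \<Rightarrow> 'a"
  assumes ra: "right_action act" and iso: "\<And>x y g. dist (act x g) (act y g) = dist x y"
  shows "orbit_dist act (orbit_map act x) (orbit_map act y) = (INF g. dist (act x g) y)"
proof -
  have ne: "orbit_map act z \<noteq> {}" for z
    by (simp add: orbit_map_def)
  obtain g0 where g0: "(SOME z. z \<in> orbit_map act x) = act x g0"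
    using someI_ex[of "\<lambda>z. z \<in> orbit_map act x"] ne[of x] by (auto simp: orbit_map_def)
  obtain h0 where h0: "(SOME z. z \<in> orbit_map act y) = act y h0"
    using someI_ex[of "\<lambda>z. z \<in> orbit_map act y"] ne[of y] by (auto simp: orbit_map_def)
  have comp: "act x (g + h) = act (act x g) h" for x g h
    using ra by (simp add: right_action_def)
  have e1: "dist (act (act x g0) g) (act y h0) = dist (act x (g0 + g + - h0)) y" for g
    using iso[of "act (act x g0) g" "- h0" "act y h0"] right_action_inverse[OF ra, of y h0]
    by (simp only: comp)
  have "range (\<lambda>g. dist (act (act x g0) g) (act y h0)) = range (\<lambda>g. dist (act x g) y)"
  proof -
    have "dist (act x g) y = dist (act (act x g0) (- g0 + g + h0)) (act y h0)" for g
      unfolding e1 by (simp add: add.assoc[symmetric])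
    with e1 show ?thesis by (fastforce simp del: add_uminus_conv_diff)
  qed
  then show ?thesis
    unfolding orbit_dist_def g0 h0 by simp
qed

lemma Metric_space_orbit_space:
  fixes act :: "'a::metric_space \<Rightarrow> 'g::topological_group_add \<Rightarrow> 'a"
  assumes ra: "right_action act" and iso: "\<And>x y g. dist (act x g) (act y g) = dist x y"
    and cpt: "compact (UNIV :: 'g set)"
    and cont: "continuous_on UNIV (\<lambda>(x, g). act x g)"
  shows "Metric_space (orbit_space act) (orbit_dist act)"
proof -
  have comp: "act x (g + h) = act (act x g) h" for x g h
    using ra by (simp add: right_action_def)
  have cx: "continuous_on UNIV (\<lambda>g. dist (act x g) y)" for x y
  proof -
    have "continuous_on UNIV (\<lambda>g. (\<lambda>(x, g). act x g) (x, g))"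
      by (rule continuous_on_compose2[OF cont]) (auto intro!: continuous_intros)
    then show ?thesis by (auto intro!: continuous_intros)
  qed
  note od = orbit_dist_orbit_map[OF ra iso]
  have bd: "bdd_below (range (\<lambda>g. dist (act x g) y))" for x y
    by (rule bdd_belowI[of _ 0]) auto
  have att: "\<exists>g. orbit_dist act (orbit_map act x) (orbit_map act y) = dist (act x g) y" for x y
  proof -
    obtain g where "\<forall>h. dist (act x g) y \<le> dist (act x h) y"
      using continuous_attains_inf[OF cpt _ cx[of x y]] by auto
    then have "(INF h. dist (act x h) y) = dist (act x g) y"
      by (intro cInf_eq_minimum) auto
    then show ?thesis unfolding od by blast
  qed
  have le: "orbit_dist act (orbit_map act x) (orbit_map act y) \<le> dist (act x g) y" for x y g
    unfolding od by (rule cINF_lower[OF bd]) simp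
  have sym_le: "orbit_dist act (orbit_map act x) (orbit_map act y)
      \<le> orbit_dist act (orbit_map act y) (orbit_map act x)" for x y
  proof -
    obtain g where g: "orbit_dist act (orbit_map act y) (orbit_map act x) = dist (act y g) x"
      using att by blast
    have "dist (act y g) x = dist (act x (- g)) y"
      using iso[of "act y g" "- g" x] right_action_inverse[OF ra, of y g]
      by (simp add: dist_commute)
    then show ?thesis using le[of x y "- g"] g by simp
  qed
  show ?thesis
  proof
    fix P Q :: "'a set"
    show "0 \<le> orbit_dist act P Q"
      unfolding orbit_dist_def by (rule cINF_greatest) auto
  next
    fix P Q :: "'a set"
    let ?p = "SOME x. x \<in> P" and ?q = "SOME x. x \<in> Q"
    have gen: "(INF g. dist (act x g) y) = (INF g. dist (act y g) x)" for x y
      using sym_le[of x y] sym_le[of y x] unfolding od by linarith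
    show "orbit_dist act P Q = orbit_dist act Q P"
      unfolding orbit_dist_def by (rule gen)
  next
    fix P Q assume "P \<in> orbit_space act" "Q \<in> orbit_space act"
    then obtain x y where P: "P = orbit_map act x" and Q: "Q = orbit_map act y"
      by (auto simp: orbit_space_def)
    show "orbit_dist act P Q = 0 \<longleftrightarrow> P = Q"
    proof
      assume "orbit_dist act P Q = 0"
      then obtain g where "dist (act x g) y = 0" using att[of x y] P Q by metis
      then have "y \<in> orbit_map act x" by (auto simp: orbit_map_def)
      then show "P = Q" using orbit_map_eq_iff[OF ra] P Q by blast
    next
      assume "P = Q"
      have "orbit_dist act P P \<le> dist (act x 0) x" unfolding P by (rule le)
      also have "\<dots> = 0" using ra by (simp add: right_action_def)
      finally have "orbit_dist act P P \<le> 0" .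
      moreover have "0 \<le> orbit_dist act P P"
        unfolding orbit_dist_def by (rule cINF_greatest) auto
      ultimately show "orbit_dist act P Q = 0" using \<open>P = Q\<close> by simp
    qed
  next
    fix P Q R assume "P \<in> orbit_space act" "Q \<in> orbit_space act" "R \<in> orbit_space act"
    then obtain x y z where P: "P = orbit_map act x" and Q: "Q = orbit_map act y"
      and R: "R = orbit_map act z"
      by (auto simp: orbit_space_def)
    obtain g h where g: "orbit_dist act P Q = dist (act x g) y"
      and h: "orbit_dist act Q R = dist (act y h) z"
      using att P Q R by metis
    have "orbit_dist act P R \<le> dist (act x (g + h)) z" unfolding P R by (rule le)
    also have "\<dots> \<le> dist (act (act x g) h) (act y h) + dist (act y h) z"
      unfolding comp by (rule dist_triangle)
    finally show "orbit_dist act P R \<le> orbit_dist act P Q + orbit_dist act Q R"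
      using g h iso by simp
  qed
qed

lemma measurable_orbit_map:
  fixes act :: "'a::metric_space \<Rightarrow> 'g::topological_group_add \<Rightarrow> 'a"
  assumes ra: "right_action act" and iso: "\<And>x y g. dist (act x g) (act y g) = dist x y"
    and cpt: "compact (UNIV :: 'g set)"
    and cont: "continuous_on UNIV (\<lambda>(x, g). act x g)"
  shows "orbit_map act \<in> borel \<rightarrow>\<^sub>M borel_metric (orbit_space act) (orbit_dist act)"
proof -
  interpret Q: Metric_space "orbit_space act" "orbit_dist act"
    by (rule Metric_space_orbit_space[OF assms])
  have le: "orbit_dist act (orbit_map act x) (orbit_map act y) \<le> dist x y" for x y
  proof -
    have "(INF g. dist (act x g) y) \<le> dist (act x 0) y"
      by (rule cINF_lower[OF bdd_belowI[of _ 0]]) auto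
    then show ?thesis
      using ra by (simp add: orbit_dist_orbit_map[OF ra iso] right_action_def)
  qed
  have in_space: "orbit_map act x \<in> orbit_space act" for x
    by (simp add: orbit_space_def)
  show ?thesis
    unfolding borel_metric_def borel_of_top_def
  proof (rule measurable_measure_of)
    fix U assume "U \<in> {U. openin Q.mtopology U}"
    then have U: "openin Q.mtopology U" by simp
    have "open (orbit_map act -` U)"
      unfolding open_dist
    proof
      fix x assume "x \<in> orbit_map act -` U"
      then obtain r where r: "r > 0" "Q.mball (orbit_map act x) r \<subseteq> U"
        using U by (auto simp: Q.openin_mtopology)
      have "orbit_map act y \<in> U" if "dist y x < r" for y
        using r(2) le[of x y] that in_space by (auto simp: dist_commute)
      then show "\<exists>e>0. \<forall>y. dist y x < e \<longrightarrow> y \<in> orbit_map act -` U"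
        using r(1) by auto
    qed
    then show "orbit_map act -` U \<inter> space borel \<in> sets borel" by simp
  qed (use in_space openin_subset[of Q.mtopology] in auto)
qed

end

theory Submission
  imports Defs
begin

text \<open>Write \<open>q\<close> for the orbit map.  The whole theorem comes from one right inverse of \<open>q\<^sub>\<sharp>\<close>: given a
measure \<open>\<nu>\<close> on the orbit space, choose an orbit according to \<open>\<nu>\<close> and then a point of that orbit
uniformly, that is, according to the law of \<open>x g\<close> for a Haar distributed \<open>g\<close>.  Two-sided invariance
of the Haar measure makes this law depend on the orbit of \<open>x\<close> only and makes the resulting measure,
called \<open>lift \<nu>\<close>, invariant.  A Fubini argument shows that, conversely, an invariant measure is
the lift of its own image (lemma \<open>lift_push\<close>), so \<open>lift\<close> inverts \<open>q\<^sub>\<sharp>\<close> on invariant measures.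

Both \<open>q\<^sub>\<sharp>\<close> and \<open>lift\<close> are given by Markov kernels, and Markov kernels do not increase total
variation (theorem \<open>tv_diff_bind_le\<close>).  For the transport term, \<open>q\<close> is 1-Lipschitz, so couplings can
be pushed down to the orbit space without raising the cost.  In the other direction, a coupling of two
measures on the orbit space is lifted by choosing representatives of both orbits,
moving the first representative by a group element that nearly realises the distance of the two
orbits, and then moving both points by one common Haar distributed group element.  The last step
leaves the cost unchanged, as the group acts by isometries, and it turns both marginals into the
lifts of the given marginals (lemma \<open>couplings_lift\<close>).  Hence \<open>lift\<close> preserves the
Wasserstein distance exactly.  Comparing the competitors in the two infima that define the
generalized distance gives \<open>\<le>\<close> for all measures and equality for invariant ones; the statements on
surjectivity hold because \<open>lift\<close> preserves invariance and finite \<open>p\<close>-th moments.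

Only three properties of the Haar measure enter: it is a probability measure, it is invariant on
both sides, and continuous real functions are measurable.  Such a measure is constructed below for every
compact topological group.  Numbers of translates needed to cover a set yield a finitely subadditive,
invariant set function that is additive on separated sets, and Caratheodory's method turns it into
a measure.\<close>

section \<open>Haar measure on a compact group\<close>

text \<open>The tube lemma for a compact first factor, in the form in which it turns pointwise continuity into
continuity that is uniform over the group.\<close>

lemma compact_imp_eventually_all:
  fixes O' :: "('g::topological_space \<times> 'h::topological_space) set"
  assumes "compact (UNIV :: 'g set)" and "open O'" and "\<And>g. (g, h0) \<in> O'"
  shows "eventually (\<lambda>h. \<forall>g. (g, h) \<in> O') (nhds h0)"
proof -
  have "\<exists>A B. open A \<and> open B \<and> g \<in> A \<and> h0 \<in> B \<and> A \<times> B \<subseteq> O'" for g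
    using open_prod_elim[OF assms(2) assms(3)[of g]] by (metis mem_Sigma_iff)
  then obtain A B where AB: "\<And>g. open (A g)" "\<And>g. open (B g)" "\<And>g. g \<in> A g" "\<And>g. h0 \<in> B g"
      "\<And>g. A g \<times> B g \<subseteq> O'" by metis
  obtain T where T: "finite T" "UNIV \<subseteq> (\<Union>g\<in>T. A g)"
    using compactE_image[OF assms(1), of UNIV A] AB(1,3) by (metis UNIV_I UNIV_eq_I UN_iff subset_UNIV)
  have "eventually (\<lambda>h. \<forall>g\<in>T. h \<in> B g) (nhds h0)"
    using T(1) AB(2,4) by (simp add: eventually_ball_finite eventually_nhds_in_open)
  then show ?thesis
  proof eventually_elim
    case (elim h)
    then show ?case using T(2) AB(5) by blast
  qed
qed

text \<open>The cube \<open>[0, 1]\<^sup>I\<close> is compact, so \<open>u\<close> has a cluster point \<open>l\<close>; refining the filter by the preimages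
of the neighbourhoods of \<open>l\<close> makes \<open>u\<close> converge in every coordinate at once.  This supplies a
limit of covering ratios for all subsets of the group simultaneously.\<close>

lemma bounded_functions_converge_along_filter:
  fixes u :: "'v \<Rightarrow> 'i \<Rightarrow> real"
  assumes "\<And>v i. u v i \<in> {0..1}" and "F0 \<noteq> bot"
  obtains F l where "F \<le> F0" "F \<noteq> bot" "\<And>i. ((\<lambda>v. u v i) \<longlongrightarrow> l i) F"
proof -
  have "compactin (product_topology (\<lambda>_::'i. euclidean) UNIV) (PiE UNIV (\<lambda>_. {0..1::real}))"
    by (subst compactin_PiE) simp
  then have c: "compact (PiE UNIV (\<lambda>_::'i. {0..1::real}))"
    by (simp add: euclidean_product_topology)
  obtain l where l: "inf (nhds l) (filtermap u F0) \<noteq> bot"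
  proof -
    have "\<exists>l\<in>PiE UNIV (\<lambda>_::'i. {0..1::real}). inf (nhds l) (filtermap u F0) \<noteq> bot"
      by (rule c[unfolded compact_filter, rule_format])
         (use assms in \<open>auto simp: filtermap_bot_iff eventually_filtermap PiE_def\<close>)
    then show ?thesis using that by blast
  qed
  define F where "F = inf (filtercomap u (nhds l)) F0"
  have "filtermap u F \<le> nhds l"
    unfolding F_def by (metis filtermap_filtercomap filtermap_mono inf_le1 order_trans)
  then have ul: "filterlim u (nhds l) F" by (simp add: filterlim_def)
  have "((\<lambda>v. u v i) \<longlongrightarrow> l i) F" for i
  proof -
    have "((\<lambda>f::'i \<Rightarrow> real. f i) \<longlongrightarrow> l i) (nhds l)"
    proof (rule topological_tendstoI)
      fix S :: "real set" assume "open S" "l i \<in> S"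
      then show "eventually (\<lambda>f. f i \<in> S) (nhds l)"
        using open_vimage[OF \<open>open S\<close> continuous_on_product_coordinates[of i]]
        unfolding eventually_nhds vimage_def by blast
    qed
    then show ?thesis using filterlim_compose ul by blast
  qed
  moreover have "F \<noteq> bot"
  proof
    assume "F = bot"
    then have "eventually (\<lambda>_. False) (inf (filtercomap u (nhds l)) F0)" by (simp add: F_def)
    then obtain P Q where PQ: "eventually P (nhds l)" "eventually Q F0" "\<And>v. P (u v) \<and> Q v \<Longrightarrow> False"
      unfolding eventually_inf eventually_filtercomap by metis
    have "eventually (\<lambda>f. \<not> P f) (filtermap u F0)"
      unfolding eventually_filtermap using PQ(2) by eventually_elim (use PQ(3) in blast)
    then have "eventually (\<lambda>_. False) (inf (nhds l) (filtermap u F0))"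
      unfolding eventually_inf using PQ(1) by metis
    then show False using l by (simp add: trivial_limit_def)
  qed
  ultimately show ?thesis using that[of F l] by (simp add: F_def)
qed

text \<open>Left translates of such a neighbourhood are also right translates of it, so covering numbers with
respect to it are invariant on both sides.\<close>

definition conj_inv_nhd :: "'g::topological_group_add set \<Rightarrow> bool" where
  "conj_inv_nhd V \<longleftrightarrow> eventually (\<lambda>v. v \<in> V) (nhds 0) \<and> (\<forall>k. \<forall>v\<in>V. - k + v + k \<in> V)"

text \<open>The set of all \<open>v\<close> whose conjugates all lie in \<open>W\<close> is closed under conjugation, and
by compactness of the group it still is a neighbourhood of \<open>0\<close>.\<close>

lemma conj_inv_nhd_base:
  fixes W :: "'g::topological_group_add set"
  assumes "compact (UNIV :: 'g set)" "open W" "0 \<in> W"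
  shows "\<exists>V\<subseteq>W. conj_inv_nhd V"
proof -
  define V where "V = {v. \<forall>k. - k + v + k \<in> W}"
  have c: "continuous_on UNIV (\<lambda>(k, v::'g). - k + v + k)"
    unfolding case_prod_beta by (intro continuous_on_add continuous_on_minus continuous_intros)
  have "open ((\<lambda>(k, v::'g). - k + v + k) -` W)"
    using assms(2) c by (simp add: open_vimage)
  from compact_imp_eventually_all[OF assms(1) this, of 0] assms(3)
  have "eventually (\<lambda>v. v \<in> V) (nhds 0)" by (simp add: V_def)
  moreover have "- k + v + k \<in> V" if "v \<in> V" for k v
  proof -
    have "- k' + (- k + v + k) + k' = - (k + k') + v + (k + k')" for k'
      by (simp add: minus_add add.assoc del: add_uminus_conv_diff)
    then show ?thesis using that by (simp add: V_def)
  qed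
  moreover have "V \<subseteq> W" unfolding V_def
  proof
    fix v assume "v \<in> {v. \<forall>k. - k + v + k \<in> W}"
    then have "- 0 + v + 0 \<in> W" by blast
    then show "v \<in> W" by simp
  qed
  ultimately show ?thesis unfolding conj_inv_nhd_def by blast
qed

definition covers_by :: "'g::group_add set \<Rightarrow> 'g set \<Rightarrow> 'g set \<Rightarrow> bool" where
  "covers_by V U S \<longleftrightarrow> finite S \<and> (\<forall>u\<in>U. \<exists>s\<in>S. - s + u \<in> V)"

definition covnum :: "'g::group_add set \<Rightarrow> 'g set \<Rightarrow> nat" where
  "covnum V U = (LEAST n. \<exists>S. covers_by V U S \<and> card S = n)"

lemma covnum_le: "covers_by V U S \<Longrightarrow> covnum V U \<le> card S"
  unfolding covnum_def by (rule Least_le) blast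

context
  fixes V :: "'g::topological_group_add set"
  assumes cpt: "compact (UNIV :: 'g set)" and V: "conj_inv_nhd V"
begin

lemma covers_by_exists: "\<exists>S. covers_by V U S"
proof -
  obtain B where B: "open B" "0 \<in> B" "B \<subseteq> V"
    using V unfolding conj_inv_nhd_def eventually_nhds by blast
  have o: "open ((\<lambda>u. - s + u) -` B)" for s :: 'g
    by (rule open_vimage[OF B(1)]) (intro continuous_on_add continuous_intros)
  obtain T :: "'g set" where T: "finite T" "UNIV \<subseteq> (\<Union>s\<in>T. (\<lambda>u. - s + u) -` B)"
  proof (rule compactE_image[OF cpt, of UNIV "\<lambda>s. (\<lambda>u. - s + u) -` B"])
    show "open ((\<lambda>u. - s + u) -` B)" for s by (rule o)
    show "UNIV \<subseteq> (\<Union>s. (\<lambda>u. - s + u) -` B)"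
    proof
      fix u :: 'g
      have "- u + u \<in> B" using B(2) by simp
      then show "u \<in> (\<Union>s. (\<lambda>u. - s + u) -` B)" by blast
    qed
  qed
  have "covers_by V U T" unfolding covers_by_def using T B(3) by blast
  then show ?thesis ..
qed

lemma covnum_cover: obtains S where "covers_by V U S" "card S = covnum V U"
  using LeastI_ex[of "\<lambda>n. \<exists>S. covers_by V U S \<and> card S = n"] covers_by_exists
  unfolding covnum_def by blast

lemma covnum_mono: "U \<subseteq> U' \<Longrightarrow> covnum V U \<le> covnum V U'"
  by (metis covnum_cover covnum_le covers_by_def subsetD)

lemma covnum_subadditive: "covnum V (U \<union> W) \<le> covnum V U + covnum V W"
proof -
  obtain S where S: "covers_by V U S" "card S = covnum V U" by (rule covnum_cover)
  obtain T where T: "covers_by V W T" "card T = covnum V W" by (rule covnum_cover)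
  have "covers_by V (U \<union> W) (S \<union> T)" using S(1) T(1) unfolding covers_by_def by blast
  then show ?thesis using covnum_le card_Un_le[of S T] S(2) T(2) by fastforce
qed

text \<open>When no translate of \<open>V\<close> meets both sets, a cover of the union splits into
disjoint covers of the two parts.\<close>

lemma covnum_superadditive:
  assumes "\<And>s u w. u \<in> U \<Longrightarrow> w \<in> W \<Longrightarrow> - s + u \<in> V \<Longrightarrow> - s + w \<in> V \<Longrightarrow> False"
  shows "covnum V U + covnum V W \<le> covnum V (U \<union> W)"
proof -
  obtain S where S: "covers_by V (U \<union> W) S" "card S = covnum V (U \<union> W)" by (rule covnum_cover)
  define A where "A = {s\<in>S. \<exists>u\<in>U. - s + u \<in> V}"
  define B where "B = {s\<in>S. \<exists>u\<in>W. - s + u \<in> V}"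
  have fin: "finite S" and sub: "A \<subseteq> S" "B \<subseteq> S"
    using S(1) by (auto simp: A_def B_def covers_by_def)
  then have "finite A" "finite B" by (auto intro: finite_subset)
  then have "covers_by V U A" "covers_by V W B"
    using S(1) unfolding A_def B_def covers_by_def by blast+
  then have "covnum V U + covnum V W \<le> card A + card B" by (intro add_mono covnum_le)
  also have "\<dots> = card (A \<union> B)"
    using assms \<open>finite A\<close> \<open>finite B\<close> by (intro card_Un_disjoint[symmetric]) (auto simp: A_def B_def)
  also have "\<dots> \<le> card S" using sub fin by (intro card_mono) auto
  finally show ?thesis using S(2) by simp
qed

lemma covnum_empty: "covnum V {} = 0"
  using covnum_le[of V "{}" "{}"] by (simp add: covers_by_def)

lemma covnum_UNIV_pos: "covnum V UNIV > 0"
proof -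
  obtain S where S: "covers_by V UNIV S" "card S = covnum V UNIV" by (rule covnum_cover)
  then have "S \<noteq> {}" "finite S" by (auto simp: covers_by_def)
  then show ?thesis using S(2) card_gt_0_iff by metis
qed

lemma covnum_left_le: "covnum V ((\<lambda>g. k + g) ` U) \<le> covnum V U"
proof -
  obtain S where S: "covers_by V U S" "card S = covnum V U" by (rule covnum_cover)
  have "covers_by V ((\<lambda>g. k + g) ` U) ((\<lambda>g. k + g) ` S)"
    using S(1) by (simp add: covers_by_def minus_add add.assoc del: add_uminus_conv_diff)
  then show ?thesis using covnum_le card_image_le S unfolding covers_by_def by (metis order_trans)
qed

text \<open>Translating a cover by \<open>k\<close> on the right replaces \<open>s + V\<close> by
\<open>s + V + k = (s + k) + (- k + V + k)\<close>, and the last set is contained in \<open>(s + k) + V\<close>.\<close>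

lemma covnum_right_le: "covnum V ((\<lambda>g. g + k) ` U) \<le> covnum V U"
proof -
  obtain S where S: "covers_by V U S" "card S = covnum V U" by (rule covnum_cover)
  have "covers_by V ((\<lambda>g. g + k) ` U) ((\<lambda>g. g + k) ` S)"
    unfolding covers_by_def
  proof (intro conjI ballI)
    show "finite ((\<lambda>g. g + k) ` S)" using S(1) by (simp add: covers_by_def)
    fix u assume "u \<in> (\<lambda>g. g + k) ` U"
    then obtain u' where u': "u' \<in> U" "u = u' + k" by blast
    then obtain s where s: "s \<in> S" "- s + u' \<in> V" using S(1) by (auto simp: covers_by_def)
    have "- (s + k) + u = - k + (- s + u') + k"
      by (simp add: u' minus_add add.assoc del: add_uminus_conv_diff)
    then have "- (s + k) + u \<in> V" using V s(2) by (simp add: conj_inv_nhd_def)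
    then show "\<exists>s\<in>(\<lambda>g. g + k) ` S. - s + u \<in> V" using s(1) by blast
  qed
  then show ?thesis using covnum_le card_image_le S unfolding covers_by_def by (metis order_trans)
qed

lemma covnum_left: "covnum V ((\<lambda>g. k + g) ` U) = covnum V U"
  using covnum_left_le[of k U] covnum_left_le[of "- k" "(\<lambda>g. k + g) ` U"]
  by (simp add: image_image add.assoc[symmetric])

lemma covnum_right: "covnum V ((\<lambda>g. g + k) ` U) = covnum V U"
  using covnum_right_le[of k U] covnum_right_le[of "- k" "(\<lambda>g. g + k) ` U"]
  by (simp add: image_image add.assoc)

end

text \<open>The set function is a limit of the ratios \<open>covnum V U / covnum V UNIV\<close> as \<open>V\<close> shrinks to \<open>0\<close>.  Each
of its properties passes to the limit from the covering numbers.  The last one is the additivity on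
separated sets: \<open>f\<close> is uniformly continuous, so a small translate of \<open>V\<close> cannot
meet both \<open>{f \<le> s}\<close> and \<open>{f \<ge> t}\<close>.\<close>

theorem haar_content_exists:
  assumes cpt: "compact (UNIV :: 'g::topological_group_add set)"
  obtains \<mu> :: "'g::topological_group_add set \<Rightarrow> real" where
    "\<And>U. 0 \<le> \<mu> U" "\<mu> {} = 0" "\<mu> UNIV = 1"
    "\<And>U W. U \<subseteq> W \<Longrightarrow> \<mu> U \<le> \<mu> W"
    "\<And>U W. \<mu> (U \<union> W) \<le> \<mu> U + \<mu> W"
    "\<And>k U. \<mu> ((\<lambda>g. k + g) ` U) = \<mu> U"
    "\<And>k U. \<mu> ((\<lambda>g. g + k) ` U) = \<mu> U"
    "\<And>f s t U W. continuous_on UNIV f \<Longrightarrow> s < (t::real) \<Longrightarrow> U \<subseteq> {g. f g \<le> s} \<Longrightarrow> W \<subseteq> {g. t \<le> f g}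
       \<Longrightarrow> \<mu> U + \<mu> W \<le> \<mu> (U \<union> W)"
proof -
  \<comment> \<open>Convergence of conjugation invariant neighbourhoods \<open>V\<close> to \<open>0\<close>.\<close>
  define F0 :: "'g set filter" where
    "F0 = (INF W\<in>{W. open W \<and> 0 \<in> W}. principal {V. V \<subseteq> W \<and> conj_inv_nhd V})"
  have ev0: "eventually P F0 \<longleftrightarrow> (\<exists>W. open W \<and> 0 \<in> W \<and> (\<forall>V\<subseteq>W. conj_inv_nhd V \<longrightarrow> P V))" for P
  proof -
    have "\<exists>x\<in>{W. open W \<and> 0 \<in> W}. principal {V. V \<subseteq> x \<and> conj_inv_nhd V}
        \<le> inf (principal {V. V \<subseteq> a \<and> conj_inv_nhd V}) (principal {V. V \<subseteq> b \<and> conj_inv_nhd V})"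
      if "a \<in> {W. open W \<and> 0 \<in> W}" "b \<in> {W. open W \<and> 0 \<in> W}" for a b :: "'g set"
      using that by (intro bexI[of _ "a \<inter> b"]) auto
    moreover have "{W::'g set. open W \<and> 0 \<in> W} \<noteq> {}" by (metis (mono_tags, lifting) UNIV_I empty_Collect_eq open_UNIV)
    ultimately show ?thesis
      unfolding F0_def by (subst eventually_INF_base) (auto simp: eventually_principal)
  qed
  have F0: "F0 \<noteq> bot"
    using conj_inv_nhd_base[OF cpt] by (auto simp: trivial_limit_def ev0)
  define u where "u V U = (if conj_inv_nhd V then real (covnum V U) / covnum V UNIV else 0)" for V U :: "'g set"
  have u01: "u V U \<in> {0..1}" for V U
    using covnum_mono[OF cpt, of V U UNIV] covnum_UNIV_pos[OF cpt, of V]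
    by (auto simp: u_def divide_simps)
  obtain F \<mu> where F: "F \<le> F0" "F \<noteq> bot" and lim: "\<And>U. ((\<lambda>V. u V U) \<longlongrightarrow> \<mu> U) F"
    using bounded_functions_converge_along_filter[where u = u and ?F0.0 = F0] u01 F0 by metis
  have evF: "eventually P F" if "open W" "0 \<in> W" "\<And>V. V \<subseteq> W \<Longrightarrow> conj_inv_nhd V \<Longrightarrow> P V" for P W
    using that F(1) ev0[of P] unfolding le_filter_def by blast
  have ev: "eventually P F" if "\<And>V. conj_inv_nhd V \<Longrightarrow> P V" for P
    using evF[of UNIV P] that by simp
  note le = tendsto_le[OF F(2)]
  note uniq = tendsto_unique[OF F(2)]
  show ?thesis
  proof (rule that[of \<mu>])
    show "0 \<le> \<mu> U" for U
      by (rule le[OF lim tendsto_const]) (use u01 in auto)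
    show "\<mu> {} = 0"
      by (rule uniq[OF lim[of "{}"] tendsto_eventually], rule ev) (simp add: u_def covnum_empty[OF cpt])
    show "\<mu> UNIV = 1"
      by (rule uniq[OF lim[of UNIV] tendsto_eventually], rule ev)
         (use covnum_UNIV_pos[OF cpt] in \<open>force simp: u_def\<close>)
    show "\<mu> U \<le> \<mu> W" if "U \<subseteq> W" for U W
      by (rule le[OF lim lim], rule ev)
         (use covnum_mono[OF cpt _ that] in \<open>simp add: u_def divide_right_mono\<close>)
    show "\<mu> (U \<union> W) \<le> \<mu> U + \<mu> W" for U W
      by (rule le[OF tendsto_add[OF lim lim] lim], rule ev)
         (use covnum_subadditive[OF cpt] in \<open>simp add: u_def add_divide_distrib[symmetric] divide_right_mono flip: of_nat_add\<close>)
    show "\<mu> ((\<lambda>g. k + g) ` U) = \<mu> U" for k U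
    proof (rule uniq[OF lim], rule Lim_transform_eventually[OF lim[of U]], rule ev)
      show "u V U = u V ((\<lambda>g. k + g) ` U)" if "conj_inv_nhd V" for V
        by (simp add: u_def covnum_left[OF cpt that])
    qed
    show "\<mu> ((\<lambda>g. g + k) ` U) = \<mu> U" for k U
    proof (rule uniq[OF lim], rule Lim_transform_eventually[OF lim[of U]], rule ev)
      show "u V U = u V ((\<lambda>g. g + k) ` U)" if "conj_inv_nhd V" for V
        by (simp add: u_def covnum_right[OF cpt that])
    qed
    fix f :: "'g \<Rightarrow> real" and s t :: real and U W :: "'g set"
    assume f: "continuous_on UNIV f" and st: "s < t" and U: "U \<subseteq> {g. f g \<le> s}" and W: "W \<subseteq> {g. t \<le> f g}"
    define O' where "O' = {(g, v::'g). \<bar>f (g + v) - f g\<bar> < (t - s) / 2}"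
    have "open O'"
      unfolding O'_def case_prod_beta
      by (intro open_Collect_less continuous_on_rabs continuous_on_diff continuous_on_compose2[OF f]
            continuous_on_add continuous_intros) auto
    then have "eventually (\<lambda>v. \<forall>g. (g, v) \<in> O') (nhds 0)"
      by (rule compact_imp_eventually_all[OF cpt]) (use st in \<open>simp add: O'_def\<close>)
    then obtain N where N: "open N" "0 \<in> N" "\<And>v g. v \<in> N \<Longrightarrow> \<bar>f (g + v) - f g\<bar> < (t - s) / 2"
      unfolding eventually_nhds O'_def by auto
    show "\<mu> U + \<mu> W \<le> \<mu> (U \<union> W)"
    proof (rule le[OF lim tendsto_add[OF lim lim]], rule evF[OF N(1,2)])
      fix V assume V: "V \<subseteq> N" "conj_inv_nhd V"
      have "covnum V U + covnum V W \<le> covnum V (U \<union> W)"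
      proof (rule covnum_superadditive[OF cpt V(2)])
        fix r a b assume "a \<in> U" "b \<in> W" "- r + a \<in> V" "- r + b \<in> V"
        then have "\<bar>f a - f r\<bar> < (t - s) / 2" "\<bar>f b - f r\<bar> < (t - s) / 2" "f a \<le> s" "t \<le> f b"
          using N(3)[of "- r + a" r] N(3)[of "- r + b" r] V(1) U W by (auto simp: add.assoc[symmetric])
        then have "f r - f a < (t - s) / 2" "f b - f r < (t - s) / 2" "f a \<le> s" "t \<le> f b"
          by (simp_all only: abs_less_iff minus_diff_eq)
        then show False by (simp add: field_simps)
      qed
      then show "u V U + u V W \<le> u V (U \<union> W)"
        using V(2) by (simp add: u_def add_divide_distrib[symmetric] divide_right_mono flip: of_nat_add)
    qed
  qed
qed

lemma ennreal_suminf_tail_tendsto_0: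
  fixes h :: "nat \<Rightarrow> ennreal"
  assumes "(\<Sum>k. h k) < \<infinity>"
  shows "(\<lambda>n. \<Sum>k. h (k + n)) \<longlonglongrightarrow> 0"
proof -
  define r where "r k = enn2real (h k)" for k
  have h: "h k = ennreal (r k)" for k
    using ennreal_suminf_lessD[of h top k] assms by (simp add: r_def)
  have nn: "0 \<le> r k" for k by (simp add: r_def)
  have s: "summable r"
    using assms by (intro summable_suminf_not_top nn) (simp add: h[symmetric] less_top)
  have "(\<lambda>n. ennreal (\<Sum>k. r (k + n))) \<longlonglongrightarrow> ennreal 0"
    by (intro tendsto_ennrealI suminf_exist_split2 s)
  moreover have "(\<Sum>k. h (k + n)) = ennreal (\<Sum>k. r (k + n))" for n
    unfolding h using s nn by (intro suminf_ennreal2) (auto simp: summable_iff_shift)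
  ultimately show ?thesis by simp
qed

text \<open>This is Caratheodory's criterion for metric outer measures, for the level sets of one function.
Cut \<open>{f > c}\<close> into the shells \<open>R n\<close> between the levels \<open>c + 1 / (n + 2)\<close> and \<open>c + 1 / (n + 1)\<close>.  Shells
whose indices have the same parity are separated from each other, so the outer measures of the shells
have a finite sum.  Hence the part of a set close to the level \<open>c\<close> is negligible, and the remaining
part is separated from \<open>{f \<le> c}\<close>.\<close>

lemma lambda_system_sublevelI:
  fixes f :: "'g \<Rightarrow> real" and H :: "'g set \<Rightarrow> ennreal"
  assumes H: "outer_measure_space UNIV H" and fin: "H UNIV < \<infinity>"
    and sep: "\<And>s t U W. s < t \<Longrightarrow> U \<subseteq> {g. f g \<le> s} \<Longrightarrow> W \<subseteq> {g. t \<le> f g} \<Longrightarrow> H U + H W \<le> H (U \<union> W)"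
  shows "{g. f g \<le> c} \<in> lambda_system UNIV UNIV H"
proof -
  have mono: "H A \<le> H B" if "A \<subseteq> B" for A B
    using H that by (auto simp: outer_measure_space_def increasing_def)
  have csub: "H (\<Union>i. A i) \<le> (\<Sum>i. H (A i))" for A :: "nat \<Rightarrow> 'g set"
  proof -
    have "H (\<Union>i. disjointed A i) \<le> (\<Sum>i. H (disjointed A i))"
      using H by (auto simp: outer_measure_space_def countably_subadditive_def disjoint_family_disjointed)
    also have "\<dots> \<le> (\<Sum>i. H (A i))"
      by (intro suminf_le mono disjointed_subset) auto
    finally show ?thesis by (simp add: UN_disjointed_eq)
  qed
  have H0: "H {} = 0" using H by (simp add: outer_measure_space_def positive_def)
  have sub: "H (A \<union> B) \<le> H A + H B" for A B
  proof -
    have "(\<Union>i::nat. if i = 0 then A else if i = 1 then B else {}) = A \<union> B"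
      by (auto split: if_splits)
    then have "H (A \<union> B) \<le> (\<Sum>i::nat. H (if i = 0 then A else if i = 1 then B else {}))"
      using csub[of "\<lambda>i. if i = 0 then A else if i = 1 then B else {}"] by simp
    also have "\<dots> = (\<Sum>i\<in>{0,1::nat}. H (if i = 0 then A else if i = 1 then B else {}))"
      by (rule suminf_finite) (auto simp: H0)
    finally show ?thesis by simp
  qed
  define r where "r n = c + 1 / real (Suc n)" for n
  have r_mono: "r n < r m" if "m < n" for m n
    using that by (simp add: r_def frac_less2)
  have split: "H (X \<inter> {g. f g \<le> c}) + H (X - {g. f g \<le> c}) \<le> H X" for X
  proof -
    define R where "R n = {g\<in>X. r (Suc n) \<le> f g \<and> f g \<le> r n}" for n
    define B where "B n = {g\<in>X. r n \<le> f g}" for n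
    \<comment> \<open>The induction adds the shell closest to \<open>c\<close>; a gap separates its values from those of the earlier ones.\<close>
    have odd_even: "(\<Sum>k<m. H (R (2 * k + j))) \<le> H (\<Union>k<m. R (2 * k + j))" for m j
    proof (induction m)
      case (Suc m)
      have "(\<Sum>k<Suc m. H (R (2 * k + j))) \<le> H (\<Union>k<m. R (2 * k + j)) + H (R (2 * m + j))"
        using Suc by (simp add: add_right_mono)
      also have "\<dots> \<le> H (R (2 * m + j) \<union> (\<Union>k<m. R (2 * k + j)))"
      proof (cases m)
        case (Suc m')
        have "H (R (2 * m + j)) + H (\<Union>k<m. R (2 * k + j)) \<le> H (R (2 * m + j) \<union> (\<Union>k<m. R (2 * k + j)))"
        proof (rule sep)
          show "r (2 * m + j) < r (Suc (2 * m' + j))" using Suc by (intro r_mono) simp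
          show "R (2 * m + j) \<subseteq> {g. f g \<le> r (2 * m + j)}" by (auto simp: R_def)
          show "(\<Union>k<m. R (2 * k + j)) \<subseteq> {g. r (Suc (2 * m' + j)) \<le> f g}"
          proof safe
            fix k g assume k: "k < m" and g: "g \<in> R (2 * k + j)"
            have "r (Suc (2 * m' + j)) \<le> r (Suc (2 * k + j))"
              using r_mono[of "Suc (2 * k + j)" "Suc (2 * m' + j)"] k Suc
              by (cases "k = m'") auto
            then show "r (Suc (2 * m' + j)) \<le> f g" using g by (simp add: R_def)
          qed
        qed
        then show ?thesis by (simp add: add.commute)
      qed (simp add: H0)
      finally show ?case by (simp add: lessThan_Suc)
    qed (simp add: H0)
    have sum_le: "(\<Sum>k<m. H (R k)) \<le> 2 * H UNIV" for m
    proof -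
      have "(\<Sum>k<m. H (R k)) \<le> (\<Sum>k<2 * m. H (R k))"
        by (intro sum_mono2) auto
      also have "\<dots> = (\<Sum>k<m. H (R (2 * k + 0))) + (\<Sum>k<m. H (R (2 * k + 1)))"
        by (induction m) (auto simp: ac_simps)
      also have "\<dots> \<le> H UNIV + H UNIV"
        using odd_even[of 0 m] odd_even[of 1 m] mono[OF subset_UNIV]
        by (intro add_mono) (metis order_trans)+
      finally show ?thesis by (simp add: mult_2)
    qed
    have summ: "(\<Sum>k. H (R k)) < \<infinity>"
    proof -
      have "(\<Sum>k. H (R k)) \<le> 2 * H UNIV" by (rule suminf_le_const[OF summableI sum_le])
      also have "\<dots> < \<infinity>" using fin by (simp add: ennreal_mult_less_top)
      finally show ?thesis .
    qed
    have tail0: "(\<lambda>n. \<Sum>k. H (R (k + n))) \<longlonglongrightarrow> 0"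
      using ennreal_suminf_tail_tendsto_0[OF summ] .
    have le1: "H (X \<inter> {g. f g \<le> c}) + H (X - {g. f g \<le> c}) \<le> H X + (\<Sum>k. H (R (k + n)))" for n
    proof -
      have "X - {g. f g \<le> c} \<subseteq> B n \<union> (\<Union>k. R (k + n))"
      proof (intro subsetI UnCI)
        fix g assume "g \<in> X - {g. f g \<le> c}" "g \<notin> (\<Union>k. R (k + n))"
        then have g: "g \<in> X" "\<not> f g \<le> c" "g \<notin> (\<Union>k. R (k + n))" by auto
        have "f g \<ge> r n"
        proof (rule ccontr)
          assume lt: "\<not> r n \<le> f g"
          have notR: "r (Suc (k + n)) > f g" if "f g \<le> r (k + n)" for k
            using g that by (auto simp: R_def not_le)
          have "f g < r (k + n)" for k
            by (induction k) (use lt notR in \<open>auto simp: not_le less_imp_le\<close>)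
          then have *: "f g - c < 1 / real (Suc (k + n))" for k by (simp add: r_def algebra_simps)
          obtain k where "1 / real (Suc k) < f g - c"
            using g(2) nat_approx_posE[of "f g - c"] by auto
          moreover have "1 / real (Suc (k + n)) \<le> 1 / real (Suc k)" by (simp add: frac_le)
          ultimately show False using *[of k] by linarith
        qed
        then show "g \<in> B n" using g by (simp add: B_def)
      qed
      then have "H (X - {g. f g \<le> c}) \<le> H (B n) + H (\<Union>k. R (k + n))"
        by (rule order_trans[OF mono sub])
      also have "\<dots> \<le> H (B n) + (\<Sum>k. H (R (k + n)))"
        by (intro add_left_mono csub)
      finally have "H (X \<inter> {g. f g \<le> c}) + H (X - {g. f g \<le> c})
          \<le> (H (X \<inter> {g. f g \<le> c}) + H (B n)) + (\<Sum>k. H (R (k + n)))"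
        unfolding add.assoc by (rule add_left_mono)
      also have "H (X \<inter> {g. f g \<le> c}) + H (B n) \<le> H ((X \<inter> {g. f g \<le> c}) \<union> B n)"
        by (rule sep[of c "r n"]) (auto simp: r_def B_def)
      also have "\<dots> \<le> H X" by (rule mono) (auto simp: B_def)
      finally show ?thesis by (simp add: add_right_mono)
    qed
    have "(\<lambda>n. H X + (\<Sum>k. H (R (k + n)))) \<longlonglongrightarrow> H X + 0"
      by (intro tendsto_add tendsto_const tail0)
    then show ?thesis
      using le1 by (intro LIMSEQ_le_const[where X = "\<lambda>n. H X + (\<Sum>k. H (R (k + n)))"]) auto
  qed
  show ?thesis
    unfolding lambda_system_def
  proof safe
    fix X :: "'g set"
    have "H X \<le> H (X \<inter> {g. f g \<le> c}) + H (X - {g. f g \<le> c})"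
      using sub[of "X \<inter> {g. f g \<le> c}" "X - {g. f g \<le> c}"] by (simp add: Int_Diff_Un)
    then have "H (X \<inter> {g. f g \<le> c}) + H (X - {g. f g \<le> c}) = H X"
      using split[of X] by (rule antisym[OF _ , rotated])
    then show "H ({g. f g \<le> c} \<inter> X) + H ((UNIV - {g. f g \<le> c}) \<inter> X) = H X"
      by (simp add: Int_commute Diff_eq)
  qed auto
qed

text \<open>The content is first made outer regular, by passing to the infimum over open supersets, and then
extended to a countably subadditive outer measure.  Regularity is what keeps the total mass
equal to 1: a countable cover may be enlarged to an open one at little cost, and compactness
leaves a finite cover, to which finite subadditivity of the content applies.  Level sets of
continuous functions are measurable by lemma \<open>lambda_system_sublevelI\<close>.\<close>

theorem haar_probability_exists:
  assumes cpt: "compact (UNIV :: 'g::topological_group_add set)"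
  obtains H :: "'g::topological_group_add measure" where
    "prob_space H" "space H = UNIV"
    "\<And>f::'g \<Rightarrow> real. continuous_on UNIV f \<Longrightarrow> f \<in> borel_measurable H"
    "\<And>k. (\<lambda>g. k + g) \<in> H \<rightarrow>\<^sub>M H" "\<And>k. distr H H (\<lambda>g. k + g) = H"
    "\<And>k. (\<lambda>g. g + k) \<in> H \<rightarrow>\<^sub>M H" "\<And>k. distr H H (\<lambda>g. g + k) = H"
proof -
  obtain \<mu> :: "'g set \<Rightarrow> real" where
    nn: "\<And>U. 0 \<le> \<mu> U" and \<mu>0: "\<mu> {} = 0" and \<mu>1: "\<mu> UNIV = 1"
    and mono: "\<And>U W. U \<subseteq> W \<Longrightarrow> \<mu> U \<le> \<mu> W"
    and sub: "\<And>U W. \<mu> (U \<union> W) \<le> \<mu> U + \<mu> W"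
    and left: "\<And>k U. \<mu> ((\<lambda>g. k + g) ` U) = \<mu> U"
    and right: "\<And>k U. \<mu> ((\<lambda>g. g + k) ` U) = \<mu> U"
    and sep: "\<And>f s t U W. continuous_on UNIV f \<Longrightarrow> s < (t::real) \<Longrightarrow> U \<subseteq> {g. f g \<le> s} \<Longrightarrow> W \<subseteq> {g. t \<le> f g}
       \<Longrightarrow> \<mu> U + \<mu> W \<le> \<mu> (U \<union> W)"
    by (rule haar_content_exists[OF cpt]) (rule that; assumption)
  define f where "f A = (INF U\<in>{U. open U \<and> A \<subseteq> U}. ennreal (\<mu> U))" for A
  define H where "H = outer_measure UNIV f"
  have f_le: "f A \<le> ennreal (\<mu> U)" if "open U" "A \<subseteq> U" for A U
    unfolding f_def using that by (intro INF_lower) auto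
  have f_mono: "f A \<le> f B" if "A \<subseteq> B" for A B
    unfolding f_def using that by (intro INF_superset_mono) auto
  have f0: "f {} = 0" using f_le[of "{}" "{}"] \<mu>0 by simp
  interpret P: sigma_algebra "UNIV :: 'g set" UNIV
    using sigma_algebra_Pow[of "UNIV::'g set"] by (simp add: Pow_UNIV)
  have pos: "positive UNIV f" and inc: "increasing UNIV f"
    using f0 f_mono by (auto simp: positive_def increasing_def)
  have oms: "outer_measure_space UNIV H"
    using P.outer_measure_space_outer_measure[OF pos inc] by (simp add: H_def Pow_UNIV)
  have H_le: "H X \<le> f X" for X
  proof -
    have "H X \<le> (\<Sum>i::nat. f (if i = 0 then X else {}))"
      unfolding H_def by (rule P.outer_measure_le[OF pos inc]) (auto split: if_splits)
    also have "\<dots> = (\<Sum>i\<in>{0::nat}. f (if i = 0 then X else {}))"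
      by (rule suminf_finite) (auto simp: f0)
    finally show ?thesis by simp
  qed
  have \<mu>_UN: "\<mu> (\<Union>i\<in>T. U i) \<le> (\<Sum>i\<in>T. \<mu> (U i))" if "finite T" for T :: "nat set" and U
    using that
  proof induction
    case (insert i T)
    then show ?case using sub[of "U i" "\<Union>i\<in>T. U i"] by simp
  qed (simp add: \<mu>0)
  have "1 \<le> H UNIV"
    unfolding H_def outer_measure_def
  proof (rule INF_greatest, safe)
    fix A :: "nat \<Rightarrow> 'g set" assume A: "UNIV \<subseteq> (\<Union>i. A i)"
    show "1 \<le> (\<Sum>i. f (A i))"
    proof (rule ennreal_le_epsilon)
      fix e :: real assume "0 < e" and fin: "(\<Sum>i. f (A i)) < top"
      have "\<exists>U. open U \<and> A i \<subseteq> U \<and> ennreal (\<mu> U) \<le> f (A i) + ennreal (e * (1/2) ^ Suc i)" for i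
      proof -
        have "f (A i) < top" using fin by (rule ennreal_suminf_lessD)
        then have "f (A i) < f (A i) + ennreal (e * (1/2) ^ Suc i)"
          using \<open>0 < e\<close> by simp
        then show ?thesis unfolding f_def[of "A i"] INF_less_iff by (auto intro: less_imp_le)
      qed
      then obtain U where U: "\<And>i. open (U i)" "\<And>i. A i \<subseteq> U i"
          "\<And>i. ennreal (\<mu> (U i)) \<le> f (A i) + ennreal (e * (1/2) ^ Suc i)" by metis
      obtain T where T: "finite T" "UNIV \<subseteq> (\<Union>i\<in>T. U i)"
      proof (rule compactE_image[OF cpt, of UNIV U])
        show "UNIV \<subseteq> (\<Union>i. U i)" using A UN_mono[OF subset_refl U(2)] by (rule order_trans)
        show "open (U i)" for i by (rule U(1))
      qed
      have "(\<Union>i\<in>T. U i) = UNIV" using T(2) by auto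
      then have "1 \<le> (\<Sum>i\<in>T. \<mu> (U i))"
        using \<mu>_UN[OF T(1), of U] \<mu>1 by simp
      then have "1 \<le> (\<Sum>i\<in>T. ennreal (\<mu> (U i)))"
        using nn ennreal_leI[of 1] by (simp add: sum_ennreal)
      also have "\<dots> \<le> (\<Sum>i. ennreal (\<mu> (U i)))"
        by (rule sum_le_suminf) (use T in auto)
      also have "\<dots> \<le> (\<Sum>i. f (A i) + ennreal (e * (1/2) ^ Suc i))"
        by (intro suminf_le U) auto
      also have "\<dots> = (\<Sum>i. f (A i)) + (\<Sum>i. ennreal (e * (1/2) ^ Suc i))"
        by (rule suminf_add[symmetric]) auto
      also have "(\<Sum>i. ennreal (e * (1/2) ^ Suc i)) = ennreal e"
        using \<open>0 < e\<close> sums_mult[OF power_half_series, of e]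
        by (intro suminf_ennreal_eq) auto
      finally show "1 \<le> (\<Sum>i. f (A i)) + ennreal e" .
    qed
  qed
  moreover have "H UNIV \<le> 1"
    using H_le[of UNIV] f_le[of UNIV UNIV] \<mu>1 by simp
  ultimately have H1: "H UNIV = 1" by (rule antisym[rotated])
  have H_sep: "H U + H W \<le> H (U \<union> W)"
    if c: "continuous_on UNIV h" and st: "s < (t::real)" and U: "U \<subseteq> {g. h g \<le> s}" and W: "W \<subseteq> {g. t \<le> h g}"
    for h s t U W
  proof -
    \<comment> \<open>The content is additive on separated sets; this passes to the outer regular version and then to covers.\<close>
    have f_sep: "f U' + f W' \<le> f (U' \<union> W')" if U': "U' \<subseteq> U" and W': "W' \<subseteq> W" for U' W'
      unfolding f_def[of "U' \<union> W'"]
    proof (rule INF_greatest, safe)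
      fix O' assume O': "open O'" "U' \<union> W' \<subseteq> O'"
      \<comment> \<open>Room between the levels, so that the two sets have separated open neighbourhoods.\<close>
      define s' t' where "s' = s + (t - s) / 3" and "t' = t - (t - s) / 3"
      have lt: "s < s'" "s' < t'" "t' < t" using st by (auto simp: s'_def t'_def field_simps)
      define A B where "A = O' \<inter> {g. h g < s'}" and "B = O' \<inter> {g. t' < h g}"
      have "open A" "open B"
        unfolding A_def B_def using O'(1) c
        by (auto intro!: open_Int open_Collect_less)
      moreover have "U' \<subseteq> A" "W' \<subseteq> B"
        using O' U U' W W' lt by (force simp: A_def B_def)+
      ultimately have "f U' + f W' \<le> ennreal (\<mu> A) + ennreal (\<mu> B)"
        by (intro add_mono f_le)
      also have "\<dots> = ennreal (\<mu> A + \<mu> B)" using nn by simp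
      also have "\<mu> A + \<mu> B \<le> \<mu> (A \<union> B)"
        by (rule sep[OF c lt(2)]) (auto simp: A_def B_def)
      also have "\<dots> \<le> \<mu> O'" by (rule mono) (auto simp: A_def B_def)
      finally show "f U' + f W' \<le> ennreal (\<mu> O')" by (simp add: ennreal_leI)
    qed
    show ?thesis
      unfolding H_def outer_measure_def[of _ _ "U \<union> W"]
    proof (rule INF_greatest, safe)
      fix A :: "nat \<Rightarrow> 'g set" assume A: "U \<union> W \<subseteq> (\<Union>i. A i)"
      have "outer_measure UNIV f U + outer_measure UNIV f W \<le> (\<Sum>i. f (A i \<inter> U)) + (\<Sum>i. f (A i \<inter> W))"
        using A by (intro add_mono P.outer_measure_le[OF pos inc]) auto
      also have "\<dots> = (\<Sum>i. f (A i \<inter> U) + f (A i \<inter> W))" by (rule suminf_add) auto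
      also have "\<dots> \<le> (\<Sum>i. f (A i))"
      proof (intro suminf_le)
        fix i
        have "f (A i \<inter> U) + f (A i \<inter> W) \<le> f ((A i \<inter> U) \<union> (A i \<inter> W))" by (rule f_sep) auto
        also have "\<dots> \<le> f (A i)" by (rule f_mono) auto
        finally show "f (A i \<inter> U) + f (A i \<inter> W) \<le> f (A i)" .
      qed auto
      finally show "outer_measure UNIV f U + outer_measure UNIV f W \<le> (\<Sum>i. f (A i))" .
    qed
  qed
  have H_inv: "H (b -` X) = H X"
    if b: "bij b" "continuous_on UNIV b" "continuous_on UNIV (inv b)" "\<And>U. \<mu> (b ` U) = \<mu> U" for b X
  proof -
    \<comment> \<open>One inequality suffices, as it can also be applied to the inverse of \<open>b\<close>.\<close>
    have H_vimage_le: "H (b -` X) \<le> H X"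
      if b: "bij b" "continuous_on UNIV b" "\<And>U. \<mu> (b -` U) = \<mu> U" for b X
    proof -
      have f_vimage_le: "f (b -` A) \<le> f A" for A
        unfolding f_def[of A]
      proof (rule INF_greatest, safe)
        fix U assume "open U" "A \<subseteq> U"
        then have "open (b -` U)" "b -` A \<subseteq> b -` U" using b(2) by (auto intro: open_vimage)
        then show "f (b -` A) \<le> ennreal (\<mu> U)" using f_le b(3) by metis
      qed
      show ?thesis
        unfolding H_def outer_measure_def[of _ _ X]
      proof (rule INF_greatest, safe)
        fix A :: "nat \<Rightarrow> 'g set" assume "X \<subseteq> (\<Union>i. A i)"
        then have "outer_measure UNIV f (b -` X) \<le> (\<Sum>i. f (b -` A i))"
          by (intro P.outer_measure_le[OF pos inc]) blast+
        also have "\<dots> \<le> (\<Sum>i. f (A i))" by (intro suminf_le f_vimage_le) auto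
        finally show "outer_measure UNIV f (b -` X) \<le> (\<Sum>i. f (A i))" .
      qed
    qed
    have inv_v: "inv b -` U = b ` U" for U by (simp add: b(1) bij_vimage_eq_inv_image bij_imp_bij_inv inv_inv_eq)
    have "H (b -` X) \<le> H X"
    proof (rule H_vimage_le[OF b(1,2)])
      show "\<mu> (b -` U) = \<mu> U" for U
        using b(4)[of "b -` U"] b(1) by (simp add: bij_is_surj surj_image_vimage_eq)
    qed
    moreover have "H (inv b -` (b -` X)) \<le> H (b -` X)"
      by (rule H_vimage_le[OF bij_imp_bij_inv[OF b(1)] b(3)]) (simp add: inv_v b(4))
    moreover have "inv b -` (b -` X) = X"
      using b(1) by (simp add: inv_v bij_is_surj surj_image_vimage_eq)
    ultimately show ?thesis by simp
  qed
  define L where "L = lambda_system UNIV UNIV H"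
  have ms: "measure_space UNIV L H" unfolding L_def by (rule P.caratheodory_lemma[OF oms])
  define M where "M = measure_of UNIV L H"
  have sigL: "sigma_algebra UNIV L" using ms by (simp add: measure_space_def)
  have sets_M: "sets M = L" and space_M: "space M = UNIV"
    by (simp_all add: M_def sigma_algebra.sets_measure_of_eq[OF sigL] space_measure_of_conv)
  have em: "emeasure M A = H A" if "A \<in> L" for A
    unfolding M_def by (rule emeasure_measure_of_sigma) (use ms that in \<open>auto simp: measure_space_def\<close>)
  have meas_b: "b \<in> M \<rightarrow>\<^sub>M M \<and> distr M M b = M"
    if b: "bij b" "continuous_on UNIV b" "continuous_on UNIV (inv b)" "\<And>U. \<mu> (b ` U) = \<mu> U" for b
  proof
    note inv = H_inv[OF b]
    show m: "b \<in> M \<rightarrow>\<^sub>M M"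
    proof (rule measurableI)
      fix A assume "A \<in> sets M"
      then have A: "\<And>X. H (A \<inter> X) + H ((UNIV - A) \<inter> X) = H X" by (simp add: sets_M L_def lambda_system_def)
      have "H (b -` A \<inter> X) + H ((UNIV - b -` A) \<inter> X) = H X" for X
      proof -
        have X: "b -` (b ` X) = X" using b(1) by (simp add: bij_is_inj inj_vimage_image_eq)
        have "H (b -` (A \<inter> b ` X)) + H (b -` ((UNIV - A) \<inter> b ` X)) = H (b -` (b ` X))"
          unfolding inv by (rule A)
        then show ?thesis by (simp add: X vimage_Int vimage_Diff)
      qed
      then show "b -` A \<inter> space M \<in> sets M" by (simp add: sets_M space_M L_def lambda_system_def)
    qed (simp add: space_M)
    show "distr M M b = M"
    proof (rule measure_eqI)
      fix A assume "A \<in> sets (distr M M b)"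
      then have A: "A \<in> sets M" by simp
      then have "b -` A \<in> sets M" using measurable_sets[OF m A] by (simp add: space_M)
      then show "emeasure (distr M M b) A = emeasure M A"
        using A by (simp add: emeasure_distr[OF m] space_M em sets_M inv)
    qed simp
  qed
  have left_b: "bij (\<lambda>g. k + g)" "inv (\<lambda>g. k + g) = (\<lambda>g. - k + g)" for k :: 'g
  proof -
    have "(\<lambda>g. k + g) \<circ> (\<lambda>g. - k + g) = id" "(\<lambda>g. - k + g) \<circ> (\<lambda>g. k + g) = id"
      by (auto simp: fun_eq_iff add.assoc[symmetric])
    then show "bij (\<lambda>g. k + g)" "inv (\<lambda>g. k + g) = (\<lambda>g. - k + g)"
      by (auto intro: o_bij inv_unique_comp)
  qed
  have right_b: "bij (\<lambda>g. g + k)" "inv (\<lambda>g. g + k) = (\<lambda>g. g + - k)" for k :: 'g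
  proof -
    have "(\<lambda>g. g + k) \<circ> (\<lambda>g. g + - k) = id" "(\<lambda>g. g + - k) \<circ> (\<lambda>g. g + k) = id"
      by (auto simp: fun_eq_iff add.assoc)
    then show "bij (\<lambda>g. g + k)" "inv (\<lambda>g. g + k) = (\<lambda>g. g + - k)"
      by (auto intro: o_bij inv_unique_comp)
  qed
  have L: "(\<lambda>g. k + g) \<in> M \<rightarrow>\<^sub>M M \<and> distr M M (\<lambda>g. k + g) = M" for k
    by (rule meas_b) (auto simp only: left_b left intro!: continuous_on_add continuous_intros)
  have R: "(\<lambda>g. g + k) \<in> M \<rightarrow>\<^sub>M M \<and> distr M M (\<lambda>g. g + k) = M" for k
    by (rule meas_b) (auto simp only: right_b right intro!: continuous_on_add continuous_intros)
  show ?thesis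
  proof (rule that[of M])
    have "UNIV \<in> L" using sets.top[of M] by (simp add: space_M sets_M)
    then show "prob_space M" by (intro prob_spaceI) (simp add: space_M em H1)
    show "f \<in> borel_measurable M" if "continuous_on UNIV f" for f :: "'g \<Rightarrow> real"
    proof (rule borel_measurableI_le)
      fix c
      have "{g. f g \<le> c} \<in> L"
        unfolding L_def by (rule lambda_system_sublevelI[OF oms]) (use H1 H_sep[OF that] in auto)
      then show "{g \<in> space M. f g \<le> c} \<in> sets M" by (simp add: space_M sets_M)
    qed
  qed (use space_M L R in auto)
qed

section \<open>Markov kernels and total variation\<close>

lemma sum_measure_partition:
  assumes "finite_measure M" "finite P" "P \<subseteq> sets M" "disjoint P" "\<Union>P = space M"
  shows "(\<Sum>A\<in>P. measure M A) = measure M (space M)"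
proof -
  interpret finite_measure M by fact
  have "measure M (\<Union>A\<in>P. A) = (\<Sum>A\<in>P. measure M A)"
    by (rule finite_measure_finite_Union)
       (use assms in \<open>auto simp: disjoint_def disjoint_family_on_def\<close>)
  then show ?thesis using assms(5) by simp
qed

lemma tv_diff_upper:
  assumes fin: "finite_measure \<mu>" "finite_measure \<nu>" and sets: "sets \<nu> = sets \<mu>"
    and P: "finite P" "P \<subseteq> sets \<mu>" "disjoint P" "\<Union>P = space \<mu>"
  shows "(\<Sum>A\<in>P. \<bar>measure \<mu> A - measure \<nu> A\<bar>) \<le> tv_diff \<mu> \<nu>"
  unfolding tv_diff_def
proof (rule cSup_upper)
  show "bdd_above {(\<Sum>A\<in>P. \<bar>measure \<mu> A - measure \<nu> A\<bar>) | P.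
            finite P \<and> P \<subseteq> sets \<mu> \<and> disjoint P \<and> \<Union>P = space \<mu>}"
  proof (rule bdd_aboveI, safe)
    fix P assume P: "finite P" "P \<subseteq> sets \<mu>" "disjoint P" "\<Union>P = space \<mu>"
    have "(\<Sum>A\<in>P. \<bar>measure \<mu> A - measure \<nu> A\<bar>) \<le> (\<Sum>A\<in>P. measure \<mu> A + measure \<nu> A)"
      by (rule sum_mono) (simp add: abs_le_iff)
    also have "\<dots> = measure \<mu> (space \<mu>) + measure \<nu> (space \<nu>)"
      using sum_measure_partition[OF fin(1) P] sum_measure_partition[OF fin(2) P(1) _ P(3)] P sets
        sets_eq_imp_space_eq[OF sets] by (simp add: sum.distrib)
    finally show "(\<Sum>A\<in>P. \<bar>measure \<mu> A - measure \<nu> A\<bar>) \<le> measure \<mu> (space \<mu>) + measure \<nu> (space \<nu>)" .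
  qed
qed (use P in blast)

lemma tv_diff_least:
  assumes "\<And>P. finite P \<Longrightarrow> P \<subseteq> sets \<mu> \<Longrightarrow> disjoint P \<Longrightarrow> \<Union>P = space \<mu>
      \<Longrightarrow> (\<Sum>A\<in>P. \<bar>measure \<mu> A - measure \<nu> A\<bar>) \<le> c"
  shows "tv_diff \<mu> \<nu> \<le> c"
  unfolding tv_diff_def
proof (rule cSup_least)
  have "finite {space \<mu>} \<and> {space \<mu>} \<subseteq> sets \<mu> \<and> disjoint {space \<mu>} \<and> \<Union>{space \<mu>} = space \<mu>"
    by simp
  then show "{(\<Sum>A\<in>P. \<bar>measure \<mu> A - measure \<nu> A\<bar>) | P.
            finite P \<and> P \<subseteq> sets \<mu> \<and> disjoint P \<and> \<Union>P = space \<mu>} \<noteq> {}" by blast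
qed (use assms in blast)

text \<open>Split the space by a Hahn decomposition into \<open>Y\<close>, where \<open>\<beta> \<le> \<alpha>\<close>, and its complement \<open>Z\<close>, where
\<open>\<alpha> \<le> \<beta>\<close>.  The contributions of \<open>Y\<close> and of \<open>Z\<close> to the difference of the images have known signs on
every set.  Summing them over a partition of the target collapses, as the kernel
has total mass 1, to \<open>(\<alpha> Y - \<beta> Y) + (\<beta> Z - \<alpha> Z)\<close>, which is the value of the partition \<open>{Y, Z}\<close>.\<close>

theorem tv_diff_bind_le:
  assumes fin: "finite_measure \<alpha>" "finite_measure \<beta>" and sets: "sets \<beta> = sets \<alpha>"
    and ne: "space \<alpha> \<noteq> {}" and K: "K \<in> \<alpha> \<rightarrow>\<^sub>M prob_algebra N"
  shows "tv_diff (\<alpha> \<bind> K) (\<beta> \<bind> K) \<le> tv_diff \<alpha> \<beta>"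
proof -
  have sp: "space \<beta> = space \<alpha>" by (rule sets_eq_imp_space_eq[OF sets])
  have Ks: "K \<in> \<alpha> \<rightarrow>\<^sub>M subprob_algebra N" by (rule measurable_prob_algebraD[OF K])
  have K1: "emeasure (K x) (space N) = 1" if "x \<in> space \<alpha>" for x
    using measurable_space[OF K that] prob_space.emeasure_space_1[of "K x"] sets_eq_imp_space_eq[of "K x" N]
    by (simp add: space_prob_algebra)
  have K_meas: "K \<in> m \<rightarrow>\<^sub>M subprob_algebra N" if "sets m = sets \<alpha>" for m
    using Ks measurable_cong_sets[OF that refl, of "subprob_algebra N"] by blast
  have Km_meas: "(\<lambda>x. emeasure (K x) A) \<in> borel_measurable m" if "sets m = sets \<alpha>" "A \<in> sets N" for m A
    using measurable_compose[OF K_meas[OF that(1)] measurable_emeasure_subprob_algebra[OF that(2)]] .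
  have ne': "space m \<noteq> {}" if "sets m = sets \<alpha>" for m
    using sets_eq_imp_space_eq[OF that] ne by simp
  \<comment> \<open>The restriction of \<open>m\<close> to \<open>S\<close>, as a measure on the whole space.\<close>
  define R where "R m S = density m (indicator S :: _ \<Rightarrow> ennreal)" for m :: "'a measure" and S
  have sets_R: "sets (R m S) = sets m" "space (R m S) = space m" for m S by (simp_all add: R_def)
  have em_R: "emeasure (R m S) X = emeasure m (S \<inter> X)" if "S \<in> sets m" "X \<in> sets m" for m S X
    unfolding R_def using that by (rule emeasure_restricted)
  have em_RK: "emeasure (R m S \<bind> K) A = (\<integral>\<^sup>+x. indicator S x * emeasure (K x) A \<partial>m)"
    if m: "sets m = sets \<alpha>" and S: "S \<in> sets \<alpha>" and A: "A \<in> sets N" for m S A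
  proof -
    have "emeasure (R m S \<bind> K) A = (\<integral>\<^sup>+x. emeasure (K x) A \<partial>R m S)"
      by (rule emeasure_bind[OF ne' K_meas A]) (simp_all only: sets_R m)
    then show ?thesis
      unfolding R_def using S m by (simp add: nn_integral_density Km_meas[OF m A])
  qed
  have sets_RK: "sets (R m S \<bind> K) = sets N" if m: "sets m = sets \<alpha>" for m S
    by (rule sets_bind_measurable[OF K_meas ne']) (simp_all only: sets_R m)
  have space_RK: "space (R m S \<bind> K) = space N" if m: "sets m = sets \<alpha>" for m S
    by (rule sets_eq_imp_space_eq[OF sets_RK[OF m]])
  have sets_K: "sets (m \<bind> K) = sets N" if m: "sets m = sets \<alpha>" for m
    by (rule sets_bind_measurable[OF K_meas[OF m] ne'[OF m]])
  have tot: "emeasure (R m S \<bind> K) (space N) = emeasure m S" if m: "sets m = sets \<alpha>" and S: "S \<in> sets \<alpha>" for m S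
  proof -
    have "emeasure (R m S \<bind> K) (space N) = (\<integral>\<^sup>+x. indicator S x \<partial>m)"
      unfolding em_RK[OF m S sets.top] using sets_eq_imp_space_eq[OF m] K1 by (intro nn_integral_cong) simp
    then show ?thesis using S m by simp
  qed
  have fin_RK: "finite_measure (R m S \<bind> K)" if "sets m = sets \<alpha>" "S \<in> sets \<alpha>" "finite_measure m" for m S
    using tot[OF that(1,2)] finite_measure.emeasure_finite[OF that(3)]
    by (intro finite_measureI) (simp add: space_RK[OF that(1)])
  obtain Y where Y: "Y \<in> sets \<alpha>" "\<And>X. X \<in> sets \<alpha> \<Longrightarrow> X \<subseteq> Y \<Longrightarrow> emeasure \<beta> X \<le> emeasure \<alpha> X"
      "\<And>X. X \<in> sets \<alpha> \<Longrightarrow> X \<inter> Y = {} \<Longrightarrow> emeasure \<alpha> X \<le> emeasure \<beta> X"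
  proof -
    obtain Y where Y: "Y \<in> sets \<alpha>" "\<forall>X\<in>sets \<alpha>. X \<subseteq> Y \<longrightarrow> emeasure \<beta> X \<le> emeasure \<alpha> X"
        "\<forall>X\<in>sets \<alpha>. X \<inter> Y = {} \<longrightarrow> emeasure \<alpha> X \<le> emeasure \<beta> X"
      using finite_unsigned_Hahn_decomposition[OF fin sets] by (elim bexE conjE)
    show ?thesis
      by (rule that[OF Y(1)]; rule Y(2,3)[rule_format])
  qed
  define Z where "Z = space \<alpha> - Y"
  have Z: "Z \<in> sets \<alpha>" using Y(1) by (simp add: Z_def sets.compl_sets)
  have mono: "emeasure (R m S \<bind> K) A \<le> emeasure (R m' S \<bind> K) A"
    if m: "sets m = sets \<alpha>" "sets m' = sets \<alpha>" and S: "S \<in> sets \<alpha>" and A: "A \<in> sets N"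
      and le: "\<And>X. X \<in> sets \<alpha> \<Longrightarrow> X \<subseteq> S \<Longrightarrow> emeasure m X \<le> emeasure m' X" for m m' S A
  proof -
    have "emeasure (R m S) X \<le> emeasure (R m' S) X" for X
    proof (cases "X \<in> sets \<alpha>")
      case True
      then show ?thesis using S m le[of "S \<inter> X"] by (simp add: em_R sets.Int)
    next
      case False
      then show ?thesis by (simp add: emeasure_notin_sets sets_R m)
    qed
    then have le: "R m S \<le> R m' S"
      using m sets_eq_imp_space_eq[OF m(1)] sets_eq_imp_space_eq[OF m(2)]
      by (simp add: le_measure_iff sets_R le_fun_def)
    have e: "emeasure (R n S \<bind> K) A = (\<integral>\<^sup>+x. emeasure (K x) A \<partial>R n S)" if "sets n = sets \<alpha>" for n
      unfolding em_RK[OF that S A] unfolding R_def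
      using S that by (simp add: nn_integral_density Km_meas[OF that A])
    show ?thesis unfolding e[OF m(1)] e[OF m(2)]
      by (rule nn_integral_mono_measure[OF _ le]) (simp add: sets_R m)
  qed
  have split: "measure (m \<bind> K) A = measure (R m Y \<bind> K) A + measure (R m Z \<bind> K) A"
    if m: "sets m = sets \<alpha>" "finite_measure m" and A: "A \<in> sets N" for m A
  proof -
    have "emeasure (m \<bind> K) A = (\<integral>\<^sup>+x. emeasure (K x) A \<partial>m)"
      by (rule emeasure_bind[OF ne'[OF m(1)] K_meas[OF m(1)] A])
    also have "\<dots> = (\<integral>\<^sup>+x. indicator Y x * emeasure (K x) A + indicator Z x * emeasure (K x) A \<partial>m)"
      using sets_eq_imp_space_eq[OF m(1)] by (intro nn_integral_cong) (auto simp: Z_def indicator_def)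
    also have "\<dots> = emeasure (R m Y \<bind> K) A + emeasure (R m Z \<bind> K) A"
      unfolding em_RK[OF m(1) Y(1) A] em_RK[OF m(1) Z A]
      using Y(1) Z m(1) Km_meas[OF m(1) A] by (intro nn_integral_add) simp_all
    finally have "emeasure (m \<bind> K) A = emeasure (R m Y \<bind> K) A + emeasure (R m Z \<bind> K) A" .
    then show ?thesis
      using finite_measure.emeasure_finite[OF fin_RK[OF m(1) Y(1) m(2)], of A]
        finite_measure.emeasure_finite[OF fin_RK[OF m(1) Z m(2)], of A]
      by (simp add: measure_def enn2real_plus less_top)
  qed
  show ?thesis
  proof (rule tv_diff_least)
    fix P assume P: "finite P" "P \<subseteq> sets (\<alpha> \<bind> K)" "disjoint P" "\<Union>P = space (\<alpha> \<bind> K)"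
    have P': "P \<subseteq> sets N" "\<Union>P = space N"
      using P sets_K[OF refl] sets_eq_imp_space_eq[OF sets_K[OF refl]] by auto
    let ?aY = "\<lambda>A. measure (R \<alpha> Y \<bind> K) A" and ?aZ = "\<lambda>A. measure (R \<alpha> Z \<bind> K) A"
    let ?bY = "\<lambda>A. measure (R \<beta> Y \<bind> K) A" and ?bZ = "\<lambda>A. measure (R \<beta> Z \<bind> K) A"
    have sum: "(\<Sum>A\<in>P. measure (R m S \<bind> K) A) = measure m S"
      if "sets m = sets \<alpha>" "finite_measure m" "S \<in> sets \<alpha>" for m S
      using sum_measure_partition[OF fin_RK[OF that(1,3,2)] P(1) _ P(3)] P' tot[OF that(1,3)]
      by (simp add: sets_RK[OF that(1)] space_RK[OF that(1)] measure_def)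
    have "(\<Sum>A\<in>P. \<bar>measure (\<alpha> \<bind> K) A - measure (\<beta> \<bind> K) A\<bar>)
        \<le> (\<Sum>A\<in>P. (?aY A - ?bY A) + (?bZ A - ?aZ A))"
    proof (rule sum_mono)
      fix A assume "A \<in> P"
      then have A: "A \<in> sets N" using P' by auto
      have "?bY A \<le> ?aY A"
        using mono[OF sets refl Y(1) A Y(2)] finite_measure.emeasure_finite[OF fin_RK[OF refl Y(1) fin(1)], of A]
        by (simp add: measure_def enn2real_mono less_top)
      moreover have "?aZ A \<le> ?bZ A"
      proof -
        have "emeasure (R \<alpha> Z \<bind> K) A \<le> emeasure (R \<beta> Z \<bind> K) A"
          by (rule mono[OF refl sets Z A]) (auto intro!: Y(3) simp: Z_def)
        then show ?thesis
          using finite_measure.emeasure_finite[OF fin_RK[OF sets Z fin(2)], of A]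
          by (simp add: measure_def enn2real_mono less_top)
      qed
      ultimately show "\<bar>measure (\<alpha> \<bind> K) A - measure (\<beta> \<bind> K) A\<bar> \<le> (?aY A - ?bY A) + (?bZ A - ?aZ A)"
        unfolding split[OF refl fin(1) A] split[OF sets fin(2) A] by linarith
    qed
    also have "\<dots> = (measure \<alpha> Y - measure \<beta> Y) + (measure \<beta> Z - measure \<alpha> Z)"
      by (simp add: sum.distrib sum_subtractf sum[OF refl fin(1)] sum[OF sets fin(2)] Y(1) Z)
    also have "\<dots> \<le> \<bar>measure \<alpha> Y - measure \<beta> Y\<bar> + \<bar>measure \<alpha> Z - measure \<beta> Z\<bar>" by linarith
    also have "\<dots> = (\<Sum>A\<in>{Y, Z}. \<bar>measure \<alpha> A - measure \<beta> A\<bar>)"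
    proof (cases "Y = Z")
      case True
      then show ?thesis using ne sets.sets_into_space[OF Y(1)] by (auto simp: Z_def)
    qed simp
    also have "\<dots> \<le> tv_diff \<alpha> \<beta>"
      using Y(1) Z sets.sets_into_space[OF Y(1)]
      by (intro tv_diff_upper[OF fin sets]) (auto simp: Z_def disjoint_def)
    finally show "(\<Sum>A\<in>P. \<bar>measure (\<alpha> \<bind> K) A - measure (\<beta> \<bind> K) A\<bar>) \<le> tv_diff \<alpha> \<beta>" .
  qed
qed

section \<open>Moments and transport costs\<close>

lemma powr_add_le:
  fixes s t p :: real
  assumes "0 \<le> s" "0 \<le> t" "0 < p"
  shows "(s + t) powr p \<le> 2 powr p * (s powr p + t powr p)"
proof -
  have "(s + t) powr p \<le> (2 * max s t) powr p" by (rule powr_mono2) (use assms in auto)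
  also have "\<dots> = 2 powr p * max s t powr p" using assms by (simp add: powr_mult)
  also have "\<dots> \<le> 2 powr p * (s powr p + t powr p)"
    by (rule mult_left_mono) (auto simp: max_def)
  finally show ?thesis .
qed

lemma ennreal_powr_add_le:
  fixes s t p :: real
  assumes "0 \<le> s" "0 \<le> t" "0 < p"
  shows "ennreal ((s + t) powr p) \<le> ennreal (2 powr p) * (ennreal (s powr p) + ennreal (t powr p))"
  using ennreal_leI[OF powr_add_le[OF assms]] by (simp add: ennreal_mult' flip: ennreal_plus)

lemma fin_measures_p_imp: "\<mu> \<in> fin_measures_p p Y d \<Longrightarrow> \<mu> \<in> fin_measures Y d"
  by (simp add: fin_measures_p_def)

lemma fin_measures_UNIV: "\<mu> \<in> fin_measures UNIV dist \<longleftrightarrow> sets \<mu> = sets borel \<and> finite_measure \<mu>"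
  by (simp add: fin_measures_def borel_metric_dist)

lemma finite_moment_any:
  fixes \<mu> :: "'a::polish_space measure"
  assumes \<mu>: "\<mu> \<in> fin_measures_p p UNIV dist" and p: "0 < p"
  shows "(\<integral>\<^sup>+y. ennreal (dist y x0 powr p) \<partial>\<mu>) < \<infinity>"
proof -
  obtain y0 where y0: "(\<integral>\<^sup>+y. ennreal (dist y y0 powr p) \<partial>\<mu>) < \<infinity>" and s: "sets \<mu> = sets borel"
    and f: "finite_measure \<mu>"
    using \<mu> by (auto simp: fin_measures_p_def fin_measures_UNIV)
  note s[measurable_cong]
  have "(\<integral>\<^sup>+y. ennreal (dist y x0 powr p) \<partial>\<mu>)
      \<le> (\<integral>\<^sup>+y. ennreal (2 powr p) * (ennreal (dist y y0 powr p) + ennreal (dist y0 x0 powr p)) \<partial>\<mu>)"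
  proof (rule nn_integral_mono)
    fix y
    have "ennreal (dist y x0 powr p) \<le> ennreal ((dist y y0 + dist y0 x0) powr p)"
      using p by (intro ennreal_leI powr_mono2) (auto simp: dist_triangle)
    also have "\<dots> \<le> ennreal (2 powr p) * (ennreal (dist y y0 powr p) + ennreal (dist y0 x0 powr p))"
      by (rule ennreal_powr_add_le) (use p in auto)
    finally show "ennreal (dist y x0 powr p) \<le> ennreal (2 powr p) * (ennreal (dist y y0 powr p) + ennreal (dist y0 x0 powr p))" .
  qed
  also have "\<dots> = ennreal (2 powr p) * ((\<integral>\<^sup>+y. ennreal (dist y y0 powr p) \<partial>\<mu>)
      + ennreal (dist y0 x0 powr p) * emeasure \<mu> (space \<mu>))"
    by (subst nn_integral_cmult) (auto simp: nn_integral_add)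
  also have "\<dots> < \<infinity>"
    using y0 finite_measure.emeasure_finite[OF f, of "space \<mu>"]
    by (simp add: ennreal_mult_less_top less_top)
  finally show ?thesis .
qed

text \<open>The normalised product measure is a coupling of finite cost.  Finiteness matters because
\<^const>\<open>wasserstein\<close> applies \<^const>\<open>enn2real\<close>, which sends \<open>\<infinity>\<close> to \<open>0\<close> and so is monotone only
below \<open>\<infinity>\<close>.\<close>

lemma finite_product_cost:
  fixes \<mu> \<nu> :: "'a::polish_space measure"
  assumes \<mu>: "\<mu> \<in> fin_measures_p p UNIV dist" and \<nu>: "\<nu> \<in> fin_measures_p p UNIV dist"
    and p: "0 < p" and m: "mass \<mu> = mass \<nu>"
  shows "ennreal (mass \<mu>) * (INF \<pi>\<in>couplings UNIV dist \<mu> \<nu>. \<integral>\<^sup>+ z. ennreal (dist (fst z) (snd z) powr p) \<partial>\<pi>) < \<infinity>"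
proof (cases "mass \<mu> = 0")
  case False
  have \<mu>': "sets \<mu> = sets borel" "finite_measure \<mu>" and \<nu>': "sets \<nu> = sets borel" "finite_measure \<nu>"
    using \<mu> \<nu> by (auto simp: fin_measures_p_def fin_measures_UNIV)
  define c where "c = mass \<mu>"
  have c: "c > 0" "c = mass \<nu>" using False m by (simp_all add: c_def mass_def less_le)
  define \<mu>1 \<nu>1 where "\<mu>1 = scale_measure (ennreal (1 / c)) \<mu>" and "\<nu>1 = scale_measure (ennreal (1 / c)) \<nu>"
  have s1: "sets \<mu>1 = sets borel" "sets \<nu>1 = sets borel"
    by (simp_all add: \<mu>1_def \<nu>1_def \<mu>' \<nu>')
  note s1[measurable_cong]
  have sp1: "space \<mu>1 = UNIV" "space \<nu>1 = UNIV" using s1[THEN sets_eq_imp_space_eq] by simp_all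
  have pr: "prob_space (scale_measure (ennreal (1 / c)) m)" if "finite_measure m" "c = mass m" for m :: "'a measure"
    using that c(1)
    by (intro prob_spaceI)
       (simp add: space_scale_measure finite_measure.emeasure_eq_measure mass_def flip: ennreal_mult ennreal_1)
  interpret M: prob_space \<mu>1 unfolding \<mu>1_def by (rule pr[OF \<mu>'(2)]) (simp add: c_def)
  interpret N: prob_space \<nu>1 unfolding \<nu>1_def by (rule pr[OF \<nu>'(2) c(2)])
  interpret P: pair_prob_space \<mu>1 \<nu>1 ..
  have sP: "sets (\<mu>1 \<Otimes>\<^sub>M \<nu>1) = sets (borel :: ('a \<times> 'a) measure)"
    using sets_pair_measure_cong[OF s1] unfolding borel_prod .
  have em1: "emeasure \<mu>1 A = ennreal (measure \<mu> A / c)" "emeasure \<nu>1 A = ennreal (measure \<nu> A / c)" for A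
    using c(1) by (simp_all add: \<mu>1_def \<nu>1_def finite_measure.emeasure_eq_measure[OF \<mu>'(2)]
        finite_measure.emeasure_eq_measure[OF \<nu>'(2)] flip: ennreal_mult)
  have "\<mu>1 \<Otimes>\<^sub>M \<nu>1 \<in> couplings UNIV dist \<mu> \<nu>"
    unfolding couplings_def borel_metric2_dist borel_metric_dist
  proof (safe)
    show "prob_space (\<mu>1 \<Otimes>\<^sub>M \<nu>1)" by (rule P.prob_space_axioms)
    fix A :: "'a set" assume A: "A \<in> sets borel"
    have As: "A \<in> sets \<mu>1" "A \<in> sets \<nu>1" using A s1 by simp_all
    have "measure (\<mu>1 \<Otimes>\<^sub>M \<nu>1) (A \<times> space \<nu>1) = measure \<mu>1 A"
      using N.emeasure_pair_measure_Times[OF As(1) sets.top] by (simp add: measure_def N.emeasure_space_1)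
    then show "mass \<mu> * measure (\<mu>1 \<Otimes>\<^sub>M \<nu>1) (A \<times> UNIV) = measure \<mu> A"
      using c(1) by (simp add: sp1 measure_def[of \<mu>1] em1 c_def[symmetric])
    have "measure (\<mu>1 \<Otimes>\<^sub>M \<nu>1) (space \<mu>1 \<times> A) = measure \<nu>1 A"
      using N.emeasure_pair_measure_Times[of "space \<mu>1" \<mu>1 A, OF sets.top As(2)] by (simp add: measure_def M.emeasure_space_1)
    then show "mass \<nu> * measure (\<mu>1 \<Otimes>\<^sub>M \<nu>1) (UNIV \<times> A) = measure \<nu> A"
      using c(1) by (simp add: sp1 measure_def[of \<nu>1] em1 c(2)[symmetric])
  qed (simp_all add: sP)
  then have "(INF \<pi>\<in>couplings UNIV dist \<mu> \<nu>. \<integral>\<^sup>+ z. ennreal (dist (fst z) (snd z) powr p) \<partial>\<pi>)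
      \<le> (\<integral>\<^sup>+ z. ennreal (dist (fst z) (snd z) powr p) \<partial>(\<mu>1 \<Otimes>\<^sub>M \<nu>1))"
    by (rule INF_lower)
  also have "\<dots> < \<infinity>"
  proof -
    obtain x0 :: 'a where True by simp
    define F where "F y = ennreal (dist y x0 powr p)" for y
    have [measurable]: "F \<in> borel_measurable borel" unfolding F_def by measurable
    have F1: "(\<integral>\<^sup>+y. F y \<partial>\<mu>1) < \<infinity>" "(\<integral>\<^sup>+y. F y \<partial>\<nu>1) < \<infinity>"
      using finite_moment_any[OF \<mu> p, of x0] finite_moment_any[OF \<nu> p, of x0] \<mu>'(1) \<nu>'(1)
      by (simp_all add: \<mu>1_def \<nu>1_def nn_integral_scale_measure measurable_cong_sets[OF \<mu>'(1) refl]
            measurable_cong_sets[OF \<nu>'(1) refl] ennreal_mult_less_top flip: F_def)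
    have "(\<integral>\<^sup>+ z. ennreal (dist (fst z) (snd z) powr p) \<partial>(\<mu>1 \<Otimes>\<^sub>M \<nu>1))
        \<le> (\<integral>\<^sup>+ z. ennreal (2 powr p) * (F (fst z) + F (snd z)) \<partial>(\<mu>1 \<Otimes>\<^sub>M \<nu>1))"
    proof (rule nn_integral_mono)
      fix z :: "'a \<times> 'a"
      have "ennreal (dist (fst z) (snd z) powr p) \<le> ennreal ((dist (fst z) x0 + dist (snd z) x0) powr p)"
        using p by (intro ennreal_leI powr_mono2) (auto simp: dist_triangle2)
      also have "\<dots> \<le> ennreal (2 powr p) * (F (fst z) + F (snd z))"
        unfolding F_def by (rule ennreal_powr_add_le) (use p in auto)
      finally show "ennreal (dist (fst z) (snd z) powr p) \<le> ennreal (2 powr p) * (F (fst z) + F (snd z))" .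
    qed
    also have "\<dots> = ennreal (2 powr p) * ((\<integral>\<^sup>+ z. F (fst z) \<partial>(\<mu>1 \<Otimes>\<^sub>M \<nu>1)) + (\<integral>\<^sup>+ z. F (snd z) \<partial>(\<mu>1 \<Otimes>\<^sub>M \<nu>1)))"
      by (subst nn_integral_cmult, measurable, subst nn_integral_add, measurable)
    also have "(\<integral>\<^sup>+ z. F (fst z) \<partial>(\<mu>1 \<Otimes>\<^sub>M \<nu>1)) = (\<integral>\<^sup>+x. F x \<partial>\<mu>1)"
      using N.nn_integral_fst[of "\<lambda>z. F (fst z)" \<mu>1] N.emeasure_space_1 by simp
    also have "(\<integral>\<^sup>+ z. F (snd z) \<partial>(\<mu>1 \<Otimes>\<^sub>M \<nu>1)) = (\<integral>\<^sup>+x. F x \<partial>\<nu>1)"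
      using N.nn_integral_fst[of "\<lambda>z. F (snd z)" \<mu>1] M.emeasure_space_1 by simp
    finally show ?thesis using F1 by (simp add: ennreal_mult_less_top le_less_trans)
  qed
  finally show ?thesis by (simp add: ennreal_mult_less_top)
qed simp

lemma wasserstein_nonneg: "0 \<le> wasserstein p Y d \<mu> \<nu>"
  by (simp add: wasserstein_def)

lemma tv_diff_nonneg:
  assumes "finite_measure \<mu>" "finite_measure \<nu>" "sets \<nu> = sets \<mu>"
  shows "0 \<le> tv_diff \<mu> \<nu>"
proof -
  have "0 \<le> (\<Sum>A\<in>{space \<mu>}. \<bar>measure \<mu> A - measure \<nu> A\<bar>)" by simp
  also have "\<dots> \<le> tv_diff \<mu> \<nu>" by (rule tv_diff_upper[OF assms]) auto
  finally show ?thesis .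
qed

lemma gen_wasserstein_le:
  assumes ab: "0 \<le> a" "0 \<le> b" and \<mu>: "\<mu> \<in> fin_measures Y d" and \<nu>: "\<nu> \<in> fin_measures Y d"
    and comp: "\<mu>' \<in> fin_measures_p p Y d" "\<nu>' \<in> fin_measures_p p Y d" "mass \<mu>' = mass \<nu>'"
  shows "gen_wasserstein a b p Y d \<mu> \<nu>
    \<le> a * tv_diff \<mu> \<mu>' + a * tv_diff \<nu> \<nu>' + b * wasserstein p Y d \<mu>' \<nu>'"
  unfolding gen_wasserstein_def
proof (rule cInf_lower)
  have tv: "0 \<le> tv_diff m m'" if "m \<in> fin_measures Y d" "m' \<in> fin_measures_p p Y d" for m m'
    using that by (intro tv_diff_nonneg) (simp_all add: fin_measures_def fin_measures_p_def)
  show "bdd_below {a * tv_diff \<mu> \<mu>' + a * tv_diff \<nu> \<nu>' + b * wasserstein p Y d \<mu>' \<nu>' | \<mu>' \<nu>'.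
            \<mu>' \<in> fin_measures_p p Y d \<and> \<nu>' \<in> fin_measures_p p Y d \<and> mass \<mu>' = mass \<nu>'}"
  proof (rule bdd_belowI, elim CollectE exE conjE)
    fix x \<mu>' \<nu>' assume "\<mu>' \<in> fin_measures_p p Y d" "\<nu>' \<in> fin_measures_p p Y d"
      and x: "x = a * tv_diff \<mu> \<mu>' + a * tv_diff \<nu> \<nu>' + b * wasserstein p Y d \<mu>' \<nu>'"
    then show "0 \<le> x"
      unfolding x using ab tv[OF \<mu>] tv[OF \<nu>]
      by (intro add_nonneg_nonneg mult_nonneg_nonneg wasserstein_nonneg) simp_all
  qed
qed (use comp in blast)

text \<open>The measure \<open>\<mu>0\<close> shows that there is a competitor; the infimum of the empty set of reals would be
an arbitrary value.\<close>

lemma gen_wasserstein_greatest: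
  assumes "\<mu>0 \<in> fin_measures_p p Y d"
    and "\<And>\<mu>' \<nu>'. \<mu>' \<in> fin_measures_p p Y d \<Longrightarrow> \<nu>' \<in> fin_measures_p p Y d \<Longrightarrow> mass \<mu>' = mass \<nu>' \<Longrightarrow>
      c \<le> a * tv_diff \<mu> \<mu>' + a * tv_diff \<nu> \<nu>' + b * wasserstein p Y d \<mu>' \<nu>'"
  shows "c \<le> gen_wasserstein a b p Y d \<mu> \<nu>"
  unfolding gen_wasserstein_def
proof (rule cInf_greatest)
  show "{a * tv_diff \<mu> \<mu>' + a * tv_diff \<nu> \<nu>' + b * wasserstein p Y d \<mu>' \<nu>' | \<mu>' \<nu>'.
            \<mu>' \<in> fin_measures_p p Y d \<and> \<nu>' \<in> fin_measures_p p Y d \<and> mass \<mu>' = mass \<nu>'} \<noteq> {}"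
    using assms(1) by blast
qed (use assms(2) in blast)

lemma null_measure_fin_p: "null_measure borel \<in> fin_measures_p p UNIV dist"
  by (auto simp: fin_measures_p_def fin_measures_UNIV finite_measureI nn_integral_null_measure)

section \<open>Invariant lifts of measures on the orbit space\<close>

text \<open>The \<open>\<sigma>\<close>-algebra constructed on the group is only known to contain the level sets of continuous real
functions.  This suffices for maps into a metric space, where every open set is such a
level set of a distance function.\<close>

lemma borel_measurable_from_real_continuous:
  fixes M :: "'g::topological_space measure" and f :: "'g \<Rightarrow> 'a::metric_space"
  assumes sp: "space M = UNIV"
    and real: "\<And>h::'g \<Rightarrow> real. continuous_on UNIV h \<Longrightarrow> h \<in> borel_measurable M"
    and f: "continuous_on UNIV f"
  shows "f \<in> borel_measurable M"
proof (rule borel_measurableI)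
  fix S :: "'a set" assume "open S"
  show "f -` S \<inter> space M \<in> sets M"
  \<comment> \<open>The whole space is treated apart, because \<open>infdist\<close> to the empty set is \<open>0\<close> by convention.\<close>
  proof (cases "S = UNIV")
    case False
    have [measurable]: "(\<lambda>g. infdist (f g) (- S)) \<in> borel_measurable M"
      by (intro real continuous_on_infdist f)
    have "x \<in> S \<longleftrightarrow> infdist x (- S) \<noteq> 0" for x
      using in_closed_iff_infdist_zero[of "- S" x] \<open>open S\<close> False by auto
    then have "f -` S \<inter> space M = {g\<in>space M. infdist (f g) (- S) \<noteq> 0}" by auto
    also have "\<dots> \<in> sets M" by measurable
    finally show ?thesis .
  qed simp
qed

lemma dense_sequence_exists:
  "\<exists>e :: nat \<Rightarrow> 'a::{metric_space, second_countable_topology}. \<forall>x. \<forall>r>0. \<exists>i. dist (e i) x < r"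
proof -
  obtain D :: "'a set" where D: "countable D" "\<And>X. open X \<Longrightarrow> X \<noteq> {} \<Longrightarrow> \<exists>d\<in>D. d \<in> X"
    by (rule countable_dense_setE) blast
  have "\<exists>i. dist (from_nat_into D i) x < r" if "r > 0" for x r
  proof -
    have "x \<in> ball x r" using that by simp
    then obtain d where "d \<in> D" "d \<in> ball x r" using D(2)[OF open_ball] by blast
    then show ?thesis
      using from_nat_into_surj[OF D(1), of d] by (auto simp: dist_commute)
  qed
  then show ?thesis by blast
qed

text \<open>Replacing \<open>x\<close> by the first member of a dense sequence within \<open>1 / (n + 1)\<close> makes \<open>f\<close> depend on
\<open>x\<close> through a countable parameter, hence jointly measurable; the Lipschitz bound controls the limit
\<open>n \<rightarrow> \<infinity>\<close>.  For the action of a group that is not second countable, joint continuity would not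
suffice: the product \<open>\<sigma>\<close>-algebra may miss open sets.\<close>

lemma borel_measurable_pair_metric:
  fixes f :: "'a::{metric_space, second_countable_topology} \<Rightarrow> 'g \<Rightarrow> 'b::metric_space"
  assumes meas: "\<And>x. f x \<in> M \<rightarrow>\<^sub>M borel"
    and lip: "\<And>x y g. g \<in> space M \<Longrightarrow> dist (f x g) (f y g) \<le> dist x y"
  shows "(\<lambda>(x, g). f x g) \<in> borel \<Otimes>\<^sub>M M \<rightarrow>\<^sub>M borel"
proof -
  obtain e :: "nat \<Rightarrow> 'a" where dense: "\<And>x r. r > 0 \<Longrightarrow> \<exists>i. dist (e i) x < r"
    using dense_sequence_exists by blast
  define i where "i n x = (LEAST i. dist (e i) x < 1 / real (Suc n))" for n x
  have i: "dist (e (i n x)) x < 1 / real (Suc n)" for n x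
    unfolding i_def by (rule LeastI_ex) (rule dense, simp)
  have [measurable]: "i n \<in> borel \<rightarrow>\<^sub>M count_space UNIV" for n
    unfolding i_def by measurable
  show ?thesis
  proof (rule borel_measurable_LIMSEQ_metric)
    fix n
    show "(\<lambda>(x, g). f (e (i n x)) g) \<in> borel \<Otimes>\<^sub>M M \<rightarrow>\<^sub>M borel"
      unfolding case_prod_beta
      by (rule measurable_compose_countable[where f = "\<lambda>j p. f (e j) (snd p)" and g = "\<lambda>p. i n (fst p)"])
         (use meas in measurable)
  next
    fix p :: "'a \<times> 'g" assume p: "p \<in> space (borel \<Otimes>\<^sub>M M)"
    obtain x g where xg: "p = (x, g)" "g \<in> space M" using p by (auto simp: space_pair_measure)
    have "(\<lambda>n. f (e (i n x)) g) \<longlonglongrightarrow> f x g"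
    proof (rule metric_LIMSEQ_I)
      fix r :: real assume "0 < r"
      then obtain N where N: "1 / real (Suc N) < r" by (rule nat_approx_posE)
      have "dist (f (e (i n x)) g) (f x g) < r" if "n \<ge> N" for n
      proof -
        have "1 / real (Suc n) \<le> 1 / real (Suc N)" using that by (simp add: frac_le)
        then show ?thesis using lip[OF xg(2), of "e (i n x)" x] i[of n x] N by linarith
      qed
      then show "\<exists>N. \<forall>n\<ge>N. dist (f (e (i n x)) g) (f x g) < r" by blast
    qed
    then show "(\<lambda>n. (case p of (x, g) \<Rightarrow> f (e (i n x)) g)) \<longlonglongrightarrow> (case p of (x, g) \<Rightarrow> f x g)"
      by (simp add: xg)
  qed
qed

text \<open>\<open>H\<close> stands for a normalised Haar measure.  Its \<open>\<sigma>\<close>-algebra is left open, as the construction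
above gives only a lower bound for it.\<close>

locale haar_isometric_action =
  fixes act :: "'a::polish_space \<Rightarrow> 'g::topological_group_add \<Rightarrow> 'a" and H :: "'g measure"
  assumes cpt: "compact (UNIV :: 'g set)"
    and ra: "right_action act"
    and cont: "continuous_on UNIV (\<lambda>(x, g). act x g)"
    and iso: "\<And>x y g. dist (act x g) (act y g) = dist x y"
    and prob_H: "prob_space H" and space_H: "space H = UNIV"
    and real_H: "\<And>f::'g \<Rightarrow> real. continuous_on UNIV f \<Longrightarrow> f \<in> borel_measurable H"
    and left_meas[measurable]: "\<And>k. (\<lambda>g. k + g) \<in> H \<rightarrow>\<^sub>M H"
    and left_inv: "\<And>k. distr H H (\<lambda>g. k + g) = H"
    and right_meas[measurable]: "\<And>k. (\<lambda>g. g + k) \<in> H \<rightarrow>\<^sub>M H"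
    and right_inv: "\<And>k. distr H H (\<lambda>g. g + k) = H"
begin

sublocale H: prob_space H by (rule prob_H)

abbreviation Q where "Q \<equiv> orbit_space act"
abbreviation dQ where "dQ \<equiv> orbit_dist act"
abbreviation q where "q \<equiv> orbit_map act"
abbreviation MQ where "MQ \<equiv> borel_metric Q dQ"

lemma act_add: "act x (g + h) = act (act x g) h" and act_0: "act x 0 = x"
  using ra by (auto simp: right_action_def)

lemma act_minus: "act (act x g) (- g) = x" "act (act x (- g)) g = x"
  using right_action_inverse[OF ra, of x g] right_action_inverse[OF ra, of x "- g"] by auto

lemma act_image: "(\<lambda>x. act x g) ` A = (\<lambda>x. act x (- g)) -` A"
proof (intro equalityI subsetI)
  fix y assume "y \<in> (\<lambda>x. act x (- g)) -` A"
  then have "act (act y (- g)) g \<in> (\<lambda>x. act x g) ` A" by blast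
  then show "y \<in> (\<lambda>x. act x g) ` A" by (simp only: act_minus)
next
  fix y assume "y \<in> (\<lambda>x. act x g) ` A"
  then obtain x where "x \<in> A" "y = act x g" by blast
  then show "y \<in> (\<lambda>x. act x (- g)) -` A" by (simp add: act_minus)
qed

lemma q_act: "q (act x g) = q x"
  using orbit_map_eq_iff[OF ra, of x "act x g"] by (simp add: orbit_map_def)

lemma q_in_Q[simp]: "q x \<in> Q" by (simp add: orbit_space_def)

lemma Q_cases: assumes "P \<in> Q" obtains x where "P = q x"
  using assms by (auto simp: orbit_space_def)

sublocale Q: Metric_space Q dQ
  by (rule Metric_space_orbit_space[OF ra iso cpt cont])

lemma cont_act: "continuous_on UNIV (act x)"
proof -
  have "continuous_on UNIV (\<lambda>g. (\<lambda>(x, g). act x g) (x, g))"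
    by (rule continuous_on_compose2[OF cont]) (auto intro!: continuous_intros)
  then show ?thesis by simp
qed

lemma dQ_le: "dQ (q x) (q y) \<le> dist (act x g) y"
  unfolding orbit_dist_orbit_map[OF ra iso] by (rule cINF_lower[OF bdd_belowI[of _ 0]]) auto

lemma dQ_le_dist: "dQ (q x) (q y) \<le> dist x y"
  using dQ_le[of x y 0] by (simp add: act_0)

lemma dQ_attained: "\<exists>g. dQ (q x) (q y) = dist (act x g) y"
proof -
  have "continuous_on UNIV (\<lambda>g. dist (act x g) y)" by (intro continuous_intros cont_act)
  then obtain g where "\<forall>h. dist (act x g) y \<le> dist (act x h) y"
    using continuous_attains_inf[OF cpt] by auto
  then have "(INF h. dist (act x h) y) = dist (act x g) y"
    by (intro cInf_eq_minimum) auto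
  then show ?thesis unfolding orbit_dist_orbit_map[OF ra iso] by blast
qed

text \<open>A point of the quotient ball around \<open>q b\<close> has a representative in the ball around \<open>b\<close>, because the
distance of orbits is attained and can be realised with \<open>b\<close> as one of the two points.\<close>

lemma q_open: assumes "open B" shows "openin Q.mtopology (q ` B)"
  unfolding Q.openin_mtopology
proof (intro conjI allI impI)
  show "q ` B \<subseteq> Q" by auto
  fix P assume "P \<in> q ` B"
  then obtain b where b: "b \<in> B" "P = q b" by blast
  obtain r where r: "r > 0" "ball b r \<subseteq> B" using assms b(1) openE by blast
  have "Q.mball P r \<subseteq> q ` B"
  proof
    fix R assume "R \<in> Q.mball P r"
    then have R: "R \<in> Q" "dQ (q b) R < r" by (auto simp: b)
    obtain z where z: "R = q z" using R(1) by (rule Q_cases)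
    obtain g where g: "dist (act b g) z < r" using dQ_attained[of b z] R(2) z by auto
    have "dist b (act z (- g)) = dist (act b g) z"
      using iso[of "act b g" "- g" z] by (simp add: act_minus)
    then have "act z (- g) \<in> B" using g r(2) by auto
    then show "R \<in> q ` B" using z q_act[of z "- g"] by (metis imageI)
  qed
  then show "\<exists>r>0. Q.mball P r \<subseteq> q ` B" using r(1) by blast
qed

lemma openin_Q_iff: "openin Q.mtopology U \<longleftrightarrow> U \<subseteq> Q \<and> open (q -` U)"
proof
  assume U: "openin Q.mtopology U"
  have "open (q -` U)"
    unfolding open_dist
  proof
    fix x assume "x \<in> q -` U"
    then obtain r where r: "r > 0" "Q.mball (q x) r \<subseteq> U"
      using U by (auto simp: Q.openin_mtopology)
    have "q y \<in> U" if "dist y x < r" for y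
      using r(2) dQ_le_dist[of x y] that by (auto simp: dist_commute)
    then show "\<exists>e>0. \<forall>y. dist y x < e \<longrightarrow> y \<in> q -` U" using r(1) by auto
  qed
  then show "U \<subseteq> Q \<and> open (q -` U)" using openin_subset[OF U] by simp
next
  assume U: "U \<subseteq> Q \<and> open (q -` U)"
  then have "q ` (q -` U) = U" by (auto simp: orbit_space_def)
  then show "openin Q.mtopology U" using q_open U by metis
qed

lemma space_MQ[simp]: "space MQ = Q"
  by (simp add: borel_metric_def borel_of_top_def space_measure_of_conv)

lemma sets_MQ_openin: "openin Q.mtopology U \<Longrightarrow> U \<in> sets MQ"
  using openin_subset[of Q.mtopology]
  by (auto simp: borel_metric_def borel_of_top_def intro!: sigma_sets.Basic)

lemma q_measurable[measurable]: "q \<in> borel \<rightarrow>\<^sub>M MQ"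
  by (rule measurable_orbit_map[OF ra iso cpt cont])

text \<open>Measurability on the orbit space can be tested upstairs for functions whose superlevel sets are
open: the orbit map carries these open sets to open sets.\<close>

lemma borel_measurable_MQ_lsc:
  fixes \<phi> :: "'a set \<Rightarrow> ennreal"
  assumes "\<And>c. open {x. c < \<phi> (q x)}"
  shows "\<phi> \<in> borel_measurable MQ"
proof (rule borel_measurableI_greater)
  fix c
  have "{P \<in> Q. c < \<phi> P} = q ` {x. c < \<phi> (q x)}" by (auto simp: orbit_space_def)
  then show "{P \<in> space MQ. c < \<phi> P} \<in> sets MQ"
    using q_open[OF assms[of c]] by (simp add: sets_MQ_openin)
qed

lemma act_measurable[measurable]: "act x \<in> H \<rightarrow>\<^sub>M borel"
  by (rule borel_measurable_from_real_continuous[OF space_H real_H cont_act])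

lemma act_measurable_pair[measurable]: "(\<lambda>(x, g). act x g) \<in> borel \<Otimes>\<^sub>M H \<rightarrow>\<^sub>M borel"
  by (rule borel_measurable_pair_metric) (simp_all add: iso)

lemma act_measurable_fst: "(\<lambda>x. act x g) \<in> borel \<rightarrow>\<^sub>M borel"
  by (intro borel_measurable_continuous_onI) (auto simp: continuous_on_iff iso)

definition orbit_law :: "'a \<Rightarrow> 'a measure" where
  "orbit_law x = distr H borel (act x)"

lemma sets_orbit_law[simp, measurable_cong]: "sets (orbit_law x) = sets borel"
  and space_orbit_law[simp]: "space (orbit_law x) = UNIV"
  by (simp_all add: orbit_law_def)

lemma prob_orbit_law: "prob_space (orbit_law x)"
  unfolding orbit_law_def by (rule H.prob_space_distr) measurable

lemma emeasure_orbit_law: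
  "B \<in> sets borel \<Longrightarrow> emeasure (orbit_law x) B = emeasure H {g. act x g \<in> B}"
  by (simp add: orbit_law_def emeasure_distr space_H vimage_def)

text \<open>Left invariance of \<open>H\<close> makes the law of \<open>x g\<close> a function of the orbit of \<open>x\<close>.\<close>

lemma orbit_law_act: "orbit_law (act x k) = orbit_law x"
proof -
  have "orbit_law x = distr (distr H H (\<lambda>g. k + g)) borel (act x)"
    by (simp add: left_inv orbit_law_def)
  also have "\<dots> = distr H borel (act x \<circ> (\<lambda>g. k + g))"
    by (rule distr_distr) measurable
  also have "\<dots> = orbit_law (act x k)" by (simp add: comp_def act_add orbit_law_def)
  finally show ?thesis ..
qed

text \<open>Right invariance of \<open>H\<close> makes the law of \<open>x g\<close> invariant under the action.\<close>

lemma distr_orbit_law: "distr (orbit_law x) borel (\<lambda>y. act y k) = orbit_law x"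
proof -
  have "distr (orbit_law x) borel (\<lambda>y. act y k) = distr H borel ((\<lambda>y. act y k) \<circ> act x)"
    unfolding orbit_law_def by (rule distr_distr[OF act_measurable_fst]) measurable
  also have "\<dots> = distr H borel (act x \<circ> (\<lambda>g. g + k))" by (simp add: comp_def act_add)
  also have "\<dots> = distr (distr H H (\<lambda>g. g + k)) borel (act x)"
    by (rule distr_distr[symmetric]) measurable
  finally show ?thesis by (simp add: right_inv orbit_law_def)
qed

text \<open>By lemma \<open>orbit_law_act\<close> the choice of the representative does not matter.\<close>

definition orbit_kernel :: "'a set \<Rightarrow> 'a measure" where
  "orbit_kernel P = orbit_law (SOME x. x \<in> P)"

lemma orbit_kernel_q: "orbit_kernel (q x) = orbit_law x"
proof -
  have "(SOME y. y \<in> q x) \<in> q x" by (rule someI[of _ "act x 0"]) (simp add: orbit_map_def)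
  then obtain g where "(SOME y. y \<in> q x) = act x g" by (auto simp: orbit_map_def)
  then show ?thesis by (simp add: orbit_kernel_def orbit_law_act)
qed

text \<open>An open set \<open>B\<close> is the increasing union of the sets \<open>A n\<close> of points further than \<open>1 / (n + 1)\<close> from
the complement of \<open>B\<close>.  As the group acts by isometries, if \<open>x g\<close> lies in \<open>A n\<close> and \<open>y\<close> is that close
to \<open>x\<close>, then \<open>y g\<close> lies in \<open>B\<close>.\<close>

lemma orbit_law_lsc:
  assumes "open B"
  shows "open {x. c < emeasure (orbit_law x) B}"
proof (cases "B = UNIV")
  case True
  then show ?thesis
    using prob_space.emeasure_space_1[OF prob_orbit_law] by simp
next
  case False
  define A where "A n = {y. 1 / real (Suc n) < infdist y (- B)}" for n
  have [measurable]: "A n \<in> sets borel" for n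
    unfolding A_def by (intro borel_open open_Collect_less continuous_intros) simp_all
  have inc: "incseq A"
  proof (rule incseq_SucI)
    fix n
    have "1 / real (Suc (Suc n)) \<le> 1 / real (Suc n)" by (simp add: frac_le)
    then show "A n \<subseteq> A (Suc n)" unfolding A_def by force
  qed
  have "y \<in> B \<longleftrightarrow> infdist y (- B) > 0" for y
    using in_closed_iff_infdist_zero[of "- B" y] assms False infdist_nonneg[of y "- B"]
    by (auto simp: less_le)
  moreover have "(\<exists>n. 1 / real (Suc n) < r) \<longleftrightarrow> r > 0" for r :: real
  proof
    assume "\<exists>n. 1 / real (Suc n) < r"
    then obtain n where "1 / real (Suc n) < r" ..
    moreover have "0 < 1 / real (Suc n)" by simp
    ultimately show "0 < r" by linarith
  qed (use nat_approx_posE in blast)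
  ultimately have B: "B = (\<Union>n. A n)" unfolding A_def by blast
  show ?thesis
    unfolding open_dist
  proof safe
    fix x assume x: "c < emeasure (orbit_law x) B"
    have "emeasure (orbit_law x) B = (SUP n. emeasure (orbit_law x) (A n))"
      unfolding B by (rule SUP_emeasure_incseq[symmetric]) (use inc in auto)
    then obtain n where n: "c < emeasure (orbit_law x) (A n)"
      using x by (auto simp: less_SUP_iff)
    show "\<exists>e>0. \<forall>y. dist y x < e \<longrightarrow> y \<in> {x. c < emeasure (orbit_law x) B}"
    proof (intro exI conjI allI impI)
      fix y assume y: "dist y x < 1 / real (Suc n)"
      have "{g. act x g \<in> A n} \<subseteq> {g. act y g \<in> B}"
      proof safe
        fix g assume g: "act x g \<in> A n"
        show "act y g \<in> B"
        proof (rule ccontr)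
          assume "act y g \<notin> B"
          then have "infdist (act x g) (- B) \<le> dist (act x g) (act y g)"
            by (intro infdist_le) simp
          then show False using g y by (simp add: A_def iso dist_commute)
        qed
      qed
      then have "emeasure (orbit_law x) (A n) \<le> emeasure (orbit_law y) B"
        using assms measurable_sets[OF act_measurable[of y], of B]
        by (simp add: emeasure_orbit_law space_H vimage_def emeasure_mono)
      then show "y \<in> {x. c < emeasure (orbit_law x) B}" using n by simp
    qed simp
  qed
qed

lemma orbit_kernel_measurable: "orbit_kernel \<in> MQ \<rightarrow>\<^sub>M prob_algebra borel"
proof (rule measurable_prob_algebra_generated[where \<Omega> = UNIV and G = "Collect open"])
  show "sets (borel :: 'a measure) = sigma_sets UNIV (Collect open)" by (rule sets_borel)
  show "Int_stable (Collect open :: 'a set set)" by (auto simp: Int_stable_def)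
  show "prob_space (orbit_kernel P)" "sets (orbit_kernel P) = sets borel" for P
    by (simp_all add: orbit_kernel_def prob_orbit_law)
  show "(\<lambda>P. emeasure (orbit_kernel P) A) \<in> borel_measurable MQ" if "A \<in> Collect open" for A
    by (rule borel_measurable_MQ_lsc) (use that orbit_law_lsc in \<open>simp add: orbit_kernel_q\<close>)
qed simp

lemma orbit_kernel_subprob[measurable]: "orbit_kernel \<in> MQ \<rightarrow>\<^sub>M subprob_algebra borel"
  by (rule measurable_prob_algebraD[OF orbit_kernel_measurable])

text \<open>The mixture of the uniform laws on the orbits, with \<open>\<nu>\<close> as the mixing measure.\<close>

definition lift :: "'a set measure \<Rightarrow> 'a measure" where
  "lift \<nu> = \<nu> \<bind> orbit_kernel"

context
  fixes \<nu> :: "'a set measure"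
  assumes \<nu>[measurable_cong]: "sets \<nu> = sets MQ"
begin

lemma space_\<nu>: "space \<nu> = Q" using sets_eq_imp_space_eq[OF \<nu>] by simp

lemma space_\<nu>_ne: "space \<nu> \<noteq> {}" using q_in_Q unfolding space_\<nu> by blast

lemma orbit_kernel_measurable_\<nu>: "orbit_kernel \<in> \<nu> \<rightarrow>\<^sub>M subprob_algebra borel"
  using orbit_kernel_subprob by (simp add: measurable_cong_sets[OF \<nu> refl])

lemma sets_lift[simp]: "sets (lift \<nu>) = sets borel"
  unfolding lift_def by (rule sets_bind_measurable[OF orbit_kernel_measurable_\<nu> space_\<nu>_ne])

lemma space_lift[simp]: "space (lift \<nu>) = UNIV"
  using sets_eq_imp_space_eq[OF sets_lift] by simp

lemma emeasure_lift:
  "B \<in> sets borel \<Longrightarrow> emeasure (lift \<nu>) B = (\<integral>\<^sup>+P. emeasure (orbit_kernel P) B \<partial>\<nu>)"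
  unfolding lift_def by (rule emeasure_bind[OF space_\<nu>_ne orbit_kernel_measurable_\<nu>])

lemma nn_integral_lift:
  "f \<in> borel_measurable borel \<Longrightarrow> (\<integral>\<^sup>+x. f x \<partial>lift \<nu>) = (\<integral>\<^sup>+P. \<integral>\<^sup>+x. f x \<partial>orbit_kernel P \<partial>\<nu>)"
  unfolding lift_def by (rule nn_integral_bind[OF _ orbit_kernel_measurable_\<nu>])

lemma push_lift: "push_orbit act (lift \<nu>) = \<nu>"
proof (rule measure_eqI)
  show "sets (push_orbit act (lift \<nu>)) = sets \<nu>" by (simp add: push_orbit_def \<nu>)
  fix A assume "A \<in> sets (push_orbit act (lift \<nu>))"
  then have A: "A \<in> sets MQ" by (simp add: push_orbit_def)
  then have A': "q -` A \<in> sets borel" using measurable_sets[OF q_measurable, of A] by simp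
  have qm: "q \<in> lift \<nu> \<rightarrow>\<^sub>M MQ" by (simp add: measurable_cong_sets[OF sets_lift refl])
  have "emeasure (push_orbit act (lift \<nu>)) A = emeasure (lift \<nu>) (q -` A)"
    by (simp add: push_orbit_def emeasure_distr[OF qm A])
  also have "\<dots> = (\<integral>\<^sup>+P. emeasure (orbit_kernel P) (q -` A) \<partial>\<nu>)" by (rule emeasure_lift[OF A'])
  also have "\<dots> = (\<integral>\<^sup>+P. indicator A P \<partial>\<nu>)"
  proof (rule nn_integral_cong)
    fix P assume "P \<in> space \<nu>"
    then obtain x where "P = q x" unfolding space_\<nu> by (rule Q_cases)
    then show "emeasure (orbit_kernel P) (q -` A) = indicator A P"
      using H.emeasure_space_1
      by (auto simp: orbit_kernel_q emeasure_orbit_law[OF A'] q_act space_H indicator_def)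
  qed
  also have "\<dots> = emeasure \<nu> A" using A \<nu> by simp
  finally show "emeasure (push_orbit act (lift \<nu>)) A = emeasure \<nu> A" .
qed

lemma emeasure_lift_act:
  assumes A: "A \<in> sets borel"
  shows "emeasure (lift \<nu>) ((\<lambda>x. act x g) ` A) = emeasure (lift \<nu>) A"
proof -
  have im: "(\<lambda>x. act x g) ` A = (\<lambda>x. act x (- g)) -` A"
    by (rule act_image)
  have v: "(\<lambda>x. act x (- g)) -` A \<in> sets borel"
    using measurable_sets[OF act_measurable_fst[of "- g"] A] by simp
  have "emeasure (orbit_kernel P) ((\<lambda>x. act x (- g)) -` A) = emeasure (orbit_kernel P) A" for P
  proof -
    let ?x = "SOME x. x \<in> P"
    have "emeasure (orbit_law ?x) A = emeasure (distr (orbit_law ?x) borel (\<lambda>y. act y (- g))) A"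
      by (simp add: distr_orbit_law)
    also have "\<dots> = emeasure (orbit_law ?x) ((\<lambda>x. act x (- g)) -` A)"
      using emeasure_distr[of "\<lambda>y. act y (- g)" "orbit_law ?x" borel A] A act_measurable_fst[of "- g"]
      by (simp add: measurable_cong_sets[OF sets_orbit_law refl])
    finally show ?thesis by (simp add: orbit_kernel_def)
  qed
  then show ?thesis by (simp add: im emeasure_lift A v)
qed

end

lemma push_measurable: "sets \<mu> = sets borel \<Longrightarrow> q \<in> \<mu> \<rightarrow>\<^sub>M MQ"
  using measurable_cong_sets[of \<mu> borel MQ MQ] q_measurable by simp

lemma sets_push[simp]: "sets (push_orbit act \<mu>) = sets MQ"
  by (simp add: push_orbit_def)

lemma lift_push_eq_bind:
  assumes \<mu>: "sets \<mu> = sets borel"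
  shows "lift (push_orbit act \<mu>) = \<mu> \<bind> orbit_law"
proof -
  have "space \<mu> = UNIV" using sets_eq_imp_space_eq[OF \<mu>] by simp
  then have "lift (push_orbit act \<mu>) = \<mu> \<bind> (\<lambda>x. orbit_kernel (q x))"
    unfolding lift_def push_orbit_def
    by (intro bind_distr[OF push_measurable[OF \<mu>] orbit_kernel_subprob]) simp
  then show ?thesis by (simp add: orbit_kernel_q)
qed

lemma orbit_law_measurable[measurable]: "orbit_law \<in> borel \<rightarrow>\<^sub>M subprob_algebra borel"
  using measurable_compose[OF q_measurable orbit_kernel_subprob] by (simp add: orbit_kernel_q)

text \<open>By Fubini, the mass that the lift gives to \<open>B\<close> is the average over \<open>g\<close> of the mass that \<open>\<mu>\<close> gives to
\<open>{x. x g \<in> B}\<close>, and every term of this average equals \<open>\<mu> B\<close> by invariance.\<close>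

lemma lift_push:
  assumes \<mu>: "\<mu> \<in> inv_measures act"
  shows "lift (push_orbit act \<mu>) = \<mu>"
proof (rule measure_eqI)
  have sets_\<mu>: "sets \<mu> = sets borel" and fin: "finite_measure \<mu>"
    using \<mu> unfolding inv_measures_def fin_measures_def borel_metric_dist by blast+
  have inv: "emeasure \<mu> ((\<lambda>x. act x g) ` A) = emeasure \<mu> A" if "A \<in> sets borel" for g A
    using \<mu> that sets_\<mu> unfolding inv_measures_def by blast
  have space_\<mu>: "space \<mu> = UNIV" using sets_eq_imp_space_eq[OF sets_\<mu>] by simp
  show "sets (lift (push_orbit act \<mu>)) = sets \<mu>" by (simp add: sets_\<mu>)
  fix B assume "B \<in> sets (lift (push_orbit act \<mu>))"
  then have B[measurable]: "B \<in> sets borel" by simp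
  interpret \<mu>: finite_measure \<mu> by (rule fin)
  interpret P: pair_sigma_finite \<mu> H ..
  have ind: "(\<lambda>(x, g). indicator B (act x g) :: ennreal) \<in> borel_measurable (\<mu> \<Otimes>\<^sub>M H)"
    using measurable_compose[OF act_measurable_pair borel_measurable_indicator[OF B]]
    by (simp add: measurable_cong_sets[OF sets_pair_measure_cong[OF sets_\<mu> refl] refl] case_prod_beta)
  have "emeasure (lift (push_orbit act \<mu>)) B = (\<integral>\<^sup>+x. emeasure (orbit_law x) B \<partial>\<mu>)"
    unfolding lift_push_eq_bind[OF sets_\<mu>]
    by (rule emeasure_bind[where N = borel])
       (use orbit_law_measurable B in \<open>simp_all add: space_\<mu> measurable_cong_sets[OF sets_\<mu> refl]\<close>)
  also have "\<dots> = (\<integral>\<^sup>+x. \<integral>\<^sup>+g. indicator B (act x g) \<partial>H \<partial>\<mu>)"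
  proof (rule nn_integral_cong)
    fix x
    have "emeasure (orbit_law x) B = (\<integral>\<^sup>+y. indicator B y \<partial>orbit_law x)"
      using B by (simp add: nn_integral_indicator)
    also have "\<dots> = (\<integral>\<^sup>+g. indicator B (act x g) \<partial>H)"
      unfolding orbit_law_def by (rule nn_integral_distr) (use B in measurable)
    finally show "emeasure (orbit_law x) B = (\<integral>\<^sup>+g. indicator B (act x g) \<partial>H)" .
  qed
  also have "\<dots> = (\<integral>\<^sup>+g. \<integral>\<^sup>+x. indicator B (act x g) \<partial>\<mu> \<partial>H)"
    by (rule P.Fubini'[symmetric, OF ind])
  also have "\<dots> = (\<integral>\<^sup>+g. emeasure \<mu> B \<partial>H)"
  proof (rule nn_integral_cong)
    fix g
    have v: "(\<lambda>x. act x g) -` B \<in> sets borel"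
      using measurable_sets[OF act_measurable_fst[of g] B] by simp
    have im: "(\<lambda>x. act x (- g)) ` B = (\<lambda>x. act x g) -` B"
      using act_image[of "- g" B] by simp
    have "(\<integral>\<^sup>+x. indicator B (act x g) \<partial>\<mu>) = (\<integral>\<^sup>+x. indicator ((\<lambda>x. act x g) -` B) x \<partial>\<mu>)"
      by (simp add: indicator_def vimage_def)
    also have "\<dots> = emeasure \<mu> ((\<lambda>x. act x g) -` B)" using v sets_\<mu> by simp
    also have "\<dots> = emeasure \<mu> B" using inv[OF B, of "- g"] by (simp add: im)
    finally show "(\<integral>\<^sup>+x. indicator B (act x g) \<partial>\<mu>) = emeasure \<mu> B" .
  qed
  also have "\<dots> = emeasure \<mu> B" using H.emeasure_space_1 by simp
  finally show "emeasure (lift (push_orbit act \<mu>)) B = emeasure \<mu> B" .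
qed

abbreviation M2 where "M2 \<equiv> borel_metric2 Q dQ"

lemma space_M2[simp]: "space M2 = Q \<times> Q"
  by (simp add: borel_metric2_def borel_of_top_def space_measure_of_conv)

lemma openin_M2: "openin (prod_topology Q.mtopology Q.mtopology) U \<Longrightarrow> U \<in> sets M2"
  unfolding borel_metric2_def borel_of_top_def
  by (rule in_measure_of) (use openin_subset in blast)+

lemma measurable_M2I:
  assumes "f \<in> space M \<rightarrow> Q \<times> Q"
    and "\<And>U. openin (prod_topology Q.mtopology Q.mtopology) U \<Longrightarrow> f -` U \<inter> space M \<in> sets M"
  shows "f \<in> M \<rightarrow>\<^sub>M M2"
  unfolding borel_metric2_def borel_of_top_def
proof (rule measurable_measure_of)
  show "{U. openin (prod_topology Q.mtopology Q.mtopology) U} \<subseteq> Pow (topspace (prod_topology Q.mtopology Q.mtopology))"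
    using openin_subset by blast
qed (use assms in simp_all)

lemma qq_measurable[measurable]: "map_prod q q \<in> borel \<rightarrow>\<^sub>M M2"
proof (rule measurable_M2I)
  fix U assume U: "openin (prod_topology Q.mtopology Q.mtopology) U"
  have "open (map_prod q q -` U)"
  proof (rule open_prod_intro)
    fix z assume "z \<in> map_prod q q -` U"
    then have zU: "(q (fst z), q (snd z)) \<in> U" by (cases z) simp
    obtain A B where AB: "openin Q.mtopology A" "openin Q.mtopology B" "q (fst z) \<in> A" "q (snd z) \<in> B" "A \<times> B \<subseteq> U"
      using U[unfolded openin_prod_topology_alt, rule_format, OF zU] by (elim exE conjE)
    then show "\<exists>A B. open A \<and> open B \<and> z \<in> A \<times> B \<and> A \<times> B \<subseteq> map_prod q q -` U"
      by (intro exI[of _ "q -` A"] exI[of _ "q -` B"]) (auto simp: openin_Q_iff mem_Times_iff)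
  qed
  then show "map_prod q q -` U \<inter> space borel \<in> sets borel" by simp
qed auto

lemma measurable_MQI:
  assumes "f \<in> space M \<rightarrow> Q" and "\<And>U. openin Q.mtopology U \<Longrightarrow> f -` U \<inter> space M \<in> sets M"
  shows "f \<in> M \<rightarrow>\<^sub>M MQ"
  unfolding borel_metric_def borel_of_top_def
proof (rule measurable_measure_of)
  show "{U. openin Q.mtopology U} \<subseteq> Pow (topspace Q.mtopology)" using openin_subset by blast
qed (use assms in simp_all)

lemma fst_M2[measurable]: "fst \<in> M2 \<rightarrow>\<^sub>M MQ" and snd_M2[measurable]: "snd \<in> M2 \<rightarrow>\<^sub>M MQ"
proof -
  have op: "openin Q.mtopology Q" using openin_topspace[of Q.mtopology] by simp
  have *: "fst -` U \<inter> space M2 \<in> sets M2 \<and> snd -` U \<inter> space M2 \<in> sets M2" if U: "openin Q.mtopology U" for U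
  proof -
    have "U \<subseteq> Q" using openin_subset[OF U] by simp
    then have "fst -` U \<inter> space M2 = U \<times> Q" "snd -` U \<inter> space M2 = Q \<times> U" by auto
    then show ?thesis using op U by (simp add: openin_M2 openin_prod_Times_iff)
  qed
  show "fst \<in> M2 \<rightarrow>\<^sub>M MQ" by (rule measurable_MQI) (simp add: Pi_iff, use * in blast)
  show "snd \<in> M2 \<rightarrow>\<^sub>M MQ" by (rule measurable_MQI) (simp add: Pi_iff, use * in blast)
qed

text \<open>The analogue of \<open>borel_measurable_MQ_lsc\<close> for pairs of orbits; a product of two open maps is open.\<close>

lemma borel_measurable_M2_lsc:
  fixes \<phi> :: "'a set \<times> 'a set \<Rightarrow> ennreal"
  assumes "\<And>c. open {(x, y). c < \<phi> (q x, q y)}"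
  shows "\<phi> \<in> borel_measurable M2"
proof (rule borel_measurableI_greater)
  fix c
  let ?W = "{(x, y). c < \<phi> (q x, q y)}"
  have eq: "{z \<in> Q \<times> Q. c < \<phi> z} = map_prod q q ` ?W"
  proof (intro equalityI subsetI)
    fix z assume z: "z \<in> {z \<in> Q \<times> Q. c < \<phi> z}"
    then obtain x y where "z = (q x, q y)" by (auto simp: orbit_space_def)
    then show "z \<in> map_prod q q ` ?W" using z by (intro image_eqI[of _ _ "(x, y)"]) auto
  qed auto
  have "openin (prod_topology Q.mtopology Q.mtopology) (map_prod q q ` ?W)"
    unfolding openin_prod_topology_alt
  proof (intro allI impI)
    fix P R assume "(P, R) \<in> map_prod q q ` ?W"
    then obtain x y where xy: "P = q x" "R = q y" "(x, y) \<in> ?W" by auto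
    obtain A B where AB: "open A" "open B" "(x, y) \<in> A \<times> B" "A \<times> B \<subseteq> ?W"
      using assms[of c] xy(3) by (rule open_prod_elim)
    then show "\<exists>U V. openin Q.mtopology U \<and> openin Q.mtopology V \<and> P \<in> U \<and> R \<in> V \<and> U \<times> V \<subseteq> map_prod q q ` ?W"
    proof (intro exI conjI)
      show "openin Q.mtopology (q ` A)" "openin Q.mtopology (q ` B)" using AB by (simp_all add: q_open)
      show "P \<in> q ` A" "R \<in> q ` B" using AB(3) xy by auto
      have "q ` A \<times> q ` B = map_prod q q ` (A \<times> B)" by (rule map_prod_surj_on[OF refl refl, symmetric])
      then show "q ` A \<times> q ` B \<subseteq> map_prod q q ` ?W" using image_mono[OF AB(4)] by simp
    qed
  qed
  then show "{z \<in> space M2. c < \<phi> z} \<in> sets M2"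
    unfolding space_M2 eq by (rule openin_M2)
qed

lemma dQ_lipschitz: "\<bar>dQ (q x) (q y) - dQ (q x') (q y')\<bar> \<le> dist x x' + dist y y'"
proof -
  have tri: "dQ (q u) (q v) \<le> dist u u' + dQ (q u') (q v') + dist v v'" for u u' v v'
  proof -
    have "dQ (q u) (q v) \<le> dQ (q u) (q u') + (dQ (q u') (q v') + dQ (q v') (q v))"
      using Q.triangle[of "q u" "q u'" "q v"] Q.triangle[of "q u'" "q v'" "q v"] by simp
    then show ?thesis using dQ_le_dist[of u u'] dQ_le_dist[of v' v] by (simp add: dist_commute)
  qed
  show ?thesis
    using tri[of x y x' y'] tri[of x' y' x y] by (simp add: dist_commute abs_le_iff)
qed

lemma continuous_dQ: "continuous_on UNIV (\<lambda>z. dQ (q (fst z)) (q (snd z)))"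
  unfolding continuous_on_iff
proof (intro ballI allI impI)
  fix z :: "'a \<times> 'a" and e :: real assume "0 < e"
  show "\<exists>d>0. \<forall>z'\<in>UNIV. dist z' z < d \<longrightarrow> dist (dQ (q (fst z')) (q (snd z'))) (dQ (q (fst z)) (q (snd z))) < e"
  proof (intro exI conjI ballI impI)
    fix z' assume "dist z' z < e / 2"
    then have "dist (fst z') (fst z) < e / 2" "dist (snd z') (snd z) < e / 2"
      using dist_fst_le[of z' z] dist_snd_le[of z' z] by linarith+
    then show "dist (dQ (q (fst z')) (q (snd z'))) (dQ (q (fst z)) (q (snd z))) < e"
      using dQ_lipschitz[of "fst z'" "snd z'" "fst z" "snd z"] by (simp add: dist_real_def)
  qed (use \<open>0 < e\<close> in simp)
qed

lemma dQ_powr_measurable: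
  assumes "0 < p"
  shows "(\<lambda>z. ennreal (dQ (fst z) (snd z) powr p)) \<in> borel_measurable M2"
    and "(\<lambda>P. ennreal (dQ P (q y) powr p)) \<in> borel_measurable MQ"
proof -
  have c: "continuous_on UNIV (\<lambda>z. ennreal (dQ (q (fst z)) (q (snd z)) powr p))"
    by (intro continuous_on_ennreal continuous_on_powr' continuous_dQ continuous_on_const)
       (use assms in auto)
  show "(\<lambda>z. ennreal (dQ (fst z) (snd z) powr p)) \<in> borel_measurable M2"
  proof (rule borel_measurable_M2_lsc)
    fix a
    have "open {z. a < ennreal (dQ (q (fst z)) (q (snd z)) powr p)}"
      by (rule open_Collect_less[OF continuous_on_const c])
    then show "open {(x, z). a < ennreal (dQ (fst (q x, q z)) (snd (q x, q z)) powr p)}"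
      by (simp add: case_prod_beta')
  qed
  show "(\<lambda>P. ennreal (dQ P (q y) powr p)) \<in> borel_measurable MQ"
  proof (rule borel_measurable_MQ_lsc)
    fix a
    have "continuous_on UNIV (\<lambda>x. (\<lambda>z. ennreal (dQ (q (fst z)) (q (snd z)) powr p)) (x, y))"
      by (rule continuous_on_compose2[OF c]) (auto intro!: continuous_intros)
    then show "open {x. a < ennreal (dQ (q x) (q y) powr p)}"
      by (intro open_Collect_less continuous_on_const) simp
  qed
qed

lemma fin_measures_Q: "\<nu> \<in> fin_measures Q dQ \<longleftrightarrow> sets \<nu> = sets MQ \<and> finite_measure \<nu>"
  by (simp add: fin_measures_def)

lemma emeasure_push:
  assumes "sets \<mu> = sets borel" "A \<in> sets MQ"
  shows "emeasure (push_orbit act \<mu>) A = emeasure \<mu> (q -` A)"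
  unfolding push_orbit_def
  by (subst emeasure_distr[OF push_measurable[OF assms(1)] assms(2)])
     (simp add: sets_eq_imp_space_eq[OF assms(1)])

lemma mass_push:
  assumes "sets \<mu> = sets borel" shows "mass (push_orbit act \<mu>) = mass \<mu>"
proof -
  have "q -` Q = UNIV" by auto
  then have "emeasure (push_orbit act \<mu>) Q = emeasure \<mu> UNIV"
    using emeasure_push[OF assms sets.top] by simp
  moreover have "space (push_orbit act \<mu>) = Q" "space \<mu> = UNIV"
    using sets_eq_imp_space_eq[OF assms] by (simp_all add: push_orbit_def)
  ultimately show ?thesis by (simp add: mass_def measure_def)
qed

lemma push_fin:
  assumes "\<mu> \<in> fin_measures UNIV dist" shows "push_orbit act \<mu> \<in> fin_measures Q dQ"
proof -
  have \<mu>: "sets \<mu> = sets borel" "finite_measure \<mu>" using assms by (simp_all add: fin_measures_UNIV)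
  show ?thesis
    using finite_measure.finite_measure_distr[OF \<mu>(2) push_measurable[OF \<mu>(1)]]
    unfolding fin_measures_Q push_orbit_def by simp
qed

lemma push_fin_p:
  assumes "\<mu> \<in> fin_measures_p p UNIV dist" "0 < p"
  shows "push_orbit act \<mu> \<in> fin_measures_p p Q dQ"
proof -
  obtain y0 where \<mu>: "\<mu> \<in> fin_measures UNIV dist" and y0: "(\<integral>\<^sup>+y. ennreal (dist y y0 powr p) \<partial>\<mu>) < \<infinity>"
    using assms(1) by (auto simp: fin_measures_p_def)
  have s: "sets \<mu> = sets borel" using \<mu> by (simp add: fin_measures_UNIV)
  have "(\<integral>\<^sup>+P. ennreal (dQ P (q y0) powr p) \<partial>push_orbit act \<mu>) = (\<integral>\<^sup>+y. ennreal (dQ (q y) (q y0) powr p) \<partial>\<mu>)"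
    unfolding push_orbit_def
    by (rule nn_integral_distr[OF push_measurable[OF s]])
       (simp only: measurable_distr_eq1 dQ_powr_measurable(2)[OF assms(2)])
  also have "\<dots> \<le> (\<integral>\<^sup>+y. ennreal (dist y y0 powr p) \<partial>\<mu>)"
    using assms(2) by (intro nn_integral_mono ennreal_leI powr_mono2 dQ_le_dist) auto
  finally have "(\<integral>\<^sup>+P. ennreal (dQ P (q y0) powr p) \<partial>push_orbit act \<mu>) < \<infinity>"
    using y0 by (rule le_less_trans)
  then show ?thesis
    using push_fin[OF \<mu>] q_in_Q[of y0] unfolding fin_measures_p_def by blast
qed

lemma mass_lift:
  assumes "sets \<nu> = sets MQ" shows "emeasure (lift \<nu>) UNIV = emeasure \<nu> (space \<nu>)" "mass (lift \<nu>) = mass \<nu>"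
proof -
  have "emeasure (lift \<nu>) UNIV = (\<integral>\<^sup>+P. emeasure (orbit_kernel P) UNIV \<partial>\<nu>)"
    by (rule emeasure_lift[OF assms]) simp
  also have "\<dots> = (\<integral>\<^sup>+P. 1 \<partial>\<nu>)"
    using prob_space.emeasure_space_1[OF prob_orbit_law]
    by (intro nn_integral_cong) (simp add: orbit_kernel_def)
  finally show "emeasure (lift \<nu>) UNIV = emeasure \<nu> (space \<nu>)" by simp
  then show "mass (lift \<nu>) = mass \<nu>" by (simp add: mass_def measure_def space_lift[OF assms])
qed

lemma lift_fin:
  assumes "\<nu> \<in> fin_measures Q dQ" shows "lift \<nu> \<in> fin_measures UNIV dist"
proof -
  have \<nu>: "sets \<nu> = sets MQ" "finite_measure \<nu>" using assms by (simp_all add: fin_measures_Q)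
  have "finite_measure (lift \<nu>)"
    by (rule finite_measureI)
       (simp add: space_lift[OF \<nu>(1)] mass_lift[OF \<nu>(1)] finite_measure.emeasure_finite[OF \<nu>(2)])
  then show ?thesis by (simp add: fin_measures_UNIV sets_lift[OF \<nu>(1)])
qed

lemma lift_inv:
  assumes "\<nu> \<in> fin_measures Q dQ" shows "lift \<nu> \<in> inv_measures act"
proof -
  have \<nu>: "sets \<nu> = sets MQ" using assms by (simp add: fin_measures_Q)
  show ?thesis
    unfolding inv_measures_def mem_Collect_eq
    by (intro conjI lift_fin[OF assms] allI ballI emeasure_lift_act[OF \<nu>]) (simp only: sets_lift[OF \<nu>])
qed

text \<open>Points of one orbit are at nearly the same distance from \<open>x0\<close>: the error is at most the radius of the
compact orbit of \<open>x0\<close>.\<close>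

lemma dist_orbit_bound: "\<exists>D\<ge>0. \<forall>x g. dist (act x g) x0 \<le> dQ (q x) (q x0) + D"
proof -
  have "continuous_on UNIV (\<lambda>g. dist (act x0 g) x0)" by (intro continuous_intros cont_act)
  then obtain k where k: "\<And>g. dist (act x0 g) x0 \<le> dist (act x0 k) x0"
    using continuous_attains_sup[OF cpt] by auto
  have "dist (act x g) x0 \<le> dQ (q x) (q x0) + dist (act x0 k) x0" for x g
  proof -
    obtain h where h: "dQ (q x) (q x0) = dist (act x h) x0" using dQ_attained by blast
    have g: "g = h + (- h + g)" by (simp add: add.assoc[symmetric])
    have "act x g = act (act x h) (- h + g)" by (subst g) (rule act_add)
    then have "dist (act x g) x0 \<le> dist (act (act x h) (- h + g)) (act x0 (- h + g)) + dist (act x0 (- h + g)) x0"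
      by (simp only: dist_triangle)
    then show ?thesis using k[of "- h + g"] by (simp only: iso h)
  qed
  then show ?thesis by (intro exI[of _ "dist (act x0 k) x0"]) auto
qed

lemma nn_integral_orbit_law_const:
  assumes "f \<in> borel_measurable borel" "\<And>g. f (act x g) = c"
  shows "(\<integral>\<^sup>+y. f y \<partial>orbit_law x) = c"
proof -
  have "(\<integral>\<^sup>+y. f y \<partial>orbit_law x) = (\<integral>\<^sup>+g. f (act x g) \<partial>H)"
    unfolding orbit_law_def by (rule nn_integral_distr) (use assms in measurable)
  then show ?thesis using H.emeasure_space_1 by (simp add: assms(2))
qed

lemma lift_fin_p:
  assumes "\<nu> \<in> fin_measures_p p Q dQ" "0 < p"
  shows "lift \<nu> \<in> fin_measures_p p UNIV dist"
proof -
  obtain P0 where \<nu>: "\<nu> \<in> fin_measures Q dQ" and P0: "P0 \<in> Q" "(\<integral>\<^sup>+P. ennreal (dQ P P0 powr p) \<partial>\<nu>) < \<infinity>"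
    using assms(1) by (auto simp: fin_measures_p_def)
  obtain x0 where x0: "P0 = q x0" using P0(1) by (rule Q_cases)
  have s: "sets \<nu> = sets MQ" and fin: "finite_measure \<nu>" using \<nu> by (simp_all add: fin_measures_Q)
  obtain D where D: "D \<ge> 0" "\<And>x g. dist (act x g) x0 \<le> dQ (q x) (q x0) + D"
    using dist_orbit_bound by blast
  have m: "(\<lambda>P. ennreal (dQ P P0 powr p)) \<in> borel_measurable \<nu>"
    using dQ_powr_measurable(2)[OF assms(2), of x0] measurable_cong_sets[OF s refl, of "borel :: ennreal measure"]
    by (simp add: x0)
  have "(\<integral>\<^sup>+y. ennreal (dist y x0 powr p) \<partial>lift \<nu>) = (\<integral>\<^sup>+P. \<integral>\<^sup>+y. ennreal (dist y x0 powr p) \<partial>orbit_kernel P \<partial>\<nu>)"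
    by (rule nn_integral_lift[OF s]) measurable
  also have "\<dots> \<le> (\<integral>\<^sup>+P. ennreal (2 powr p) * (ennreal (dQ P P0 powr p) + ennreal (D powr p)) \<partial>\<nu>)"
  proof (rule nn_integral_mono)
    fix P assume "P \<in> space \<nu>"
    then obtain x where x: "P = q x" using sets_eq_imp_space_eq[OF s] Q_cases by auto
    have "(\<integral>\<^sup>+y. ennreal (dist y x0 powr p) \<partial>orbit_kernel P) = (\<integral>\<^sup>+g. ennreal (dist (act x g) x0 powr p) \<partial>H)"
      unfolding x orbit_kernel_q orbit_law_def by (rule nn_integral_distr) measurable
    also have "\<dots> \<le> (\<integral>\<^sup>+g. ennreal (2 powr p) * (ennreal (dQ P P0 powr p) + ennreal (D powr p)) \<partial>H)"
    proof (rule nn_integral_mono)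
      fix g
      have "ennreal (dist (act x g) x0 powr p) \<le> ennreal ((dQ P P0 + D) powr p)"
        using D(2)[of x g] assms(2) by (intro ennreal_leI powr_mono2) (auto simp: x x0)
      also have "\<dots> \<le> ennreal (2 powr p) * (ennreal (dQ P P0 powr p) + ennreal (D powr p))"
        by (rule ennreal_powr_add_le) (use D(1) assms(2) in auto)
      finally show "ennreal (dist (act x g) x0 powr p) \<le> ennreal (2 powr p) * (ennreal (dQ P P0 powr p) + ennreal (D powr p))" .
    qed
    also have "\<dots> = ennreal (2 powr p) * (ennreal (dQ P P0 powr p) + ennreal (D powr p))"
      using H.emeasure_space_1 by simp
    finally show "(\<integral>\<^sup>+y. ennreal (dist y x0 powr p) \<partial>orbit_kernel P)
        \<le> ennreal (2 powr p) * (ennreal (dQ P P0 powr p) + ennreal (D powr p))" .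
  qed
  also have "\<dots> = ennreal (2 powr p) * (\<integral>\<^sup>+P. ennreal (dQ P P0 powr p) + ennreal (D powr p) \<partial>\<nu>)"
    by (rule nn_integral_cmult, rule borel_measurable_add[OF m borel_measurable_const])
  also have "\<dots> = ennreal (2 powr p) * ((\<integral>\<^sup>+P. ennreal (dQ P P0 powr p) \<partial>\<nu>) + ennreal (D powr p) * emeasure \<nu> (space \<nu>))"
    by (subst nn_integral_add[OF m borel_measurable_const]) simp
  also have "\<dots> < \<infinity>"
    using P0(2) finite_measure.emeasure_finite[OF fin, of "space \<nu>"]
    by (simp add: ennreal_mult_less_top less_top)
  finally show ?thesis using lift_fin[OF \<nu>] unfolding fin_measures_p_def by blast
qed

end

section \<open>Couplings on the orbit space and on the total space\<close>

context haar_isometric_action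
begin

text \<open>Take optimal group elements for all pairs of points of a dense sequence.  They are nearly optimal for
all other pairs, as both sides depend on \<open>x\<close> and \<open>y\<close> in a Lipschitz way.\<close>

lemma near_optimal_sequence:
  "\<exists>\<gamma>::nat \<Rightarrow> 'g. \<forall>x y. \<forall>\<delta>>0. \<exists>n. dist (act x (\<gamma> n)) y < dQ (q x) (q y) + \<delta>"
proof -
  obtain e :: "nat \<Rightarrow> 'a" where dense: "\<And>x r. r > 0 \<Longrightarrow> \<exists>i. dist (e i) x < r"
    using dense_sequence_exists by blast
  define h where "h i j = (SOME g. dQ (q (e i)) (q (e j)) = dist (act (e i) g) (e j))" for i j
  have h: "dQ (q (e i)) (q (e j)) = dist (act (e i) (h i j)) (e j)" for i j
    unfolding h_def by (rule someI_ex[OF dQ_attained])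
  have "\<exists>n. dist (act x (case_prod h (prod_decode n))) y < dQ (q x) (q y) + \<delta>" if "\<delta> > 0" for x y \<delta>
  proof -
    have pos: "\<delta> / 4 > 0" using that by simp
    obtain i where i: "dist (e i) x < \<delta> / 4" using dense[OF pos] by blast
    obtain j where j: "dist (e j) y < \<delta> / 4" using dense[OF pos] by blast
    have "dist (act x (h i j)) y
        \<le> dist (act x (h i j)) (act (e i) (h i j)) + dist (act (e i) (h i j)) (e j) + dist (e j) y"
      using dist_triangle[of "act x (h i j)" y "act (e i) (h i j)"]
        dist_triangle[of "act (e i) (h i j)" y "e j"] by linarith
    also have "\<dots> = dist x (e i) + dQ (q (e i)) (q (e j)) + dist (e j) y" by (simp add: iso h)
    also have "\<dots> < dQ (q x) (q y) + \<delta>"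
      using dQ_lipschitz[of "e i" "e j" x y] i j by (simp add: abs_le_iff dist_commute)
    finally show ?thesis by (intro exI[of _ "prod_encode (i, j)"]) simp
  qed
  then show ?thesis by blast
qed

text \<open>Choosing the first good member of a countable family keeps the selection measurable.\<close>

lemma near_optimal_selection:
  assumes p: "0 < p" and \<epsilon>: "0 < \<epsilon>"
  obtains \<gamma> :: "'a \<times> 'a \<Rightarrow> 'g" where
    "(\<lambda>z. act (fst z) (\<gamma> z)) \<in> borel \<rightarrow>\<^sub>M borel"
    "\<And>z. dist (act (fst z) (\<gamma> z)) (snd z) powr p \<le> dQ (q (fst z)) (q (snd z)) powr p + \<epsilon>"
proof -
  obtain s :: "nat \<Rightarrow> 'g" where s: "\<And>x y \<delta>. 0 < \<delta> \<Longrightarrow> \<exists>n. dist (act x (s n)) y < dQ (q x) (q y) + \<delta>"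
    using near_optimal_sequence by blast
  \<comment> \<open>The group element \<open>s n\<close> moves \<open>fst z\<close> close enough to \<open>snd z\<close>.\<close>
  define good where "good n z \<longleftrightarrow> dist (act (fst z) (s n)) (snd z) powr p \<le> dQ (q (fst z)) (q (snd z)) powr p + \<epsilon>"
    for n and z :: "'a \<times> 'a"
  have ex: "\<exists>n. good n z" for z
  proof -
    let ?d = "dQ (q (fst z)) (q (snd z))"
    have "((\<lambda>t. t powr p) \<longlongrightarrow> ?d powr p) (at_right ?d)"
      using p by (intro tendsto_powr' tendsto_ident_at tendsto_const) (auto simp: eventually_at_filter)
    then have "eventually (\<lambda>t. t powr p < ?d powr p + \<epsilon>) (at_right ?d)"
      by (rule order_tendstoD(2)) (use \<epsilon> in simp)
    then obtain t where t: "?d < t" "\<And>u. ?d < u \<Longrightarrow> u < t \<Longrightarrow> u powr p < ?d powr p + \<epsilon>"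
      unfolding eventually_at_right_field by blast
    obtain n where n: "dist (act (fst z) (s n)) (snd z) < ?d + (t - ?d) / 2"
      using s[of "(t - ?d) / 2" "fst z" "snd z"] t(1) by auto
    have "dist (act (fst z) (s n)) (snd z) powr p \<le> (?d + (t - ?d) / 2) powr p"
      using n p by (intro powr_mono2) auto
    also have "\<dots> < ?d powr p + \<epsilon>" by (rule t(2)) (use t(1) in \<open>simp_all add: field_simps\<close>)
    finally have "good n z" by (simp add: good_def)
    then show ?thesis ..
  qed
  define i where "i z = (LEAST n. good n z)" for z
  have good_i: "good (i z) z" for z unfolding i_def by (rule LeastI_ex[OF ex])
  have act_m: "(\<lambda>z. act (fst z) g) \<in> borel \<rightarrow>\<^sub>M borel" for g
    by (rule measurable_compose[OF _ act_measurable_fst]) (simp add: borel_measurable_continuous_onI continuous_on_fst)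
  have [measurable]: "good n \<in> borel \<rightarrow>\<^sub>M count_space UNIV" for n
  proof -
    have [measurable]: "(\<lambda>z. dQ (q (fst z)) (q (snd z))) \<in> borel_measurable borel"
      by (rule borel_measurable_continuous_onI[OF continuous_dQ])
    have [measurable]: "(\<lambda>z. act (fst z) (s n)) \<in> borel \<rightarrow>\<^sub>M borel" by (rule act_m)
    have [measurable]: "(snd :: 'a \<times> 'a \<Rightarrow> 'a) \<in> borel \<rightarrow>\<^sub>M borel"
      by (rule borel_measurable_continuous_onI) (intro continuous_intros)
    have "Measurable.pred borel (\<lambda>z. dist (act (fst z) (s n)) (snd z) powr p \<le> dQ (q (fst z)) (q (snd z)) powr p + \<epsilon>)"
      by measurable
    then show ?thesis by (simp add: good_def[abs_def])
  qed
  have i_m: "i \<in> borel \<rightarrow>\<^sub>M count_space UNIV"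
    unfolding i_def[abs_def] by measurable
  have "(\<lambda>z. act (fst z) (s (i z))) \<in> borel \<rightarrow>\<^sub>M borel"
    by (rule measurable_compose_countable[where f = "\<lambda>n z. act (fst z) (s n)", OF act_m i_m])
  then show ?thesis
    by (rule that[of "\<lambda>z. s (i z)"]) (use good_i in \<open>simp add: good_def\<close>)
qed

text \<open>Independent uniform points of two given orbits.  Independence is what makes the result depend on the
two orbits only.\<close>

definition pair_kernel :: "'a set \<times> 'a set \<Rightarrow> ('a \<times> 'a) measure" where
  "pair_kernel z = orbit_kernel (fst z) \<Otimes>\<^sub>M orbit_kernel (snd z)"

lemma pair_kernel_measurable: "pair_kernel \<in> M2 \<rightarrow>\<^sub>M subprob_algebra borel"
proof -
  have "(\<lambda>z. orbit_kernel (fst z) \<Otimes>\<^sub>M orbit_kernel (snd z)) \<in> M2 \<rightarrow>\<^sub>M subprob_algebra (borel \<Otimes>\<^sub>M borel)"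
    by (intro measurable_pair_measure measurable_compose[OF fst_M2 orbit_kernel_subprob]
        measurable_compose[OF snd_M2 orbit_kernel_subprob])
  then show ?thesis unfolding borel_prod pair_kernel_def[abs_def] .
qed

text \<open>A function of the two orbits is constant on the set that carries \<open>pair_kernel\<close>.\<close>

lemma nn_integral_pair_kernel_invariant:
  fixes F :: "'a \<times> 'a \<Rightarrow> ennreal"
  assumes F: "F \<in> borel_measurable borel" and inv: "\<And>x y. F (x, y) = \<Phi> (q x, q y)"
  shows "(\<integral>\<^sup>+w. F w \<partial>pair_kernel (q x, q y)) = \<Phi> (q x, q y)"
proof -
  have pr: "prob_space (orbit_kernel P)" for P by (simp add: orbit_kernel_def prob_orbit_law)
  interpret K: prob_space "orbit_law y" by (rule prob_orbit_law)
  have F': "F \<in> borel_measurable (orbit_law x \<Otimes>\<^sub>M orbit_law y)"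
    using F unfolding borel_prod[symmetric]
    by (simp add: measurable_cong_sets[OF sets_pair_measure_cong[OF sets_orbit_law sets_orbit_law] refl])
  have "(\<integral>\<^sup>+w. F w \<partial>pair_kernel (q x, q y)) = (\<integral>\<^sup>+u. \<integral>\<^sup>+v. F (u, v) \<partial>orbit_law y \<partial>orbit_law x)"
    unfolding pair_kernel_def by (simp add: orbit_kernel_q K.nn_integral_fst[OF F'])
  also have "\<dots> = (\<integral>\<^sup>+u. \<Phi> (q u, q y) \<partial>orbit_law x)"
  proof (rule nn_integral_cong)
    fix u
    have "(\<lambda>v. F (u, v)) \<in> borel_measurable borel"
      by (rule measurable_compose[OF _ F]) (intro borel_measurable_continuous_onI continuous_intros)
    then show "(\<integral>\<^sup>+v. F (u, v) \<partial>orbit_law y) = \<Phi> (q u, q y)"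
      by (rule nn_integral_orbit_law_const) (simp add: inv q_act)
  qed
  also have "\<dots> = \<Phi> (q x, q y)"
  proof (rule nn_integral_orbit_law_const)
    have "(\<lambda>u. F (u, y)) \<in> borel_measurable borel"
      by (rule measurable_compose[OF _ F]) (intro borel_measurable_continuous_onI continuous_intros)
    then show "(\<lambda>u. \<Phi> (q u, q y)) \<in> borel_measurable borel" by (simp add: inv)
  qed (simp add: q_act)
  finally show ?thesis .
qed

text \<open>The image of a coupling under \<open>q \<times> q\<close> couples the images, and \<open>q\<close> does not increase distances.\<close>

lemma couplings_push:
  assumes \<mu>: "sets \<mu> = sets borel" and \<nu>: "sets \<nu> = sets borel" and \<pi>: "\<pi> \<in> couplings UNIV dist \<mu> \<nu>"
    and p: "0 < p"
  shows "distr \<pi> M2 (map_prod q q) \<in> couplings Q dQ (push_orbit act \<mu>) (push_orbit act \<nu>)"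
    and "(\<integral>\<^sup>+z. ennreal (dQ (fst z) (snd z) powr p) \<partial>distr \<pi> M2 (map_prod q q))
      \<le> (\<integral>\<^sup>+z. ennreal (dist (fst z) (snd z) powr p) \<partial>\<pi>)"
proof -
  have s: "sets \<pi> = sets borel" and pr: "prob_space \<pi>"
    and m: "\<And>A. A \<in> sets borel \<Longrightarrow> mass \<mu> * measure \<pi> (A \<times> UNIV) = measure \<mu> A"
           "\<And>A. A \<in> sets borel \<Longrightarrow> mass \<nu> * measure \<pi> (UNIV \<times> A) = measure \<nu> A"
    using \<pi> unfolding couplings_def borel_metric2_dist borel_metric_dist by blast+
  have sp: "space \<pi> = UNIV" using sets_eq_imp_space_eq[OF s] by simp
  have qq: "map_prod q q \<in> \<pi> \<rightarrow>\<^sub>M M2"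
    using qq_measurable measurable_cong_sets[OF s refl, of M2] by blast
  have meas: "measure (distr \<pi> M2 (map_prod q q)) A = measure \<pi> (map_prod q q -` A)" if "A \<in> sets M2" for A
    using measure_distr[OF qq that] by (simp add: sp)
  have rect: "A \<times> Q \<in> sets M2" "Q \<times> A \<in> sets M2" if A: "A \<in> sets MQ" for A
  proof -
    have "A \<subseteq> Q" using sets.sets_into_space[OF A] by simp
    then have "A \<times> Q = fst -` A \<inter> space M2" "Q \<times> A = snd -` A \<inter> space M2" by auto
    then show "A \<times> Q \<in> sets M2" "Q \<times> A \<in> sets M2"
      using measurable_sets[OF fst_M2 A] measurable_sets[OF snd_M2 A] by simp_all
  qed
  have pull: "q -` A \<in> sets borel" if "A \<in> sets MQ" for A
    using measurable_sets[OF q_measurable that] by simp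
  have mp: "measure (push_orbit act m) A = measure m (q -` A)" if "sets m = sets borel" "A \<in> sets MQ" for m A
    using emeasure_push[OF that] by (simp add: measure_def)
  show "distr \<pi> M2 (map_prod q q) \<in> couplings Q dQ (push_orbit act \<mu>) (push_orbit act \<nu>)"
    unfolding couplings_def mem_Collect_eq
  proof (intro conjI ballI)
    show "prob_space (distr \<pi> M2 (map_prod q q))" by (rule prob_space.prob_space_distr[OF pr qq])
    fix A assume A: "A \<in> sets MQ"
    have "map_prod q q -` (A \<times> Q) = (q -` A) \<times> UNIV" "map_prod q q -` (Q \<times> A) = UNIV \<times> (q -` A)" by auto
    then show "mass (push_orbit act \<mu>) * measure (distr \<pi> M2 (map_prod q q)) (A \<times> Q) = measure (push_orbit act \<mu>) A"
      "mass (push_orbit act \<nu>) * measure (distr \<pi> M2 (map_prod q q)) (Q \<times> A) = measure (push_orbit act \<nu>) A"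
      using m(1)[OF pull[OF A]] m(2)[OF pull[OF A]]
      by (simp_all add: mass_push \<mu> \<nu> meas rect A mp)
  qed simp
  have "(\<integral>\<^sup>+z. ennreal (dQ (fst z) (snd z) powr p) \<partial>distr \<pi> M2 (map_prod q q))
      = (\<integral>\<^sup>+z. ennreal (dQ (q (fst z)) (q (snd z)) powr p) \<partial>\<pi>)"
    by (subst nn_integral_distr[OF qq]) (simp_all only: measurable_distr_eq1 dQ_powr_measurable(1)[OF p] fst_map_prod snd_map_prod)
  also have "\<dots> \<le> (\<integral>\<^sup>+z. ennreal (dist (fst z) (snd z) powr p) \<partial>\<pi>)"
    using p by (intro nn_integral_mono ennreal_leI powr_mono2 dQ_le_dist) auto
  finally show "(\<integral>\<^sup>+z. ennreal (dQ (fst z) (snd z) powr p) \<partial>distr \<pi> M2 (map_prod q q))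
      \<le> (\<integral>\<^sup>+z. ennreal (dist (fst z) (snd z) powr p) \<partial>\<pi>)" .
qed

text \<open>Draw a pair of orbits from \<open>\<pi>\<close> and independent uniform points \<open>x\<close>, \<open>y\<close> on them, giving \<open>\<pi>1\<close>.
Replace \<open>x\<close> by \<open>x \<gamma>\<close>, where \<open>\<gamma>\<close> depends on \<open>(x, y)\<close> and nearly realises the distance of the two
orbits, and finally apply one common Haar distributed element \<open>g\<close> to both points, giving \<open>\<pi>2\<close>.  The
cost is decided before \<open>g\<close> is applied.  The marginals are decided by \<open>g\<close>: whatever
point of an orbit it is applied to, the outcome is uniform on that orbit.\<close>

lemma couplings_lift:
  assumes \<alpha>: "\<alpha> \<in> fin_measures Q dQ" and \<beta>: "\<beta> \<in> fin_measures Q dQ"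
    and \<pi>: "\<pi> \<in> couplings Q dQ \<alpha> \<beta>" and p: "0 < p" and \<epsilon>: "0 < (\<epsilon>::real)"
  shows "\<exists>\<pi>'\<in>couplings UNIV dist (lift \<alpha>) (lift \<beta>).
    (\<integral>\<^sup>+z. ennreal (dist (fst z) (snd z) powr p) \<partial>\<pi>')
      \<le> (\<integral>\<^sup>+z. ennreal (dQ (fst z) (snd z) powr p) \<partial>\<pi>) + ennreal \<epsilon>"
proof -
  have s: "sets \<pi> = sets M2" and pr: "prob_space \<pi>"
    and m: "\<And>A. A \<in> sets MQ \<Longrightarrow> mass \<alpha> * measure \<pi> (A \<times> Q) = measure \<alpha> A"
           "\<And>A. A \<in> sets MQ \<Longrightarrow> mass \<beta> * measure \<pi> (Q \<times> A) = measure \<beta> A"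
    using \<pi> unfolding couplings_def by blast+
  interpret \<pi>: prob_space \<pi> by (rule pr)
  have s\<alpha>: "sets \<alpha> = sets MQ" "finite_measure \<alpha>" and s\<beta>: "sets \<beta> = sets MQ" "finite_measure \<beta>"
    using \<alpha> \<beta> by (simp_all add: fin_measures_Q)
  have sp: "space \<pi> = Q \<times> Q" using sets_eq_imp_space_eq[OF s] by simp
  have ne: "space \<pi> \<noteq> {}" by (rule \<pi>.not_empty)
  obtain \<gamma> where \<gamma>: "(\<lambda>z. act (fst z) (\<gamma> z)) \<in> borel \<rightarrow>\<^sub>M borel"
    "\<And>z. dist (act (fst z) (\<gamma> z)) (snd z) powr p \<le> dQ (q (fst z)) (q (snd z)) powr p + \<epsilon>"
    using near_optimal_selection[OF p \<epsilon>] by blast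
  have pk: "pair_kernel \<in> \<pi> \<rightarrow>\<^sub>M subprob_algebra borel"
    using pair_kernel_measurable measurable_cong_sets[OF s refl, of "subprob_algebra (borel :: ('a \<times> 'a) measure)"] by blast
  define \<pi>1 where "\<pi>1 = \<pi> \<bind> pair_kernel"
  have s1: "sets \<pi>1 = sets borel" unfolding \<pi>1_def by (rule sets_bind_measurable[OF pk ne])
  have sp1: "space \<pi>1 = UNIV" using sets_eq_imp_space_eq[OF s1] by simp
  have int1: "(\<integral>\<^sup>+w. F w \<partial>\<pi>1) = (\<integral>\<^sup>+z. \<Phi> z \<partial>\<pi>)"
    if F: "F \<in> borel_measurable borel" and inv: "\<And>x y. F (x, y) = \<Phi> (q x, q y)"
    for F :: "'a \<times> 'a \<Rightarrow> ennreal" and \<Phi>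
  proof -
    have "(\<integral>\<^sup>+w. F w \<partial>\<pi>1) = (\<integral>\<^sup>+z. \<integral>\<^sup>+w. F w \<partial>pair_kernel z \<partial>\<pi>)"
      unfolding \<pi>1_def by (rule nn_integral_bind[OF F pk])
    also have "\<dots> = (\<integral>\<^sup>+z. \<Phi> z \<partial>\<pi>)"
    proof (rule nn_integral_cong)
      fix z assume "z \<in> space \<pi>"
      then obtain x y where "z = (q x, q y)" unfolding sp by (auto simp: orbit_space_def)
      then show "(\<integral>\<^sup>+w. F w \<partial>pair_kernel z) = \<Phi> z"
        using nn_integral_pair_kernel_invariant[OF F inv] by simp
    qed
    finally show ?thesis .
  qed
  define S where "S z g = (act (act (fst z) (\<gamma> z)) g, act (snd z) g)" for z g
  have S: "(\<lambda>(z, g). S z g) \<in> borel \<Otimes>\<^sub>M H \<rightarrow>\<^sub>M borel"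
  proof -
    have a: "(\<lambda>w. act (f (fst w)) (snd w)) \<in> borel \<Otimes>\<^sub>M H \<rightarrow>\<^sub>M borel" if f: "f \<in> borel \<rightarrow>\<^sub>M borel"
      for f :: "'a \<times> 'a \<Rightarrow> 'a"
    proof -
      have "(\<lambda>w. (f (fst w), snd w)) \<in> borel \<Otimes>\<^sub>M H \<rightarrow>\<^sub>M borel \<Otimes>\<^sub>M H"
        by (intro measurable_Pair measurable_compose[OF measurable_fst f] measurable_snd)
      from measurable_compose[OF this act_measurable_pair] show ?thesis by simp
    qed
    have "(\<lambda>w. (act (act (fst (fst w)) (\<gamma> (fst w))) (snd w), act (snd (fst w)) (snd w)))
        \<in> borel \<Otimes>\<^sub>M H \<rightarrow>\<^sub>M borel \<Otimes>\<^sub>M borel"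
      by (intro measurable_Pair a[OF \<gamma>(1)] a[of snd] borel_measurable_continuous_onI continuous_intros)
    then show ?thesis unfolding borel_prod S_def case_prod_beta .
  qed
  have Sz: "S z \<in> H \<rightarrow>\<^sub>M borel" for z
    using measurable_compose[OF measurable_Pair1' S, of z] by simp
  define K where "K z = distr H borel (S z)" for z
  have K: "K \<in> \<pi>1 \<rightarrow>\<^sub>M subprob_algebra borel"
  proof -
    have "(\<lambda>z. distr H borel (S z)) \<in> borel \<rightarrow>\<^sub>M subprob_algebra borel"
    proof (rule measurable_distr2[OF S])
      show "(\<lambda>z. H) \<in> borel \<rightarrow>\<^sub>M subprob_algebra H"
        by (rule measurable_const) (simp add: space_subprob_algebra H.subprob_space_axioms)
    qed
    then show ?thesis
      using measurable_cong_sets[OF s1 refl, of "subprob_algebra (borel :: ('a \<times> 'a) measure)"]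
      unfolding K_def[abs_def] by blast
  qed
  define \<pi>2 where "\<pi>2 = \<pi>1 \<bind> K"
  have ne1: "space \<pi>1 \<noteq> {}" by (simp add: sp1)
  have s2: "sets \<pi>2 = sets borel" unfolding \<pi>2_def by (rule sets_bind_measurable[OF K ne1])
  have sp2: "space \<pi>2 = UNIV" using sets_eq_imp_space_eq[OF s2] by simp
  have em2: "emeasure \<pi>2 A = (\<integral>\<^sup>+z. emeasure H {g. S z g \<in> A} \<partial>\<pi>1)" if "A \<in> sets borel" for A
    unfolding \<pi>2_def emeasure_bind[OF ne1 K that]
    by (intro nn_integral_cong) (simp add: K_def emeasure_distr[OF Sz that] space_H vimage_def)
  have marg: "emeasure \<pi>2 (A \<times> UNIV) = (\<integral>\<^sup>+z. emeasure (orbit_kernel (fst z)) A \<partial>\<pi>)"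
    "emeasure \<pi>2 (UNIV \<times> A) = (\<integral>\<^sup>+z. emeasure (orbit_kernel (snd z)) A \<partial>\<pi>)"
    if A: "A \<in> sets borel" for A
  proof -
    have r: "A \<times> (UNIV :: 'a set) \<in> sets borel" "(UNIV :: 'a set) \<times> A \<in> sets borel"
      using A by (auto simp flip: borel_prod)
    have em: "(\<lambda>x. emeasure (orbit_law x) A) \<in> borel_measurable borel"
      by (rule measurable_compose[OF orbit_law_measurable measurable_emeasure_subprob_algebra[OF A]])
    have "emeasure \<pi>2 (A \<times> UNIV) = (\<integral>\<^sup>+z. emeasure (orbit_law (fst z)) A \<partial>\<pi>1)"
      unfolding em2[OF r(1)]
      by (intro nn_integral_cong) (simp add: S_def emeasure_orbit_law[OF A, symmetric] orbit_law_act)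
    also have "\<dots> = (\<integral>\<^sup>+z. emeasure (orbit_kernel (fst z)) A \<partial>\<pi>)"
      by (rule int1, rule measurable_compose[OF _ em])
         (intro borel_measurable_continuous_onI continuous_intros, simp add: orbit_kernel_q)
    finally show "emeasure \<pi>2 (A \<times> UNIV) = (\<integral>\<^sup>+z. emeasure (orbit_kernel (fst z)) A \<partial>\<pi>)" .
    have "emeasure \<pi>2 (UNIV \<times> A) = (\<integral>\<^sup>+z. emeasure (orbit_law (snd z)) A \<partial>\<pi>1)"
      unfolding em2[OF r(2)]
      by (intro nn_integral_cong) (simp add: S_def emeasure_orbit_law[OF A, symmetric])
    also have "\<dots> = (\<integral>\<^sup>+z. emeasure (orbit_kernel (snd z)) A \<partial>\<pi>)"
      by (rule int1, rule measurable_compose[OF _ em])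
         (intro borel_measurable_continuous_onI continuous_intros, simp add: orbit_kernel_q)
    finally show "emeasure \<pi>2 (UNIV \<times> A) = (\<integral>\<^sup>+z. emeasure (orbit_kernel (snd z)) A \<partial>\<pi>)" .
  qed
  have em_m: "(\<lambda>P. emeasure (orbit_kernel P) A) \<in> borel_measurable MQ" if "A \<in> sets borel" for A
    by (rule measurable_compose[OF orbit_kernel_subprob measurable_emeasure_subprob_algebra[OF that]])
  have marg_lift: "ennreal (mass m) * (\<integral>\<^sup>+z. emeasure (orbit_kernel (f z)) A \<partial>\<pi>) = emeasure (lift m) A"
    if A: "A \<in> sets borel" and sm: "sets m = sets MQ" "finite_measure m"
      and f: "f \<in> M2 \<rightarrow>\<^sub>M MQ"
      and eq: "\<And>B. B \<in> sets MQ \<Longrightarrow> mass m * measure \<pi> (f -` B \<inter> Q \<times> Q) = measure m B" for A m f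
  proof -
    have f': "f \<in> \<pi> \<rightarrow>\<^sub>M MQ" using f measurable_cong_sets[OF s refl, of MQ] by blast
    \<comment> \<open>The measure \<open>m\<close> is its mass times a marginal of \<open>\<pi>\<close>, also when its mass is \<open>0\<close>.\<close>
    have "m = scale_measure (ennreal (mass m)) (distr \<pi> MQ f)"
    proof (rule measure_eqI)
      fix B assume "B \<in> sets m"
      then have B: "B \<in> sets MQ" by (simp add: sm)
      have "emeasure m B = ennreal (mass m * measure \<pi> (f -` B \<inter> Q \<times> Q))"
        by (simp add: eq[OF B] finite_measure.emeasure_eq_measure[OF sm(2)])
      also have "\<dots> = ennreal (mass m) * emeasure \<pi> (f -` B \<inter> Q \<times> Q)"
        by (simp add: \<pi>.emeasure_eq_measure ennreal_mult' mass_def)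
      finally show "emeasure m B = emeasure (scale_measure (ennreal (mass m)) (distr \<pi> MQ f)) B"
        by (simp add: emeasure_distr[OF f' B] sp)
    qed (simp add: sm)
    then have "(\<integral>\<^sup>+P. emeasure (orbit_kernel P) A \<partial>m)
        = (\<integral>\<^sup>+P. emeasure (orbit_kernel P) A \<partial>scale_measure (ennreal (mass m)) (distr \<pi> MQ f))" by simp
    also have "\<dots> = ennreal (mass m) * (\<integral>\<^sup>+P. emeasure (orbit_kernel P) A \<partial>distr \<pi> MQ f)"
      by (rule nn_integral_scale_measure) (simp only: measurable_distr_eq1 em_m[OF A])
    also have "(\<integral>\<^sup>+P. emeasure (orbit_kernel P) A \<partial>distr \<pi> MQ f) = (\<integral>\<^sup>+z. emeasure (orbit_kernel (f z)) A \<partial>\<pi>)"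
      by (rule nn_integral_distr[OF f']) (simp only: measurable_distr_eq1 em_m[OF A])
    finally show ?thesis by (simp add: emeasure_lift[OF sm(1) A])
  qed
  have Qsub: "B \<subseteq> Q" if "B \<in> sets MQ" for B using sets.sets_into_space[OF that] by simp
  have fst_eq: "mass \<alpha> * measure \<pi> (fst -` B \<inter> Q \<times> Q) = measure \<alpha> B" if "B \<in> sets MQ" for B
  proof -
    have "fst -` B \<inter> Q \<times> Q = B \<times> Q" using Qsub[OF that] by auto
    then show ?thesis using m(1)[OF that] by simp
  qed
  have snd_eq: "mass \<beta> * measure \<pi> (snd -` B \<inter> Q \<times> Q) = measure \<beta> B" if "B \<in> sets MQ" for B
  proof -
    have "snd -` B \<inter> Q \<times> Q = Q \<times> B" using Qsub[OF that] by auto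
    then show ?thesis using m(2)[OF that] by simp
  qed
  have pr2: "prob_space \<pi>2"
  proof (rule prob_spaceI)
    have "emeasure \<pi>2 (space \<pi>2) = (\<integral>\<^sup>+z. emeasure (orbit_kernel (fst z)) UNIV \<partial>\<pi>)"
      using marg(1)[of UNIV] by (simp add: sp2)
    also have "\<dots> = (\<integral>\<^sup>+z. 1 \<partial>\<pi>)"
      using prob_space.emeasure_space_1[OF prob_orbit_law]
      by (intro nn_integral_cong) (simp add: orbit_kernel_def)
    finally show "emeasure \<pi>2 (space \<pi>2) = 1" using \<pi>.emeasure_space_1 by simp
  qed
  interpret \<pi>2: prob_space \<pi>2 by (rule pr2)
  have "\<pi>2 \<in> couplings UNIV dist (lift \<alpha>) (lift \<beta>)"
    unfolding couplings_def mem_Collect_eq borel_metric2_dist borel_metric_dist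
  proof (intro conjI ballI)
    show "sets \<pi>2 = sets borel" by (rule s2)
    show "prob_space \<pi>2" by (rule pr2)
    fix A :: "'a set" assume A: "A \<in> sets borel"
    have nn: "0 \<le> mass \<alpha>" "0 \<le> mass \<beta>" by (simp_all add: mass_def)
    have "emeasure (lift \<alpha>) A = ennreal (mass \<alpha>) * emeasure \<pi>2 (A \<times> UNIV)"
      using marg_lift[OF A s\<alpha> fst_M2 fst_eq] marg(1)[OF A] by simp
    also have "\<dots> = ennreal (mass \<alpha> * measure \<pi>2 (A \<times> UNIV))"
      by (simp add: \<pi>2.emeasure_eq_measure ennreal_mult' nn)
    finally have "measure (lift \<alpha>) A = mass \<alpha> * measure \<pi>2 (A \<times> UNIV)"
      by (simp add: measure_def[of "lift \<alpha>"] nn)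
    then show "mass (lift \<alpha>) * measure \<pi>2 (A \<times> UNIV) = measure (lift \<alpha>) A"
      by (simp add: mass_lift(2)[OF s\<alpha>(1)])
    have "emeasure (lift \<beta>) A = ennreal (mass \<beta>) * emeasure \<pi>2 (UNIV \<times> A)"
      using marg_lift[OF A s\<beta> snd_M2 snd_eq] marg(2)[OF A] by simp
    also have "\<dots> = ennreal (mass \<beta> * measure \<pi>2 (UNIV \<times> A))"
      by (simp add: \<pi>2.emeasure_eq_measure ennreal_mult' nn)
    finally have "measure (lift \<beta>) A = mass \<beta> * measure \<pi>2 (UNIV \<times> A)"
      by (simp add: measure_def[of "lift \<beta>"] nn)
    then show "mass (lift \<beta>) * measure \<pi>2 (UNIV \<times> A) = measure (lift \<beta>) A"
      by (simp add: mass_lift(2)[OF s\<beta>(1)])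
  qed
  moreover have "(\<integral>\<^sup>+z. ennreal (dist (fst z) (snd z) powr p) \<partial>\<pi>2)
      \<le> (\<integral>\<^sup>+z. ennreal (dQ (fst z) (snd z) powr p) \<partial>\<pi>) + ennreal \<epsilon>"
  proof -
    have dm: "(\<lambda>z. ennreal (dist (fst z) (snd z) powr p)) \<in> borel_measurable (borel :: ('a \<times> 'a) measure)"
      unfolding borel_prod[symmetric] by measurable
    have "(\<integral>\<^sup>+z. ennreal (dist (fst z) (snd z) powr p) \<partial>\<pi>2)
        = (\<integral>\<^sup>+z. \<integral>\<^sup>+w. ennreal (dist (fst w) (snd w) powr p) \<partial>K z \<partial>\<pi>1)"
      unfolding \<pi>2_def by (rule nn_integral_bind[OF dm K])
    also have "\<dots> \<le> (\<integral>\<^sup>+z. ennreal (dQ (q (fst z)) (q (snd z)) powr p) + ennreal \<epsilon> \<partial>\<pi>1)"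
    proof (rule nn_integral_mono)
      fix z
      have "(\<integral>\<^sup>+w. ennreal (dist (fst w) (snd w) powr p) \<partial>K z)
          = (\<integral>\<^sup>+g. ennreal (dist (fst (S z g)) (snd (S z g)) powr p) \<partial>H)"
        unfolding K_def by (rule nn_integral_distr[OF Sz]) (simp only: measurable_distr_eq1 dm)
      also have "\<dots> = (\<integral>\<^sup>+g. ennreal (dist (act (fst z) (\<gamma> z)) (snd z) powr p) \<partial>H)"
        by (simp add: S_def iso)
      also have "\<dots> = ennreal (dist (act (fst z) (\<gamma> z)) (snd z) powr p)"
        using H.emeasure_space_1 by simp
      also have "\<dots> \<le> ennreal (dQ (q (fst z)) (q (snd z)) powr p + \<epsilon>)"
        by (rule ennreal_leI[OF \<gamma>(2)])
      also have "\<dots> = ennreal (dQ (q (fst z)) (q (snd z)) powr p) + ennreal \<epsilon>"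
        using \<epsilon> by (intro ennreal_plus) simp_all
      finally show "(\<integral>\<^sup>+w. ennreal (dist (fst w) (snd w) powr p) \<partial>K z)
          \<le> ennreal (dQ (q (fst z)) (q (snd z)) powr p) + ennreal \<epsilon>" .
    qed
    also have "\<dots> = (\<integral>\<^sup>+z. ennreal (dQ (fst z) (snd z) powr p) + ennreal \<epsilon> \<partial>\<pi>)"
    proof (rule int1)
      have "(\<lambda>z. ennreal (dQ (fst (map_prod q q z)) (snd (map_prod q q z)) powr p)) \<in> borel_measurable borel"
        by (rule measurable_compose[OF qq_measurable dQ_powr_measurable(1)[OF p]])
      then show "(\<lambda>z. ennreal (dQ (q (fst z)) (q (snd z)) powr p) + ennreal \<epsilon>) \<in> borel_measurable borel"
        by simp
    qed simp
    also have "\<dots> = (\<integral>\<^sup>+z. ennreal (dQ (fst z) (snd z) powr p) \<partial>\<pi>) + ennreal \<epsilon>"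
    proof -
      have "(\<lambda>z. ennreal (dQ (fst z) (snd z) powr p)) \<in> borel_measurable \<pi>"
        using dQ_powr_measurable(1)[OF p] measurable_cong_sets[OF s refl, of "borel :: ennreal measure"] by blast
      then show ?thesis using \<pi>.emeasure_space_1 by (simp add: nn_integral_add)
    qed
    finally show ?thesis .
  qed
  ultimately show ?thesis by blast
qed

end

section \<open>The generalized Wasserstein distance on the orbit space\<close>

context haar_isometric_action
begin

text \<open>Pushing couplings down gives one inequality, since the lifts have the given measures as images, and
lifting couplings with an arbitrarily small loss gives the other.\<close>

lemma transport_cost_lift:
  assumes \<alpha>: "\<alpha> \<in> fin_measures Q dQ" and \<beta>: "\<beta> \<in> fin_measures Q dQ" and p: "0 < p"
  shows "(INF \<pi>\<in>couplings UNIV dist (lift \<alpha>) (lift \<beta>). \<integral>\<^sup>+ z. ennreal (dist (fst z) (snd z) powr p) \<partial>\<pi>)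
       = (INF \<pi>\<in>couplings Q dQ \<alpha> \<beta>. \<integral>\<^sup>+ z. ennreal (dQ (fst z) (snd z) powr p) \<partial>\<pi>)"
    (is "?up = ?down")
proof (rule antisym)
  show "?up \<le> ?down"
  proof (rule INF_greatest)
    fix \<pi> assume \<pi>: "\<pi> \<in> couplings Q dQ \<alpha> \<beta>"
    show "?up \<le> (\<integral>\<^sup>+ z. ennreal (dQ (fst z) (snd z) powr p) \<partial>\<pi>)"
    proof (rule ennreal_le_epsilon)
      fix e :: real assume "0 < e"
      then obtain \<pi>' where "\<pi>' \<in> couplings UNIV dist (lift \<alpha>) (lift \<beta>)"
        "(\<integral>\<^sup>+z. ennreal (dist (fst z) (snd z) powr p) \<partial>\<pi>')
          \<le> (\<integral>\<^sup>+z. ennreal (dQ (fst z) (snd z) powr p) \<partial>\<pi>) + ennreal e"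
        using couplings_lift[OF \<alpha> \<beta> \<pi> p] by blast
      then show "?up \<le> (\<integral>\<^sup>+ z. ennreal (dQ (fst z) (snd z) powr p) \<partial>\<pi>) + ennreal e"
        by (rule INF_lower2)
    qed
  qed
  have s: "sets \<alpha> = sets MQ" "sets \<beta> = sets MQ" using \<alpha> \<beta> by (simp_all add: fin_measures_Q)
  show "?down \<le> ?up"
  proof (rule INF_greatest)
    fix \<pi> assume \<pi>: "\<pi> \<in> couplings UNIV dist (lift \<alpha>) (lift \<beta>)"
    note push = couplings_push[OF sets_lift[OF s(1)] sets_lift[OF s(2)] \<pi> p]
    show "?down \<le> (\<integral>\<^sup>+ z. ennreal (dist (fst z) (snd z) powr p) \<partial>\<pi>)"
      using push unfolding push_lift[OF s(1)] push_lift[OF s(2)] by (rule INF_lower2)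
  qed
qed

lemma wasserstein_lift:
  assumes "\<alpha> \<in> fin_measures Q dQ" "\<beta> \<in> fin_measures Q dQ" "0 < p"
  shows "wasserstein p UNIV dist (lift \<alpha>) (lift \<beta>) = wasserstein p Q dQ \<alpha> \<beta>"
  using assms unfolding wasserstein_def transport_cost_lift[OF assms]
  by (simp add: mass_lift(2) fin_measures_Q)

lemma wasserstein_push_le:
  assumes \<mu>: "\<mu> \<in> fin_measures_p p UNIV dist" and \<nu>: "\<nu> \<in> fin_measures_p p UNIV dist"
    and p: "0 < p" and m: "mass \<mu> = mass \<nu>"
  shows "wasserstein p Q dQ (push_orbit act \<mu>) (push_orbit act \<nu>) \<le> wasserstein p UNIV dist \<mu> \<nu>"
proof -
  have s: "sets \<mu> = sets borel" "sets \<nu> = sets borel"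
    using \<mu> \<nu> by (simp_all add: fin_measures_p_def fin_measures_UNIV)
  have "(INF \<pi>\<in>couplings Q dQ (push_orbit act \<mu>) (push_orbit act \<nu>). \<integral>\<^sup>+ z. ennreal (dQ (fst z) (snd z) powr p) \<partial>\<pi>)
      \<le> (INF \<pi>\<in>couplings UNIV dist \<mu> \<nu>. \<integral>\<^sup>+ z. ennreal (dist (fst z) (snd z) powr p) \<partial>\<pi>)"
  proof (rule INF_greatest)
    fix \<pi> assume "\<pi> \<in> couplings UNIV dist \<mu> \<nu>"
    from couplings_push[OF s this p]
    show "(INF \<pi>\<in>couplings Q dQ (push_orbit act \<mu>) (push_orbit act \<nu>). \<integral>\<^sup>+ z. ennreal (dQ (fst z) (snd z) powr p) \<partial>\<pi>)
      \<le> (\<integral>\<^sup>+ z. ennreal (dist (fst z) (snd z) powr p) \<partial>\<pi>)"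
      by (rule INF_lower2)
  qed
  then show ?thesis
    using finite_product_cost[OF \<mu> \<nu> p m] p
    unfolding wasserstein_def mass_push[OF s(1)]
    by (intro powr_mono2 enn2real_mono mult_left_mono) (auto simp: less_top)
qed

lemma tv_diff_push_le:
  assumes "\<mu> \<in> fin_measures UNIV dist" "\<nu> \<in> fin_measures UNIV dist"
  shows "tv_diff (push_orbit act \<mu>) (push_orbit act \<nu>) \<le> tv_diff \<mu> \<nu>"
proof -
  have \<mu>: "sets \<mu> = sets borel" "finite_measure \<mu>" and \<nu>: "sets \<nu> = sets borel" "finite_measure \<nu>"
    using assms by (simp_all add: fin_measures_UNIV)
  have sp: "space \<mu> = UNIV" "space \<nu> = UNIV"
    using sets_eq_imp_space_eq[OF \<mu>(1)] sets_eq_imp_space_eq[OF \<nu>(1)] by simp_all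
  have eq: "push_orbit act m = m \<bind> (\<lambda>x. return MQ (q x))" if "sets m = sets borel" "space m = UNIV" for m
    unfolding push_orbit_def by (rule bind_return_distr'[symmetric]) (simp_all add: that push_measurable)
  have "(\<lambda>x. return MQ (q x)) \<in> \<mu> \<rightarrow>\<^sub>M prob_algebra MQ"
    by (rule measurable_compose[OF push_measurable[OF \<mu>(1)] measurable_return_prob_space])
  then show ?thesis
    unfolding eq[OF \<mu>(1) sp(1)] eq[OF \<nu>(1) sp(2)]
    by (intro tv_diff_bind_le) (simp_all add: \<mu> \<nu> sp)
qed

lemma tv_diff_lift_le:
  assumes "\<alpha> \<in> fin_measures Q dQ" "\<beta> \<in> fin_measures Q dQ"
  shows "tv_diff (lift \<alpha>) (lift \<beta>) \<le> tv_diff \<alpha> \<beta>"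
proof -
  have \<alpha>: "sets \<alpha> = sets MQ" "finite_measure \<alpha>" and \<beta>: "sets \<beta> = sets MQ" "finite_measure \<beta>"
    using assms by (simp_all add: fin_measures_Q)
  have "orbit_kernel \<in> \<alpha> \<rightarrow>\<^sub>M prob_algebra borel"
    using orbit_kernel_measurable measurable_cong_sets[OF \<alpha>(1) refl, of "prob_algebra borel"] by blast
  then show ?thesis
    unfolding lift_def by (intro tv_diff_bind_le) (simp_all add: \<alpha> \<beta> space_\<nu>_ne)
qed

lemma gen_wasserstein_push_le:
  assumes \<mu>: "\<mu> \<in> fin_measures UNIV dist" and \<nu>: "\<nu> \<in> fin_measures UNIV dist"
    and ab: "0 < a" "0 < b" and p: "0 < p"
  shows "gen_wasserstein a b p Q dQ (push_orbit act \<mu>) (push_orbit act \<nu>)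
    \<le> gen_wasserstein a b p UNIV dist \<mu> \<nu>"
proof (rule gen_wasserstein_greatest[OF null_measure_fin_p])
  fix \<mu>' \<nu>' :: "'a measure"
  assume \<mu>': "\<mu>' \<in> fin_measures_p p UNIV dist" and \<nu>': "\<nu>' \<in> fin_measures_p p UNIV dist"
    and m: "mass \<mu>' = mass \<nu>'"
  have s: "sets \<mu>' = sets borel" "sets \<nu>' = sets borel"
    using \<mu>' \<nu>' by (simp_all add: fin_measures_p_def fin_measures_UNIV)
  have "gen_wasserstein a b p Q dQ (push_orbit act \<mu>) (push_orbit act \<nu>)
      \<le> a * tv_diff (push_orbit act \<mu>) (push_orbit act \<mu>') + a * tv_diff (push_orbit act \<nu>) (push_orbit act \<nu>')
        + b * wasserstein p Q dQ (push_orbit act \<mu>') (push_orbit act \<nu>')"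
    using ab by (intro gen_wasserstein_le push_fin \<mu> \<nu> push_fin_p \<mu>' \<nu>' p) (simp_all add: mass_push s m)
  also have "\<dots> \<le> a * tv_diff \<mu> \<mu>' + a * tv_diff \<nu> \<nu>' + b * wasserstein p UNIV dist \<mu>' \<nu>'"
    using ab tv_diff_push_le[OF \<mu> fin_measures_p_imp[OF \<mu>']] tv_diff_push_le[OF \<nu> fin_measures_p_imp[OF \<nu>']]
      wasserstein_push_le[OF \<mu>' \<nu>' p m]
    by (intro add_mono mult_left_mono) simp_all
  finally show "gen_wasserstein a b p Q dQ (push_orbit act \<mu>) (push_orbit act \<nu>)
      \<le> a * tv_diff \<mu> \<mu>' + a * tv_diff \<nu> \<nu>' + b * wasserstein p UNIV dist \<mu>' \<nu>'" .
qed

lemma inv_measures_fin: "\<mu> \<in> inv_measures act \<Longrightarrow> \<mu> \<in> fin_measures UNIV dist"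
  by (simp add: inv_measures_def)

lemma gen_wasserstein_push_eq:
  assumes \<mu>: "\<mu> \<in> inv_measures act" and \<nu>: "\<nu> \<in> inv_measures act"
    and ab: "0 < a" "0 < b" and p: "0 < p"
  shows "gen_wasserstein a b p Q dQ (push_orbit act \<mu>) (push_orbit act \<nu>) = gen_wasserstein a b p UNIV dist \<mu> \<nu>"
proof (rule antisym)
  note fin = inv_measures_fin[OF \<mu>] inv_measures_fin[OF \<nu>]
  show "gen_wasserstein a b p Q dQ (push_orbit act \<mu>) (push_orbit act \<nu>) \<le> gen_wasserstein a b p UNIV dist \<mu> \<nu>"
    by (rule gen_wasserstein_push_le[OF fin ab p])
  show "gen_wasserstein a b p UNIV dist \<mu> \<nu> \<le> gen_wasserstein a b p Q dQ (push_orbit act \<mu>) (push_orbit act \<nu>)"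
  proof (rule gen_wasserstein_greatest[OF push_fin_p[OF null_measure_fin_p p]])
    fix \<alpha> \<beta> assume \<alpha>: "\<alpha> \<in> fin_measures_p p Q dQ" and \<beta>: "\<beta> \<in> fin_measures_p p Q dQ"
      and m: "mass \<alpha> = mass \<beta>"
    note fin' = fin_measures_p_imp[OF \<alpha>] fin_measures_p_imp[OF \<beta>]
    have s: "sets \<alpha> = sets MQ" "sets \<beta> = sets MQ" using fin' by (simp_all add: fin_measures_Q)
    have "gen_wasserstein a b p UNIV dist \<mu> \<nu>
        \<le> a * tv_diff \<mu> (lift \<alpha>) + a * tv_diff \<nu> (lift \<beta>) + b * wasserstein p UNIV dist (lift \<alpha>) (lift \<beta>)"
      using ab by (intro gen_wasserstein_le fin lift_fin_p \<alpha> \<beta> p) (simp_all add: mass_lift(2) s m)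
    also have "tv_diff \<mu> (lift \<alpha>) \<le> tv_diff (push_orbit act \<mu>) \<alpha>"
      using tv_diff_lift_le[OF push_fin[OF fin(1)] fin'(1)] by (simp add: lift_push[OF \<mu>])
    also have "tv_diff \<nu> (lift \<beta>) \<le> tv_diff (push_orbit act \<nu>) \<beta>"
      using tv_diff_lift_le[OF push_fin[OF fin(2)] fin'(2)] by (simp add: lift_push[OF \<nu>])
    finally show "gen_wasserstein a b p UNIV dist \<mu> \<nu>
        \<le> a * tv_diff (push_orbit act \<mu>) \<alpha> + a * tv_diff (push_orbit act \<nu>) \<beta> + b * wasserstein p Q dQ \<alpha> \<beta>"
      using ab by (simp add: wasserstein_lift[OF fin' p])
  qed
qed

lemma lift_fin_p_inv:
  assumes "\<nu> \<in> fin_measures_p p Q dQ" "0 < p"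
  shows "lift \<nu> \<in> inv_measures_p p act"
  using lift_fin_p[OF assms] lift_inv[OF fin_measures_p_imp[OF assms(1)]]
  by (simp add: inv_measures_p_def)

end

theorem theorem1p4:
  fixes act :: "'a::polish_space \<Rightarrow> 'g::topological_group_add \<Rightarrow> 'a"
    and a b p :: real
  assumes "locally_compact_space (euclidean :: 'a topology)"
    and "compact (UNIV :: 'g set)"
    and "right_action act"
    and "continuous_on UNIV (\<lambda>(x, g). act x g)"
    and "\<And>x y g. dist (act x g) (act y g) = dist x y"
    and "a > 0" and "b > 0" and "p \<ge> 1"
  shows "push_orbit act ` fin_measures_p p UNIV dist
           = fin_measures_p p (orbit_space act) (orbit_dist act)
       \<and> (\<forall>\<nu>\<in>fin_measures_p p (orbit_space act) (orbit_dist act).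
            \<exists>\<mu>\<in>inv_measures_p p act. push_orbit act \<mu> = \<nu>)
       \<and> (\<forall>\<mu>\<in>fin_measures UNIV dist. \<forall>\<nu>\<in>fin_measures UNIV dist.
            gen_wasserstein a b p (orbit_space act) (orbit_dist act)
                (push_orbit act \<mu>) (push_orbit act \<nu>)
              \<le> gen_wasserstein a b p UNIV dist \<mu> \<nu>)
       \<and> isometry_between
            (inv_measures act) (gen_wasserstein a b p UNIV dist)
            (fin_measures (orbit_space act) (orbit_dist act))
            (gen_wasserstein a b p (orbit_space act) (orbit_dist act))
            (push_orbit act)
       \<and> isometry_between
            (inv_measures_p p act) (gen_wasserstein a b p UNIV dist)
            (fin_measures_p p (orbit_space act) (orbit_dist act))
            (gen_wasserstein a b p (orbit_space act) (orbit_dist act))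
            (push_orbit act)"
proof -
  obtain H :: "'g measure" where H: "prob_space H" "space H = UNIV"
    "\<And>f::'g \<Rightarrow> real. continuous_on UNIV f \<Longrightarrow> f \<in> borel_measurable H"
    "\<And>k. (\<lambda>g. k + g) \<in> H \<rightarrow>\<^sub>M H" "\<And>k. distr H H (\<lambda>g. k + g) = H"
    "\<And>k. (\<lambda>g. g + k) \<in> H \<rightarrow>\<^sub>M H" "\<And>k. distr H H (\<lambda>g. g + k) = H"
    by (rule haar_probability_exists[OF assms(2)]) (rule that; assumption)
  interpret haar_isometric_action act H
    by (rule haar_isometric_action.intro) (fact assms H)+
  have p: "0 < p" using assms(8) by simp
  have s: "sets \<nu> = sets MQ" if "\<nu> \<in> fin_measures Q dQ" for \<nu> using that by (simp add: fin_measures_Q)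
  have onto_p: "\<exists>\<mu>\<in>inv_measures_p p act. push_orbit act \<mu> = \<nu>" if "\<nu> \<in> fin_measures_p p Q dQ" for \<nu>
    using lift_fin_p_inv[OF that p] push_lift[OF s[OF fin_measures_p_imp[OF that]]] by blast
  have onto: "\<exists>\<mu>\<in>inv_measures act. push_orbit act \<mu> = \<nu>" if "\<nu> \<in> fin_measures Q dQ" for \<nu>
    using lift_inv[OF that] push_lift[OF s[OF that]] by blast
  have inv_p: "\<mu> \<in> fin_measures_p p UNIV dist" "\<mu> \<in> inv_measures act" if "\<mu> \<in> inv_measures_p p act" for \<mu>
    using that by (simp_all add: inv_measures_p_def)
  show ?thesis
    unfolding isometry_between_def
  proof (intro conjI ballI)
    show "push_orbit act ` fin_measures_p p UNIV dist = fin_measures_p p Q dQ"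
      using push_fin_p[OF _ p] onto_p inv_p by blast
    show "push_orbit act ` inv_measures act = fin_measures Q dQ"
      using push_fin[OF inv_measures_fin] onto by blast
    show "push_orbit act ` inv_measures_p p act = fin_measures_p p Q dQ"
      using push_fin_p[OF inv_p(1) p] onto_p by blast
  qed (fact onto_p gen_wasserstein_push_le[OF _ _ assms(6,7) p]
      gen_wasserstein_push_eq[OF _ _ assms(6,7) p]
      gen_wasserstein_push_eq[OF inv_p(2) inv_p(2) assms(6,7) p])+
qed

end
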